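(* Let $\varphi_0<\varphi_1$ and $\varepsilon\in(0,\varepsilon_0)$, $\varepsilon_0=1/(\varphi_1-\varphi_0)$. The functional $\Lambda^*:L^\infty([0,1])\to\mathbb R$ is lower semicontinuous (for the weak* topology) and convex. Moreover, for each $\rho\in L^\infty([0,1])$ we have $$D^-_{\mathrm G}\Lambda^*(\rho)=\partial\Lambda^*(\rho)=\mathrm{co}\,\mathscr F(\rho),$$ $$D^+_{\mathrm G}\Lambda^*(\rho)=\begin{cases}\{\varphi\}&\text{if }\mathscr F(\rho)=\{\varphi\}\text{ for some }\varphi\in\mathcal F,\\ \varnothing&\text{otherwise.}\end{cases}$$ In particular, $\Lambda^*$ is Gâteaux differentiable at $\rho$ if and only if $\mathscr F(\rho)$ is a singleton.
   Context: $L^\infty([0,1])$ is endowed with the weak* topology and is in duality with $L^1([0,1])$ (endowed with the weak topology) through $\langle\rho,\varphi\rangle=\int_0^1\rho\varphi\,dx$; (sub/super)differentials of functionals on $L^\infty([0,1])$ are subsets of $L^1([0,1])$. $\mathcal F$ is the set of functions $\varphi(x)=\varphi_0+\mu([0,x])$, $x\in[0,1]$, with $\mu=d\varphi$ a positive Borel measure on $[0,1]$ of total mass $\varphi_1-\varphi_0$. $s(a)=a\log a+(1-a)\log(1-a)$ for $a\in[0,1]$ (with $0\log0=0$), $+\infty$ otherwise. $\Lambda:L^1([0,1])\to(-\infty,+\infty]$ is $$\Lambda(\varphi)=\int_0^1\big[s(\varepsilon\varphi_x)+\varphi-\log(1+e^\varphi)\big]dx\ \text{ if }\varphi\in\mathcal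 F,\qquad \Lambda(\varphi)=+\infty\ \text{ otherwise},$$ where it is understood that $\Lambda(\varphi)=+\infty$ unless $d\varphi$ is absolutely continuous with density $\varphi_x$ satisfying $0\le\varepsilon\varphi_x\le1$ a.e. $\Lambda^*(\rho)=\sup_{\varphi\in L^1([0,1])}\{\langle\rho,\varphi\rangle-\Lambda(\varphi)\}$, and $\mathscr F(\rho)\subset\mathcal F$ is the (non-empty) set of maximizers in this supremum. $\mathrm{co}$ denotes the convex hull. For vector spaces $X,X^*$ in duality, $g:X\to(-\infty,+\infty]$ and $x\in X$ with $g(x)<\infty$: $D^+_{\mathrm G}g(x)$ (resp. $D^-_{\mathrm G}g(x)$) is the set of $\ell\in X^*$ such that for every $v\in X$, $\limsup_{\lambda\downarrow0}\lambda^{-1}[g(x+\lambda v)-g(x)-\lambda\langle\ell,v\rangle]\le0$ (resp. $\liminf_{\lambda\downarrow0}\lambda^{-1}[\dots]\ge0$). $g$ is Gâteaux differentiable at $x$ if there is $\ell\in X^*$ with $\lim_{\lambda\downarrow0}\lambda^{-1}[g(x+\lambda v)-g(x)-\lambda\langle\ell,v\rangle]=0$ for all $v\in X$. For convex $g$, $\partial g(x)=\{\ell\in X^*:g(y)-g(x)\ge\langle\ell,y-x\rangle\ \forall y\in X\}$. *)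

theory Defs
  imports "HOL-Analysis.Analysis"
begin

abbreviation leb01 :: "real measure" where
  "leb01 \<equiv> restrict_space lborel {0..1}"

section \<open>The spaces of integrable and of essentially bounded functions on the unit interval\<close>

lemma part_equivp_AE_eq:
  assumes "P f0"
  shows "part_equivp (\<lambda>f g. P f \<and> P g \<and> (AE x in M. f x = g x))"
proof (rule part_equivpI)
  show "\<exists>f. P f \<and> P f \<and> (AE x in M. f x = f x)"
    by (rule exI[of _ f0]) (simp add: assms)
  show "symp (\<lambda>f g. P f \<and> P g \<and> (AE x in M. f x = g x))"
    by (rule sympI) (simp add: eq_commute)
  show "transp (\<lambda>f g. P f \<and> P g \<and> (AE x in M. f x = g x))"
  proof (rule transpI, intro conjI)
    fix f g h
    assume fg: "P f \<and> P g \<and> (AE x in M. f x = g x)" and gh: "P g \<and> P h \<and> (AE x in M. g x = h x)"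
    show "P f" "P h" using fg gh by simp_all
    from fg gh have "AE x in M. f x = g x" "AE x in M. g x = h x" by simp_all
    then show "AE x in M. f x = h x" by eventually_elim simp
  qed
qed

lemma AE_eq_op:
  assumes "AE x in M. f x = g x" "AE x in M. h x = k x"
  shows "AE x in M. F (f x) (h x) = F (g x) (k x)"
  using assms by eventually_elim simp

lemma AE_eq_scale:
  assumes "AE x in M. f x = g x"
  shows "AE x in M. (c :: real) * f x = c * g x"
  using assms by eventually_elim simp

text \<open>Both spaces consist of classes modulo almost everywhere equality. Representatives are Borel
  measurable, which gives the same classes as Lebesgue measurability; their values outside
  the unit interval are irrelevant.\<close>

quotient_type L1 = "real \<Rightarrow> real" / partial:
  "\<lambda>f g. integrable leb01 f \<and> integrable leb01 g \<and> (AE x in leb01. f x = g x)"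
  by (rule part_equivp_AE_eq[where P = "integrable leb01" and ?f0.0 = "\<lambda>_. 0"]) simp

definition ess_bounded01 :: "(real \<Rightarrow> real) \<Rightarrow> bool" where
  "ess_bounded01 f \<longleftrightarrow> f \<in> borel_measurable leb01 \<and> (\<exists>C. AE x in leb01. \<bar>f x\<bar> \<le> C)"

lemma ess_bounded01_zero: "ess_bounded01 (\<lambda>_. 0)"
  by (auto simp: ess_bounded01_def intro: exI[of _ 0])

lemma ess_bounded01_add:
  assumes "ess_bounded01 f" "ess_bounded01 g"
  shows "ess_bounded01 (\<lambda>x. f x + g x)"
proof -
  obtain C D where "AE x in leb01. \<bar>f x\<bar> \<le> C" "AE x in leb01. \<bar>g x\<bar> \<le> D"
    using assms by (auto simp: ess_bounded01_def)
  then have "AE x in leb01. \<bar>f x + g x\<bar> \<le> C + D"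
    by eventually_elim linarith
  then show ?thesis
    using assms by (auto simp: ess_bounded01_def intro!: borel_measurable_add)
qed

lemma ess_bounded01_scale:
  assumes "ess_bounded01 f"
  shows "ess_bounded01 (\<lambda>x. c * f x)"
proof -
  obtain C where "AE x in leb01. \<bar>f x\<bar> \<le> C"
    using assms by (auto simp: ess_bounded01_def)
  then have "AE x in leb01. \<bar>c * f x\<bar> \<le> \<bar>c\<bar> * C"
    by eventually_elim (simp add: abs_mult mult_left_mono)
  then show ?thesis
    using assms by (auto simp: ess_bounded01_def intro!: borel_measurable_times)
qed

lemma ess_bounded01_diff:
  assumes "ess_bounded01 f" "ess_bounded01 g"
  shows "ess_bounded01 (\<lambda>x. f x - g x)"
  using ess_bounded01_add[OF assms(1) ess_bounded01_scale[OF assms(2), of "-1"]] by simp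

lemma ess_bounded01_uminus: "ess_bounded01 f \<Longrightarrow> ess_bounded01 (\<lambda>x. - f x)"
  using ess_bounded01_scale[of f "-1"] by simp

lemmas ess_bounded01_rules =
  ess_bounded01_zero ess_bounded01_add ess_bounded01_diff ess_bounded01_scale ess_bounded01_uminus

quotient_type Linf = "real \<Rightarrow> real" / partial:
  "\<lambda>f g. ess_bounded01 f \<and> ess_bounded01 g \<and> (AE x in leb01. f x = g x)"
  by (rule part_equivp_AE_eq[where P = ess_bounded01, OF ess_bounded01_zero])

instantiation L1 :: real_vector
begin

lift_definition zero_L1 :: L1 is "\<lambda>_. 0" by simp

lift_definition plus_L1 :: "L1 \<Rightarrow> L1 \<Rightarrow> L1" is "\<lambda>f g x. f x + g x"
  by (elim conjE, intro conjI AE_eq_op[where F = "(+)"] Bochner_Integration.integrable_add)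

lift_definition uminus_L1 :: "L1 \<Rightarrow> L1" is "\<lambda>f x. - f x"
  by simp

lift_definition minus_L1 :: "L1 \<Rightarrow> L1 \<Rightarrow> L1" is "\<lambda>f g x. f x - g x"
  by (elim conjE, intro conjI AE_eq_op[where F = "(-)"] Bochner_Integration.integrable_diff)

lift_definition scaleR_L1 :: "real \<Rightarrow> L1 \<Rightarrow> L1" is "\<lambda>c f x. c * f x"
  by (elim conjE, intro conjI AE_eq_scale integrable_mult_right impI)

instance
proof
  fix a b :: real and x y z :: L1
  show "x + y + z = x + (y + z)" by transfer (simp add: add.assoc)
  show "x + y = y + x" by transfer (simp add: add.commute)
  show "0 + x = x" by transfer simp
  show "- x + x = 0" by transfer simp
  show "x - y = x + - y" by transfer simp
  show "a *\<^sub>R (x + y) = a *\<^sub>R x + a *\<^sub>R y" by transfer (simp add: distrib_left)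
  show "(a + b) *\<^sub>R x = a *\<^sub>R x + b *\<^sub>R x" by transfer (simp add: distrib_right)
  show "a *\<^sub>R b *\<^sub>R x = (a * b) *\<^sub>R x" by transfer (simp add: mult.assoc)
  show "1 *\<^sub>R x = x" by transfer simp
qed

end

instantiation Linf :: real_vector
begin

lift_definition zero_Linf :: Linf is "\<lambda>_. 0" by (simp add: ess_bounded01_zero)

lift_definition plus_Linf :: "Linf \<Rightarrow> Linf \<Rightarrow> Linf" is "\<lambda>f g x. f x + g x"
  by (elim conjE, intro conjI AE_eq_op[where F = "(+)"] ess_bounded01_add)

lift_definition uminus_Linf :: "Linf \<Rightarrow> Linf" is "\<lambda>f x. - f x"
  by (simp add: ess_bounded01_uminus)

lift_definition minus_Linf :: "Linf \<Rightarrow> Linf \<Rightarrow> Linf" is "\<lambda>f g x. f x - g x"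
  by (elim conjE, intro conjI AE_eq_op[where F = "(-)"] ess_bounded01_diff)

lift_definition scaleR_Linf :: "real \<Rightarrow> Linf \<Rightarrow> Linf" is "\<lambda>c f x. c * f x"
  by (elim conjE, intro conjI AE_eq_scale ess_bounded01_scale)

instance
proof
  fix a b :: real and x y z :: Linf
  show "x + y + z = x + (y + z)" by transfer (simp add: add.assoc ess_bounded01_rules)
  show "x + y = y + x" by transfer (simp add: add.commute ess_bounded01_rules)
  show "0 + x = x" by transfer simp
  show "- x + x = 0" by transfer (simp add: ess_bounded01_rules)
  show "x - y = x + - y" by transfer (simp add: ess_bounded01_rules)
  show "a *\<^sub>R (x + y) = a *\<^sub>R x + a *\<^sub>R y" by transfer (simp add: distrib_left ess_bounded01_rules)
  show "(a + b) *\<^sub>R x = a *\<^sub>R x + b *\<^sub>R x" by transfer (simp add: distrib_right ess_bounded01_rules)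
  show "a *\<^sub>R b *\<^sub>R x = (a * b) *\<^sub>R x" by transfer (simp add: mult.assoc ess_bounded01_rules)
  show "1 *\<^sub>R x = x" by transfer simp
qed

end

lift_definition pairing :: "Linf \<Rightarrow> L1 \<Rightarrow> real" is
  "\<lambda>\<rho> \<phi>. \<integral>x. \<rho> x * \<phi> x \<partial>leb01"
proof (elim conjE, rule integral_cong_AE)
  fix f g h k :: "real \<Rightarrow> real"
  assume "ess_bounded01 f" "ess_bounded01 g" "integrable leb01 h" "integrable leb01 k"
  then show "(\<lambda>x. f x * h x) \<in> borel_measurable leb01" "(\<lambda>x. g x * k x) \<in> borel_measurable leb01"
    unfolding ess_bounded01_def by (blast intro: borel_measurable_times borel_measurable_integrable)+
qed (rule AE_eq_op[where F = "(*)"])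

definition weak_star :: "Linf topology" where
  "weak_star = topology_generated_by {(\<lambda>\<rho>. pairing \<rho> \<phi>) -` U | \<phi> U. open U}"

section \<open>Semicontinuity and differentials of extended real functionals\<close>

definition lower_semicontinuous :: "'x topology \<Rightarrow> ('x \<Rightarrow> ereal) \<Rightarrow> bool" where
  "lower_semicontinuous T g \<longleftrightarrow> (\<forall>t. openin T {x \<in> topspace T. t < g x})"

text \<open>The argument \<open>b\<close> is the bilinear pairing of the space with its dual.
  The definitions are meant for points \<open>x\<close> where \<open>g x\<close> is finite.\<close>

definition diff_remainder ::
  "('x::real_vector \<Rightarrow> 'y \<Rightarrow> real) \<Rightarrow> ('x \<Rightarrow> ereal) \<Rightarrow> 'x \<Rightarrow> 'y \<Rightarrow> 'x \<Rightarrow> real \<Rightarrow> ereal" where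
  "diff_remainder b g x l v t = (g (x + t *\<^sub>R v) - g x - ereal (t * b v l)) / ereal t"

definition gateaux_superdiff ::
  "('x::real_vector \<Rightarrow> 'y \<Rightarrow> real) \<Rightarrow> ('x \<Rightarrow> ereal) \<Rightarrow> 'x \<Rightarrow> 'y set" where
  "gateaux_superdiff b g x = {l. \<forall>v. Limsup (at_right 0) (diff_remainder b g x l v) \<le> 0}"

definition gateaux_subdiff ::
  "('x::real_vector \<Rightarrow> 'y \<Rightarrow> real) \<Rightarrow> ('x \<Rightarrow> ereal) \<Rightarrow> 'x \<Rightarrow> 'y set" where
  "gateaux_subdiff b g x = {l. \<forall>v. Liminf (at_right 0) (diff_remainder b g x l v) \<ge> 0}"

definition gateaux_differentiable ::
  "('x::real_vector \<Rightarrow> 'y \<Rightarrow> real) \<Rightarrow> ('x \<Rightarrow> ereal) \<Rightarrow> 'x \<Rightarrow> bool" where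
  "gateaux_differentiable b g x \<longleftrightarrow>
     (\<exists>l. \<forall>v. (diff_remainder b g x l v \<longlongrightarrow> 0) (at_right 0))"

definition subdifferential ::
  "('x::real_vector \<Rightarrow> 'y \<Rightarrow> real) \<Rightarrow> ('x \<Rightarrow> ereal) \<Rightarrow> 'x \<Rightarrow> 'y set" where
  "subdifferential b g x = {l. \<forall>y. g y - g x \<ge> ereal (b (y - x) l)}"

section \<open>The functional and its Legendre transform\<close>

text \<open>Since \<open>ln 0 = 0\<close>, the convention \<open>0 log 0 = 0\<close> is automatic.\<close>

definition s_entropy :: "real \<Rightarrow> ereal" where
  "s_entropy a = (if a \<in> {0..1} then ereal (a * ln a + (1 - a) * ln (1 - a)) else \<infinity>)"

text \<open>\<open>f\<close> agrees almost everywhere with \<open>x \<mapsto> \<phi>0 + \<mu> [0, x]\<close>, where \<open>\<mu>\<close> is a positive Borel measure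
  on the unit interval with total mass \<open>\<phi>1 - \<phi>0\<close>. The measure may have atoms, also at the
  end points; it is uniquely determined by the class of \<open>f\<close>.\<close>

definition has_dmeasure :: "real \<Rightarrow> real \<Rightarrow> (real \<Rightarrow> real) \<Rightarrow> real measure \<Rightarrow> bool" where
  "has_dmeasure \<phi>0 \<phi>1 f \<mu> \<longleftrightarrow>
     sets \<mu> = sets (restrict_space borel {0..1}) \<and>
     emeasure \<mu> {0..1} = ennreal (\<phi>1 - \<phi>0) \<and>
     (AE x in leb01. f x = \<phi>0 + measure \<mu> {0..x})"

lemma has_dmeasure_cong:
  assumes "AE x in leb01. f x = g x"
  shows "has_dmeasure \<phi>0 \<phi>1 f = has_dmeasure \<phi>0 \<phi>1 g"
proof (rule ext)
  fix \<mu>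
  have "(AE x in leb01. f x = \<phi>0 + measure \<mu> {0..x}) \<longleftrightarrow> (AE x in leb01. g x = \<phi>0 + measure \<mu> {0..x})"
    by (rule eventually_subst) (use assms in \<open>eventually_elim, simp\<close>)
  then show "has_dmeasure \<phi>0 \<phi>1 f \<mu> = has_dmeasure \<phi>0 \<phi>1 g \<mu>"
    by (simp add: has_dmeasure_def)
qed

lift_definition is_profile :: "real \<Rightarrow> real \<Rightarrow> L1 \<Rightarrow> bool" is
  "\<lambda>\<phi>0 \<phi>1 f. \<exists>\<mu>. has_dmeasure \<phi>0 \<phi>1 f \<mu>"
  by (elim conjE) (simp only: has_dmeasure_cong)

definition profiles :: "real \<Rightarrow> real \<Rightarrow> L1 set" where
  "profiles \<phi>0 \<phi>1 = {\<phi>. is_profile \<phi>0 \<phi>1 \<phi>}"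

definition dmeasure :: "real \<Rightarrow> real \<Rightarrow> (real \<Rightarrow> real) \<Rightarrow> real measure" where
  "dmeasure \<phi>0 \<phi>1 f = (THE \<mu>. has_dmeasure \<phi>0 \<phi>1 f \<mu>)"

definition ddensity :: "real \<Rightarrow> real \<Rightarrow> (real \<Rightarrow> real) \<Rightarrow> real \<Rightarrow> real" where
  "ddensity \<phi>0 \<phi>1 f x = enn2real (RN_deriv leb01 (dmeasure \<phi>0 \<phi>1 f) x)"

text \<open>The second and third condition express that \<open>\<Lambda>\<close> is infinite unless \<open>d\<phi>\<close> is absolutely
  continuous with density \<open>\<phi>\<^sub>x\<close> satisfying \<open>0 \<le> \<epsilon> \<phi>\<^sub>x \<le> 1\<close>; then \<open>s_entropy\<close> is finite in the integrand.\<close>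

definition Lambda_fun :: "real \<Rightarrow> real \<Rightarrow> real \<Rightarrow> (real \<Rightarrow> real) \<Rightarrow> ereal" where
  "Lambda_fun \<epsilon> \<phi>0 \<phi>1 f =
     (if (\<exists>\<mu>. has_dmeasure \<phi>0 \<phi>1 f \<mu>)
         \<and> absolutely_continuous leb01 (dmeasure \<phi>0 \<phi>1 f)
         \<and> (AE x in leb01. 0 \<le> \<epsilon> * ddensity \<phi>0 \<phi>1 f x \<and> \<epsilon> * ddensity \<phi>0 \<phi>1 f x \<le> 1)
      then ereal (\<integral>x. real_of_ereal (s_entropy (\<epsilon> * ddensity \<phi>0 \<phi>1 f x)) + f x - ln (1 + exp (f x)) \<partial>leb01)
      else \<infinity>)"

lemma s_entropy_measurable: "(\<lambda>a. real_of_ereal (s_entropy a)) \<in> borel_measurable borel"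
proof -
  have "(\<lambda>a. real_of_ereal (s_entropy a)) =
      (\<lambda>a. if a \<in> {0..1} then a * ln a + (1 - a) * ln (1 - a) else 0)"
    by (auto simp: s_entropy_def fun_eq_iff)
  also have "\<dots> \<in> borel_measurable borel"
    by measurable
  finally show ?thesis .
qed

lemma Lambda_fun_cong:
  assumes "integrable leb01 f" "integrable leb01 g" and eq: "AE x in leb01. f x = g x"
  shows "Lambda_fun \<epsilon> \<phi>0 \<phi>1 f = Lambda_fun \<epsilon> \<phi>0 \<phi>1 g"
proof -
  have d: "has_dmeasure \<phi>0 \<phi>1 f = has_dmeasure \<phi>0 \<phi>1 g"
    by (rule has_dmeasure_cong[OF eq])
  then have m: "dmeasure \<phi>0 \<phi>1 f = dmeasure \<phi>0 \<phi>1 g"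
    by (simp add: dmeasure_def)
  then have r: "ddensity \<phi>0 \<phi>1 f = ddensity \<phi>0 \<phi>1 g"
    by (simp add: ddensity_def fun_eq_iff)
  have [measurable]: "f \<in> borel_measurable leb01" "g \<in> borel_measurable leb01"
    using assms by auto
  have [measurable]: "ddensity \<phi>0 \<phi>1 g \<in> borel_measurable leb01"
    unfolding ddensity_def[abs_def] by measurable
  have [measurable]: "(\<lambda>x. real_of_ereal (s_entropy (\<epsilon> * ddensity \<phi>0 \<phi>1 g x))) \<in> borel_measurable leb01"
    by (rule measurable_compose[OF _ s_entropy_measurable]) measurable
  have "(\<integral>x. real_of_ereal (s_entropy (\<epsilon> * ddensity \<phi>0 \<phi>1 g x)) + f x - ln (1 + exp (f x)) \<partial>leb01)
      = (\<integral>x. real_of_ereal (s_entropy (\<epsilon> * ddensity \<phi>0 \<phi>1 g x)) + g x - ln (1 + exp (g x)) \<partial>leb01)"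
  proof (rule integral_cong_AE)
    show "AE x in leb01. real_of_ereal (s_entropy (\<epsilon> * ddensity \<phi>0 \<phi>1 g x)) + f x - ln (1 + exp (f x))
        = real_of_ereal (s_entropy (\<epsilon> * ddensity \<phi>0 \<phi>1 g x)) + g x - ln (1 + exp (g x))"
      using eq by eventually_elim simp
  qed measurable
  then show ?thesis
    unfolding Lambda_fun_def d m r by (simp only:)
qed

lift_definition Lambda :: "real \<Rightarrow> real \<Rightarrow> real \<Rightarrow> L1 \<Rightarrow> ereal" is Lambda_fun
  by (elim conjE, rule Lambda_fun_cong)

definition Lambda_star :: "real \<Rightarrow> real \<Rightarrow> real \<Rightarrow> Linf \<Rightarrow> ereal" where
  "Lambda_star \<epsilon> \<phi>0 \<phi>1 \<rho> = (SUP \<phi>. ereal (pairing \<rho> \<phi>) - Lambda \<epsilon> \<phi>0 \<phi>1 \<phi>)"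

definition maximizers :: "real \<Rightarrow> real \<Rightarrow> real \<Rightarrow> Linf \<Rightarrow> L1 set" where
  "maximizers \<epsilon> \<phi>0 \<phi>1 \<rho> =
     {\<phi>. ereal (pairing \<rho> \<phi>) - Lambda \<epsilon> \<phi>0 \<phi>1 \<phi> = Lambda_star \<epsilon> \<phi>0 \<phi>1 \<rho>}"

end

(* Writing a = eps * phi_x, the functional is a strictly convex function of a plus a concave function of
   phi. Replacing the concave part by its tangent leaves a convex problem with an explicit
   minimizer, namely a logistic function of a Lipschitz potential. This never increases the cost, so
   almost maximizers can be taken equi-Lipschitz; by Arzela-Ascoli maximizers exist and the
   directional derivative of the Legendre transform at rho is the maximum of the pairing over the
   maximizers (Danskin). Every maximizer is a fixed point of the replacement, that is, it solves a second
   order equation with phi(0) and phi(1) prescribed, and is determined by one shooting parameter.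
   The end point is an analytic function of that parameter (a Montel limit of complexified Euler
   schemes) and is not constant, so there are only finitely many maximizers. Hence their convex hull
   needs no closure, and a Gordan type alternative identifies it with the subdifferential. *)
theory Submission
  imports Defs "HOL-Complex_Analysis.Complex_Analysis"
begin

text \<open>The main obstacle is the rough coefficient: \<rho> is only bounded and measurable. With
  \<open>u\<close> the profile and \<open>w\<close> the potential, the second order equation is the
  system u' = logistic(w) / \<epsilon>, w' = (1 - \<rho> - logistic(u)) / \<epsilon>, which holds in
  integrated form. Removing from \<open>w\<close> the primitive of (1 - \<rho>) / \<epsilon> leaves
  a continuous right-hand side, and Euler's method then converges to every solution with the given
  w(0). That one fact yields both uniqueness and, through complexified schemes, analyticity. The
  logistic function has poles at odd multiples of i pi, so the schemes are complexified in a strip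
  only. Where imaginary parts are at most 1, a step of length h multiplies them by at most 1 + h;
  starting values with imaginary part below exp(-1/\<epsilon>) therefore stay in the strip, whatever
  the number of steps. The condition \<epsilon> < \<epsilon>_0 says that the mean rescaled slope is
  below 1. A steep enough start therefore overshoots \<phi>1, and the end point is not a constant
  function of the parameter.\<close>

section \<open>Suprema of affine functions with finitely many maximizers\<close>

text \<open>Gordan's alternative, by elimination and without any topology on the space. If the
  functionals in \<open>S\<close> already satisfy the hypothesis, \<open>m\<close> gets weight 0.
  Otherwise some \<open>v0\<close> is strictly negative on all of \<open>S\<close>, and correcting
  the functionals in \<open>S\<close> by multiples of \<open>f m\<close> removes \<open>m\<close>
  from the problem.\<close>

lemma gordan_finite:
  fixes f :: "'i \<Rightarrow> 'v::real_vector \<Rightarrow> real"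
  assumes "finite S" "\<And>i. i \<in> S \<Longrightarrow> linear (f i)" "\<And>v. \<exists>i\<in>S. f i v \<ge> 0"
  shows "\<exists>c. (\<forall>i\<in>S. c i \<ge> 0) \<and> sum c S = 1 \<and> (\<forall>v. (\<Sum>i\<in>S. c i * f i v) = 0)"
  using assms
proof (induction S arbitrary: f rule: finite_induct)
  case empty
  then show ?case by simp
next
  case (insert m S)
  have lin: "linear (f i)" if "i \<in> insert m S" for i
    using insert.prems that by blast
  show ?case
  proof (cases "\<forall>v. \<exists>i\<in>S. f i v \<ge> 0")
    case True
    then obtain c where c: "\<forall>i\<in>S. c i \<ge> 0" "sum c S = 1" "\<And>v. (\<Sum>i\<in>S. c i * f i v) = 0"
      using insert.IH[of f] lin by blast
    have eq: "(\<Sum>i\<in>S. (c(m := 0)) i * h i) = (\<Sum>i\<in>S. c i * h i)" for h :: "'i \<Rightarrow> real"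
      using insert.hyps by (intro sum.cong) auto
    show ?thesis
      using c insert.hyps eq[of "\<lambda>_. 1"] eq by (intro exI[of _ "c(m := 0)"]) auto
  next
    case False
    then obtain v0 where v0: "\<And>i. i \<in> S \<Longrightarrow> f i v0 < 0" by (meson not_le)
    have fm0: "f m v0 \<ge> 0" using insert.prems(2)[of v0] v0 by force
    \<comment> \<open>Strict negativity on the finite set \<open>S\<close> survives a small move. So
      if every small move along \<open>w\<close> makes \<open>f m\<close> negative, \<open>S\<close>
      cannot be entirely negative at \<open>v\<close>.\<close>
    have key: "\<exists>i\<in>S. f i v \<ge> 0" if m: "\<And>d. d > 0 \<Longrightarrow> f m (v + d *\<^sub>R w) < 0" for v w
    proof (rule ccontr)
      assume "\<not> ?thesis"
      then have neg: "f i v < 0" if "i \<in> S" for i using that by (meson not_le)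
      have "eventually (\<lambda>d. \<forall>i\<in>S. f i (v + d *\<^sub>R w) < 0) (at_right (0::real))"
      proof (intro eventually_ball_finite ballI insert.hyps)
        fix i assume i: "i \<in> S"
        have "((\<lambda>d. f i v + d * f i w) \<longlongrightarrow> f i v + 0 * f i w) (at_right 0)"
          by (intro tendsto_intros)
        then have "eventually (\<lambda>d. f i v + d * f i w < 0) (at_right (0::real))"
          using neg[OF i] by (intro order_tendstoD) auto
        then show "eventually (\<lambda>d. f i (v + d *\<^sub>R w) < 0) (at_right (0::real))"
          using lin i by (simp add: linear_add linear_scale)
      qed
      then have "eventually (\<lambda>d. (\<forall>i\<in>S. f i (v + d *\<^sub>R w) < 0) \<and> d > 0) (at_right (0::real))"
        by (intro eventually_conj) (auto simp: eventually_at_right_less)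
      then obtain d where d: "d > 0" "\<forall>i\<in>S. f i (v + d *\<^sub>R w) < 0"
        using eventually_happens'[OF trivial_limit_at_right_real] by blast
      with m[OF d(1)] insert.prems(2)[of "v + d *\<^sub>R w"] show False by force
    qed
    show ?thesis
    proof (cases "f m v0 = 0")
      case True
      have fm: "f m v = 0" for v
      proof (rule ccontr)
        assume "f m v \<noteq> 0"
        \<comment> \<open>A nonzero value of \<open>f m\<close> would give a direction in which a
          small move from \<open>v0\<close> makes every functional negative.\<close>
        define w where "w = (- sgn (f m v)) *\<^sub>R v"
        have w: "f m w < 0" using \<open>f m v \<noteq> 0\<close> lin
          by (simp add: w_def linear_scale linear_neg sgn_if split: if_splits)
        have "\<exists>i\<in>S. f i v0 \<ge> 0"
          using w True lin by (intro key[of _ w]) (auto simp: linear_add linear_scale mult_pos_neg)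
        then show False using v0 by force
      qed
      show ?thesis
        using insert.hyps by (intro exI[of _ "\<lambda>i. if i = m then 1 else 0"])
          (auto simp: fm sum.delta' if_distrib[of "\<lambda>x. x * _"] cong: if_cong intro!: sum.neutral)
    next
      case False
      with fm0 have pos: "f m v0 > 0" by simp
      \<comment> \<open>Chosen so that \<open>f i + k i * f m\<close> vanishes at \<open>v0\<close>;
        since \<open>k i\<close> is positive, the weight that returns to \<open>m\<close> at the end
        is nonnegative.\<close>
      define k where "k = (\<lambda>i. - f i v0 / f m v0)"
      have k: "k i > 0" if "i \<in> S" for i using v0[OF that] pos by (simp add: k_def divide_neg_pos)
      define g where "g = (\<lambda>i v. f i v + k i * f m v)"
      have ling: "linear (g i)" if "i \<in> S" for i
        using lin[of i] lin[of m] that unfolding g_def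
        by (intro linearI) (simp_all add: linear_add linear_scale algebra_simps)
      have "\<exists>i\<in>S. g i v \<ge> 0" for v
      proof -
        \<comment> \<open>The projection of \<open>v\<close> along \<open>v0\<close> onto the kernel
          of \<open>f m\<close>. It leaves each \<open>g i\<close> unchanged, and on that kernel
          \<open>g i\<close> and \<open>f i\<close> agree.\<close>
        define v' where "v' = v - (f m v / f m v0) *\<^sub>R v0"
        have m: "f m v' = 0" using lin pos by (simp add: v'_def linear_diff linear_scale)
        have gi: "g i v = f i v'" if "i \<in> S" for i
          using lin[of i] that pos by (simp add: v'_def linear_diff linear_scale g_def k_def field_simps)
        have "\<exists>i\<in>S. f i v' \<ge> 0"
          using m pos lin by (intro key[of _ "- v0"]) (auto simp: linear_diff linear_scale)
        then show ?thesis using gi by auto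
      qed
      with insert.IH[of g] ling obtain c where
        c: "\<forall>i\<in>S. c i \<ge> 0" "sum c S = 1" "\<And>v. (\<Sum>i\<in>S. c i * g i v) = 0" by blast
      define s where "s = (\<Sum>i\<in>S. c i * k i)"
      have s: "s \<ge> 0" unfolding s_def using c k by (intro sum_nonneg mult_nonneg_nonneg) (auto simp: less_imp_le)
      \<comment> \<open>Expanding \<open>g\<close> in the relation for \<open>c\<close> gives
        \<open>m\<close> the total weight \<open>s\<close>; division by \<open>1 + s\<close>
        restores a convex combination.\<close>
      define e where "e = (\<lambda>i. if i = m then s / (1 + s) else c i / (1 + s))"
      have e: "(\<Sum>i\<in>S. e i * h i) = (\<Sum>i\<in>S. c i * h i) / (1 + s)" for h :: "'i \<Rightarrow> real"
        unfolding e_def sum_divide_distrib using insert.hyps by (intro sum.cong) auto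
      have sm: "sum e S = 1 / (1 + s)" using e[of "\<lambda>_. 1"] c by simp
      have "(\<Sum>i\<in>S. c i * f i v) + s * f m v = 0" for v
        using c(3)[of v] unfolding g_def s_def
        by (simp add: distrib_left sum.distrib sum_distrib_right mult.assoc)
      then have "(\<Sum>i\<in>S. e i * f i v) + e m * f m v = 0" for v
        unfolding e by (simp add: e_def) (metis add_divide_distrib divide_eq_0_iff)
      moreover have "e m + sum e S = 1" using s unfolding sm
        by (simp add: e_def add_divide_distrib[symmetric])
      ultimately show ?thesis using insert.hyps c s
        by (intro exI[of _ e]) (auto simp: e_def add.commute)
    qed
  qed
qed

text \<open>\<open>G\<close> is an attained supremum of affine functions indexed by
  \<open>A\<close>, with maximizers \<open>M x\<close>. The assumption \<open>danskin\<close> bounds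
  the increments only at some arbitrarily small times, because compactness provides no more than a
  subsequence. The maximizer in it may depend on the direction but not on
  \<open>\<eta>\<close>.\<close>

locale affine_supremum =
  fixes b :: "'x::real_vector \<Rightarrow> 'y::real_vector \<Rightarrow> real"
    and A :: "'y set" and L :: "'y \<Rightarrow> real" and G :: "'x \<Rightarrow> real" and M :: "'x \<Rightarrow> 'y set"
  assumes bilin: "bilinear b"
    and separating: "\<And>l. (\<And>v. b v l = 0) \<Longrightarrow> l = 0"
    and M_def: "\<And>x. M x = {y \<in> A. b x y - L y = G x}"
    and upper: "\<And>x y. y \<in> A \<Longrightarrow> b x y - L y \<le> G x"
    and finM: "\<And>x. finite (M x)"
    and danskin: "\<And>x v. \<exists>y\<in>M x. \<forall>\<eta>>0. frequently (\<lambda>t. G (x + t *\<^sub>R v) \<le> G x + t * (b v y + \<eta>)) (at_right 0)"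
begin

lemma linR: "linear (b v)" and linL: "linear (\<lambda>v. b v l)"
  using bilin by (auto simp: bilinear_def)

lemmas b_simps = linear_add[OF linR] linear_diff[OF linR] linear_scale[OF linR]
  linear_add[OF linL] linear_diff[OF linL] linear_scale[OF linL] linear_0[OF linR] linear_0[OF linL]

lemma separating_eq: "(\<And>v. b v l = b v k) \<Longrightarrow> l = k"
  using separating[of "l - k"] by (simp add: b_simps)

lemma M_nonempty: "M x \<noteq> {}"
  using danskin[of x 0] by blast

lemma M_subgradient: "y \<in> M x \<Longrightarrow> G z - G x \<ge> b (z - x) y"
  using upper[of y z] by (auto simp: M_def b_simps)

text \<open>A maximizer at the intermediate point provides an affine function that equals
  \<open>G\<close> there and lies below \<open>G\<close> at both ends.\<close>

lemma convex_G: "convex_on UNIV G"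
proof (rule convex_onI)
  fix t :: real and x y :: 'x assume t: "0 < t" "t < 1"
  let ?z = "(1 - t) *\<^sub>R x + t *\<^sub>R y"
  obtain p where p: "p \<in> M ?z" using M_nonempty by blast
  then have "G ?z = (1 - t) * (b x p - L p) + t * (b y p - L p)"
    by (auto simp: M_def b_simps algebra_simps)
  also have "\<dots> \<le> (1 - t) * G x + t * G y"
    using p t by (intro add_mono mult_left_mono upper) (auto simp: M_def)
  finally show "G ?z \<le> (1 - t) * G x + t * G y" .
qed simp

lemma diff_remainder_real:
  assumes "t > 0"
  shows "diff_remainder b (\<lambda>x. ereal (G x)) x l v t = ereal ((G (x + t *\<^sub>R v) - G x) / t - b v l)"
  using assms by (simp add: diff_remainder_def diff_divide_distrib)

text \<open>A bound on the difference quotients along some sequence of times tending to zero suffices,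
  because they are monotone by convexity.\<close>

lemma directional_derivative:
  obtains y where "y \<in> M x" "\<And>z. z \<in> M x \<Longrightarrow> b v z \<le> b v y"
    "\<And>l. (diff_remainder b (\<lambda>x. ereal (G x)) x l v \<longlongrightarrow> ereal (b v y - b v l)) (at_right 0)"
proof -
  obtain y where y: "y \<in> M x"
    and fr: "\<And>\<eta>. \<eta> > 0 \<Longrightarrow> frequently (\<lambda>t. G (x + t *\<^sub>R v) \<le> G x + t * (b v y + \<eta>)) (at_right 0)"
    using danskin[of x v] by blast
  have lb: "b v z \<le> (G (x + t *\<^sub>R v) - G x) / t" if "z \<in> M x" "t > 0" for z t
    using M_subgradient[of z x "x + t *\<^sub>R v"] that by (simp add: b_simps field_simps)
  have ev: "eventually (\<lambda>t. (G (x + t *\<^sub>R v) - G x) / t \<le> b v y + \<eta>) (at_right 0)" if \<eta>: "\<eta> > 0" for \<eta>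
  proof -
    have "frequently (\<lambda>t. G (x + t *\<^sub>R v) \<le> G x + t * (b v y + \<eta>) \<and> t > 0) (at_right 0)"
      using frequently_eventually_conj[OF fr[OF \<eta>] eventually_at_right_less[of 0]] by (simp add: conj_commute)
    then obtain T where T: "T > 0" "G (x + T *\<^sub>R v) \<le> G x + T * (b v y + \<eta>)"
      using frequently_ex by blast
    have "(G (x + t *\<^sub>R v) - G x) / t \<le> b v y + \<eta>" if t: "0 < t" "t < T" for t
    proof -
      have "x + t *\<^sub>R v = (1 - t / T) *\<^sub>R x + (t / T) *\<^sub>R (x + T *\<^sub>R v)"
        using T by (simp add: algebra_simps)
      then have "G (x + t *\<^sub>R v) \<le> (1 - t / T) * G x + (t / T) * G (x + T *\<^sub>R v)"
        using convex_onD[OF convex_G, of "t / T" x "x + T *\<^sub>R v"] t T by simp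
      also have "\<dots> \<le> (1 - t / T) * G x + (t / T) * (G x + T * (b v y + \<eta>))"
        using T t by (intro add_left_mono mult_left_mono) auto
      also have "\<dots> = G x + t * (b v y + \<eta>)" using T by (simp add: field_simps)
      finally show ?thesis using t by (simp add: field_simps)
    qed
    then show ?thesis using T(1) unfolding eventually_at_right[OF T(1)] by blast
  qed
  have lim: "((\<lambda>t. (G (x + t *\<^sub>R v) - G x) / t) \<longlongrightarrow> b v y) (at_right 0)"
  proof (rule order_tendstoI)
    fix a assume "a < b v y"
    then show "eventually (\<lambda>t. a < (G (x + t *\<^sub>R v) - G x) / t) (at_right 0)"
      using lb[OF y] by (intro eventually_mono[OF eventually_at_right_less[of 0]]) (force intro: less_le_trans)
  next
    fix a assume a: "b v y < a"
    then have "b v y + (a - b v y) / 2 < a" by (simp add: field_simps)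
    with a show "eventually (\<lambda>t. (G (x + t *\<^sub>R v) - G x) / t < a) (at_right 0)"
      using ev[of "(a - b v y) / 2"] by (auto elim!: eventually_mono simp del: less_divide_eq_numeral1 divide_le_eq_numeral1 intro: le_less_trans)
  qed
  show ?thesis
  proof
    show "y \<in> M x" by fact
    show "b v z \<le> b v y" if "z \<in> M x" for z
      by (rule tendsto_lowerbound[OF lim]) (use lb[OF that] in \<open>auto intro: eventually_mono[OF eventually_at_right_less[of 0]]\<close>)
    fix l
    have "((\<lambda>t. ereal ((G (x + t *\<^sub>R v) - G x) / t - b v l)) \<longlongrightarrow> ereal (b v y - b v l)) (at_right 0)"
      by (intro tendsto_intros lim)
    then show "(diff_remainder b (\<lambda>x. ereal (G x)) x l v \<longlongrightarrow> ereal (b v y - b v l)) (at_right 0)"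
      by (rule Lim_transform_eventually)
        (auto simp: diff_remainder_real intro: eventually_mono[OF eventually_at_right_less[of 0]])
  qed
qed

text \<open>The directional derivative is a maximum over \<open>M x\<close>, so a Gateaux
  subgradient \<open>l\<close> never beats all maximizers in any direction. Gordan's alternative for
  the functionals \<open>b v (y - l)\<close> then writes \<open>l\<close> as a convex combination,
  and \<open>finM\<close> spares the passage to a closed hull.\<close>

lemma gateaux_subdiff_subset: "gateaux_subdiff b (\<lambda>x. ereal (G x)) x \<subseteq> convex hull M x"
proof
  fix l assume l: "l \<in> gateaux_subdiff b (\<lambda>x. ereal (G x)) x"
  have "\<exists>y\<in>M x. b v (y - l) \<ge> 0" for v
  proof -
    obtain y where y: "y \<in> M x"
      "(diff_remainder b (\<lambda>x. ereal (G x)) x l v \<longlongrightarrow> ereal (b v y - b v l)) (at_right 0)"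
      using directional_derivative by metis
    have "0 \<le> ereal (b v y - b v l)"
      using l unfolding lim_imp_Liminf[OF trivial_limit_at_right_real y(2), symmetric]
      by (auto simp: gateaux_subdiff_def)
    then show ?thesis using y(1) by (intro bexI[of _ y]) (auto simp: b_simps)
  qed
  then obtain c where c: "\<forall>y\<in>M x. c y \<ge> 0" "sum c (M x) = 1" "\<And>v. (\<Sum>y\<in>M x. c y * b v (y - l)) = 0"
    using gordan_finite[OF finM, of x "\<lambda>y v. b v (y - l)"] linL by blast
  have "b v l = b v (\<Sum>y\<in>M x. c y *\<^sub>R y)" for v
  proof -
    have "(\<Sum>y\<in>M x. c y * b v (y - l)) = (\<Sum>y\<in>M x. c y * b v y) - (\<Sum>y\<in>M x. c y) * b v l"
      by (simp add: b_simps right_diff_distrib sum_subtractf sum_distrib_right)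
    then show ?thesis using c by (simp add: linear_sum[OF linR] b_simps)
  qed
  then have "l = (\<Sum>y\<in>M x. c y *\<^sub>R y)" by (rule separating_eq)
  then show "l \<in> convex hull M x"
    using c by (auto simp: convex_hull_finite[OF finM])
qed

lemma hull_subset_subdifferential: "convex hull M x \<subseteq> subdifferential b (\<lambda>x. ereal (G x)) x"
proof (rule hull_minimal)
  show "M x \<subseteq> subdifferential b (\<lambda>x. ereal (G x)) x"
    using M_subgradient by (auto simp: subdifferential_def)
  show "convex (subdifferential b (\<lambda>x. ereal (G x)) x)"
  proof (rule convexI)
    fix k l and u v :: real
    assume k: "k \<in> subdifferential b (\<lambda>x. ereal (G x)) x" and l: "l \<in> subdifferential b (\<lambda>x. ereal (G x)) x"
      and uv: "0 \<le> u" "0 \<le> v" "u + v = 1"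
    have "b (y - x) (u *\<^sub>R k + v *\<^sub>R l) \<le> G y - G x" for y
    proof -
      have "u * b (y - x) k + v * b (y - x) l \<le> u * (G y - G x) + v * (G y - G x)"
        using k l uv by (intro add_mono mult_left_mono) (auto simp: subdifferential_def)
      also have "\<dots> = G y - G x" using uv by (metis distrib_right mult_1)
      finally show ?thesis by (simp add: linear_add[OF linR] linear_scale[OF linR])
    qed
    then show "u *\<^sub>R k + v *\<^sub>R l \<in> subdifferential b (\<lambda>x. ereal (G x)) x"
      by (simp add: subdifferential_def)
  qed
qed

lemma subdifferential_subset_gateaux:
  "subdifferential b (\<lambda>x. ereal (G x)) x \<subseteq> gateaux_subdiff b (\<lambda>x. ereal (G x)) x"
proof
  fix l assume l: "l \<in> subdifferential b (\<lambda>x. ereal (G x)) x"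
  show "l \<in> gateaux_subdiff b (\<lambda>x. ereal (G x)) x"
    unfolding gateaux_subdiff_def
  proof safe
    fix v
    show "0 \<le> Liminf (at_right 0) (diff_remainder b (\<lambda>x. ereal (G x)) x l v)"
    proof (intro Liminf_bounded eventually_mono[OF eventually_at_right_less[of 0]])
      fix t :: real assume t: "0 < t"
      have "t * b v l \<le> G (x + t *\<^sub>R v) - G x"
        using l[unfolded subdifferential_def] by (auto dest!: spec[of _ "x + t *\<^sub>R v"] simp: b_simps)
      then show "0 \<le> diff_remainder b (\<lambda>x. ereal (G x)) x l v t"
        unfolding diff_remainder_real[OF t] using t by (simp add: field_simps)
    qed
  qed
qed

lemma gateaux_subdiff_eq:
  "gateaux_subdiff b (\<lambda>x. ereal (G x)) x = subdifferential b (\<lambda>x. ereal (G x)) x"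
  and subdifferential_eq: "subdifferential b (\<lambda>x. ereal (G x)) x = convex hull M x"
  using gateaux_subdiff_subset hull_subset_subdifferential subdifferential_subset_gateaux by blast+

text \<open>For \<open>l\<close> to be a supergradient, the maximum of \<open>b v\<close> over
  \<open>M x\<close> must be at most \<open>b v l\<close>. Applied to both \<open>v\<close> and
  \<open>- v\<close>, this forces equality for each maximizer, and the pairing separates
  points.\<close>

lemma gateaux_superdiff_iff:
  "l \<in> gateaux_superdiff b (\<lambda>x. ereal (G x)) x \<longleftrightarrow> M x = {l}"
proof
  assume l: "l \<in> gateaux_superdiff b (\<lambda>x. ereal (G x)) x"
  have le: "b v z \<le> b v l" if "z \<in> M x" for v z
  proof -
    obtain y where y: "b v z \<le> b v y"
      "(diff_remainder b (\<lambda>x. ereal (G x)) x l v \<longlongrightarrow> ereal (b v y - b v l)) (at_right 0)"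
      using directional_derivative \<open>z \<in> M x\<close> by metis
    have "ereal (b v y - b v l) \<le> 0"
      using l unfolding lim_imp_Limsup[OF trivial_limit_at_right_real y(2), symmetric]
      by (auto simp: gateaux_superdiff_def)
    then show ?thesis using y(1) by simp
  qed
  have "z = l" if "z \<in> M x" for z
  proof (rule separating_eq)
    fix v
    have "b (- v) z \<le> b (- v) l" by (rule le[OF that])
    then show "b v z = b v l" using le[OF that, of v] by (simp add: linear_neg[OF linL])
  qed
  then show "M x = {l}" using M_nonempty by blast
next
  assume M: "M x = {l}"
  show "l \<in> gateaux_superdiff b (\<lambda>x. ereal (G x)) x"
    unfolding gateaux_superdiff_def
  proof safe
    fix v
    obtain y where y: "y \<in> M x"
      "(diff_remainder b (\<lambda>x. ereal (G x)) x l v \<longlongrightarrow> ereal (b v y - b v l)) (at_right 0)"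
      using directional_derivative by metis
    with M have "(diff_remainder b (\<lambda>x. ereal (G x)) x l v \<longlongrightarrow> 0) (at_right 0)"
      by (simp add: zero_ereal_def)
    then show "Limsup (at_right 0) (diff_remainder b (\<lambda>x. ereal (G x)) x l v) \<le> 0"
      using lim_imp_Limsup[OF trivial_limit_at_right_real] by fastforce
  qed
qed

text \<open>A Gateaux derivative is in particular a supergradient, which forces a single maximizer;
  with a single maximizer the directional derivative is linear in the direction.\<close>

lemma gateaux_differentiable_iff:
  "gateaux_differentiable b (\<lambda>x. ereal (G x)) x \<longleftrightarrow> is_singleton (M x)"
proof
  assume "gateaux_differentiable b (\<lambda>x. ereal (G x)) x"
  then obtain l where l: "\<And>v. (diff_remainder b (\<lambda>x. ereal (G x)) x l v \<longlongrightarrow> 0) (at_right 0)"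
    by (auto simp: gateaux_differentiable_def)
  then have "l \<in> gateaux_superdiff b (\<lambda>x. ereal (G x)) x"
    using lim_imp_Limsup[OF trivial_limit_at_right_real l] by (auto simp: gateaux_superdiff_def)
  then show "is_singleton (M x)" by (simp add: gateaux_superdiff_iff is_singleton_def)
next
  assume "is_singleton (M x)"
  then obtain l where M: "M x = {l}" by (auto simp: is_singleton_def)
  have "(diff_remainder b (\<lambda>x. ereal (G x)) x l v \<longlongrightarrow> 0) (at_right 0)" for v
    using directional_derivative[of x v] M by (metis diff_self singletonD zero_ereal_def)
  then show "gateaux_differentiable b (\<lambda>x. ereal (G x)) x"
    by (auto simp: gateaux_differentiable_def)
qed

end

section \<open>The logistic function and the binary entropy\<close>

text \<open>Polymorphic because the shooting argument evaluates it at complex arguments. On the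
  reals it is both the derivative of \<open>ln (1 + exp x)\<close> and the inverse of the derivative
  of \<open>binary_entropy\<close>, so it occurs in both equations of the system.\<close>

definition logistic :: "'a::{real_normed_field,banach} \<Rightarrow> 'a" where
  "logistic z = 1 / (1 + exp (- z))"

definition binary_entropy :: "real \<Rightarrow> real" where
  "binary_entropy a = a * ln a + (1 - a) * ln (1 - a)"

lemma logistic_pos: "0 < logistic (x::real)" and logistic_less_1: "logistic (x::real) < 1"
  by (auto simp: logistic_def add_pos_pos divide_less_eq)

lemma logistic_uminus: "logistic (- x) = 1 - logistic (x::real)"
proof -
  have "1 + exp x > 0" "1 + exp (- x) > 0" by (simp_all add: add_pos_pos)
  then show ?thesis by (simp add: logistic_def exp_minus field_simps)
qed

lemma logistic_mono: "x \<le> y \<Longrightarrow> logistic (x::real) \<le> logistic y"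
  by (auto simp: logistic_def intro!: divide_left_mono mult_pos_pos add_pos_pos)

lemma isCont_logistic: "isCont logistic (x::real)"
  unfolding logistic_def using exp_gt_zero[of "- x"] by (intro continuous_intros) linarith

lemma tendsto_logistic: "(f \<longlongrightarrow> x) F \<Longrightarrow> ((\<lambda>n. logistic (f n)) \<longlongrightarrow> logistic (x::real)) F"
  using isCont_tendsto_compose[OF isCont_logistic] .

lemma logistic_measurable [measurable]: "logistic \<in> borel_measurable (borel :: real measure)"
  by (intro borel_measurable_continuous_onI continuous_at_imp_continuous_on ballI isCont_logistic)

lemma logistic_Lipschitz: "\<bar>logistic x - logistic y\<bar> \<le> \<bar>x - y :: real\<bar>"
proof -
  have *: "logistic x - logistic y \<le> x - y" if "y \<le> x" for x y :: real
  proof -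
    have "exp (- y) * (1 + (y - x)) \<le> exp (- y) * exp (y - x)"
      by (intro mult_left_mono exp_ge_add_one_self) simp
    then have e: "exp (- y) - exp (- x) \<le> exp (- y) * (x - y)"
      by (simp add: exp_add[symmetric] algebra_simps)
    have p: "1 + exp (- x) > 0" "1 + exp (- y) > 0" by (simp_all add: add_pos_pos)
    have "logistic x - logistic y = (exp (- y) - exp (- x)) / (1 + exp (- x)) / (1 + exp (- y))"
      using p by (simp add: logistic_def field_simps)
    also have "\<dots> \<le> (exp (- y) - exp (- x)) / (1 + exp (- y))"
      using that p by (intro divide_right_mono) (auto simp: divide_le_eq mult_le_cancel_left1)
    also have "\<dots> \<le> exp (- y) * (x - y) / (1 + exp (- y))"
      using e p by (intro divide_right_mono) auto
    also have "\<dots> \<le> x - y"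
      using that p by (simp add: divide_le_eq distrib_left mult.commute)
    finally show ?thesis .
  qed
  show ?thesis using *[of x y] *[of y x] logistic_mono[of x y] logistic_mono[of y x] by linarith
qed

lemma ln_logistic: "ln (logistic g) = g - ln (1 + exp g)" for g :: real
proof -
  have "1 + exp g > 0" "1 + exp (- g) > 0" by (simp_all add: add_pos_pos)
  then have "logistic g = exp g / (1 + exp g)"
    by (simp add: logistic_def exp_minus field_simps)
  then show ?thesis using \<open>1 + exp g > 0\<close> by (simp add: ln_div)
qed

lemma ln_1m_logistic: "ln (1 - logistic g) = - ln (1 + exp g)" for g :: real
proof -
  have "1 + exp g > 0" by (simp add: add_pos_pos)
  then have "1 - logistic g = 1 / (1 + exp g)" by (simp add: logistic_uminus[symmetric]) (simp add: logistic_def)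
  then show ?thesis using \<open>1 + exp g > 0\<close> by (simp add: ln_div)
qed

lemma binary_entropy_logistic:
  "binary_entropy (logistic g) = g * logistic g - ln (1 + exp g)"
  by (simp add: binary_entropy_def ln_logistic ln_1m_logistic algebra_simps)

text \<open>One summand of a relative entropy: the bound is \<open>ln z \<le> z - 1\<close> at
  \<open>z = b / a\<close>, where equality holds only for \<open>z = 1\<close>. At
  \<open>a = 0\<close> this quotient carries no information, hence the case distinction.\<close>

lemma relative_entropy_term:
  fixes a b :: real
  assumes "0 \<le> a" "0 < b"
  shows "a * ln a - a * ln b \<ge> a - b" and "a * ln a - a * ln b = a - b \<Longrightarrow> a = b"
proof -
  have *: "a * ln a - a * ln b \<ge> a - b \<and> (a * ln a - a * ln b = a - b \<longrightarrow> a = b)"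
  proof (cases "a = 0")
    case False
    with assms have a: "a > 0" by simp
    have e: "a * ln a - a * ln b - (a - b) = a * (b / a - 1 - ln (b / a))"
      using a assms by (simp add: ln_div field_simps)
    have "ln (b / a) \<le> b / a - 1" using a assms by (intro ln_le_minus_one) auto
    then have "a * ln a - a * ln b - (a - b) \<ge> 0" using a unfolding e by simp
    moreover have "b / a = 1" if "a * ln a - a * ln b = a - b"
      using ln_eq_minus_one[of "b / a"] e that a assms by simp
    ultimately show ?thesis using a by auto
  qed (use assms in auto)
  then show "a * ln a - a * ln b \<ge> a - b" "a * ln a - a * ln b = a - b \<Longrightarrow> a = b" by auto
qed

text \<open>The gap between the two sides is the relative entropy of a Bernoulli law of parameter
  \<open>a\<close> with respect to one of parameter \<open>logistic g\<close>; the linear terms of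
  its two summands cancel. This gives the equality case without differentiating the entropy, whose
  slope is infinite at 0 and 1.\<close>

lemma entropy_Fenchel:
  fixes a g :: real
  assumes a: "0 \<le> a" "a \<le> 1"
  shows "g * a - ln (1 + exp g) \<le> binary_entropy a"
    and "binary_entropy a = g * a - ln (1 + exp g) \<Longrightarrow> a = logistic g"
proof -
  have eq: "binary_entropy a - (g * a - ln (1 + exp g)) =
      (a * ln a - a * ln (logistic g)) + ((1 - a) * ln (1 - a) - (1 - a) * ln (1 - logistic g))"
    by (simp add: binary_entropy_def ln_logistic ln_1m_logistic algebra_simps)
  note r = relative_entropy_term[of a "logistic g"] relative_entropy_term[of "1 - a" "1 - logistic g"]
  show "g * a - ln (1 + exp g) \<le> binary_entropy a"
    using eq r(1,3) a logistic_pos[of g] logistic_less_1[of g] by linarith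
  show "a = logistic g" if "binary_entropy a = g * a - ln (1 + exp g)"
    using eq r that a logistic_pos[of g] logistic_less_1[of g] by linarith
qed

text \<open>The Fenchel inequality once more, now with the slope fixed at \<open>logistic x\<close>
  and the potential \<open>y\<close> varying.\<close>

lemma log_sum_convex: "ln (1 + exp x) + logistic x * (y - x) \<le> ln (1 + exp (y::real))"
  using entropy_Fenchel(1)[of "logistic x" y] logistic_pos[of x] logistic_less_1[of x]
    binary_entropy_logistic[of x] by (simp add: algebra_simps)

lemma binary_entropy_measurable [measurable]: "binary_entropy \<in> borel_measurable borel"
  unfolding binary_entropy_def[abs_def] by measurable

lemma binary_entropy_bounds:
  assumes "0 \<le> a" "a \<le> 1"
  shows "- ln 2 \<le> binary_entropy a" "binary_entropy a \<le> 0"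
proof -
  show "- ln 2 \<le> binary_entropy a" using entropy_Fenchel(1)[OF assms, of 0] by simp
  have "a * ln a \<le> 0" "(1 - a) * ln (1 - a) \<le> 0"
    using assms by (cases "a = 0"; cases "a = 1"; simp add: mult_le_0_iff)+
  then show "binary_entropy a \<le> 0" by (simp add: binary_entropy_def)
qed

lemma binary_entropy_abs_le: "0 \<le> a \<Longrightarrow> a \<le> 1 \<Longrightarrow> \<bar>binary_entropy a\<bar> \<le> ln 2"
  using binary_entropy_bounds[of a] by linarith

section \<open>Bounded functions on the unit interval and their primitives\<close>

lemma space_leb01 [simp]: "space leb01 = {0..1}"
  by (simp add: space_restrict_space)

lemma emeasure_leb01: "emeasure leb01 {0..1} = 1"
  by (simp add: emeasure_restrict_space)

lemma finite_measure_leb01: "finite_measure leb01"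
  by (rule finite_measureI) (simp add: emeasure_leb01)

interpretation leb01: finite_measure leb01
  by (rule finite_measure_leb01)

lemma measure_leb01 [simp]: "measure leb01 {0..1} = 1"
  by (simp add: measure_def emeasure_leb01)

lemma borel_measurable_leb01: "f \<in> borel_measurable borel \<Longrightarrow> f \<in> borel_measurable leb01"
  by (rule measurable_restrict_space1) simp

lemma ident_measurable_leb01 [measurable]: "(\<lambda>x. x) \<in> borel_measurable leb01"
  by (rule borel_measurable_leb01) simp

lemma integrable_leb01:
  fixes f :: "real \<Rightarrow> real"
  assumes "f \<in> borel_measurable leb01" "\<And>x. x \<in> {0..1} \<Longrightarrow> \<bar>f x\<bar> \<le> C"
  shows "integrable leb01 f"
  using assms by (intro leb01.integrable_const_bound[of _ C]) auto

lemma integral_leb01_abs_le: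
  fixes f :: "real \<Rightarrow> real"
  assumes "f \<in> borel_measurable leb01" "\<And>x. x \<in> {0..1} \<Longrightarrow> \<bar>f x\<bar> \<le> C"
  shows "\<bar>\<integral>x. f x \<partial>leb01\<bar> \<le> C"
proof -
  have "\<bar>\<integral>x. f x \<partial>leb01\<bar> \<le> (\<integral>x. \<bar>f x\<bar> \<partial>leb01)" by (rule integral_abs_bound)
  also have "\<dots> \<le> (\<integral>x. C \<partial>leb01)"
    using assms by (intro integral_mono integrable_leb01[of _ C] leb01.integrable_const) auto
  finally show ?thesis by simp
qed

text \<open>Defined for all real \<open>x\<close>, and constant outside the unit interval, so that
  bounds such as \<open>primitive_abs_le\<close> need no condition on \<open>x\<close>.\<close>

definition primitive :: "(real \<Rightarrow> real) \<Rightarrow> real \<Rightarrow> real" where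
  "primitive f x = (\<integral>y. indicator {..x} y * f y \<partial>leb01)"

lemma indicator_mult_le: "\<bar>f\<bar> \<le> C \<Longrightarrow> \<bar>indicator A y * f :: real\<bar> \<le> C"
  by (cases "y \<in> A") auto

text \<open>The free constant \<open>c\<close> serves two purposes: \<open>c = 0\<close> gives the
  Lipschitz bound, and the value of the integrand at the left end gives the local error of an Euler
  step.\<close>

lemma primitive_increment:
  assumes f[measurable]: "f \<in> borel_measurable leb01" and bd: "\<And>x. x \<in> {0..1} \<Longrightarrow> \<bar>f x\<bar> \<le> C"
    and xy: "0 \<le> x" "x \<le> y" "y \<le> 1" and K: "\<And>t. t \<in> {x..y} \<Longrightarrow> \<bar>f t - c\<bar> \<le> K"
  shows "\<bar>primitive f y - primitive f x - c * (y - x)\<bar> \<le> K * (y - x)"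
proof -
  have [measurable]: "{x<..y} \<in> sets leb01"
    using xy by (auto simp: sets_restrict_space_iff)
  have [simp]: "{x<..y} \<inter> {0..1} = {x<..y}"
    using xy by auto
  have meas: "measure leb01 {x<..y} = y - x"
    using xy by (subst measure_restrict_space) auto
  have int: "integrable leb01 (\<lambda>t. indicator {..z} t * f t)" for z
    by (rule integrable_leb01[of _ C]) (auto intro!: bd indicator_mult_le)
  have int2: "integrable leb01 (\<lambda>t. indicator {x<..y} t * f t)"
    by (rule integrable_leb01[of _ C]) (auto intro!: bd indicator_mult_le)
  have intc: "integrable leb01 (\<lambda>t. indicator {x<..y} t * a)" for a :: real
    by (rule integrable_leb01[of _ "\<bar>a\<bar>"]) (auto intro!: indicator_mult_le)
  have "primitive f y - primitive f x = (\<integral>t. indicator {..y} t * f t - indicator {..x} t * f t \<partial>leb01)"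
    unfolding primitive_def by (rule Bochner_Integration.integral_diff[symmetric]) (rule int)+
  also have "\<dots> = (\<integral>t. indicator {x<..y} t * f t \<partial>leb01)"
    using xy by (intro Bochner_Integration.integral_cong) (auto simp: indicator_def)
  also have "\<dots> - c * (y - x) = (\<integral>t. indicator {x<..y} t * f t - indicator {x<..y} t * c \<partial>leb01)"
    by (subst Bochner_Integration.integral_diff[OF int2 intc]) (simp add: meas)
  finally have "\<bar>primitive f y - primitive f x - c * (y - x)\<bar>
      \<le> (\<integral>t. \<bar>indicator {x<..y} t * f t - indicator {x<..y} t * c\<bar> \<partial>leb01)"
    using integral_abs_bound by metis
  also have "\<dots> \<le> (\<integral>t. indicator {x<..y} t * K \<partial>leb01)"
  proof (rule integral_mono)
    show "integrable leb01 (\<lambda>t. \<bar>indicator {x<..y} t * f t - indicator {x<..y} t * c\<bar>)"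
      by (intro integrable_abs Bochner_Integration.integrable_diff int2 intc)
    show "\<bar>indicator {x<..y} t * f t - indicator {x<..y} t * c\<bar> \<le> indicator {x<..y} t * K" for t
      using K[of t] by (auto simp: indicator_def)
  qed (rule intc)
  also have "\<dots> = K * (y - x)" by (simp add: meas)
  finally show ?thesis .
qed

lemma primitive_Lipschitz:
  assumes "f \<in> borel_measurable leb01" "\<And>x. x \<in> {0..1} \<Longrightarrow> \<bar>f x\<bar> \<le> C" "x \<in> {0..1}" "y \<in> {0..1}"
  shows "\<bar>primitive f y - primitive f x\<bar> \<le> C * \<bar>y - x\<bar>"
proof (cases "x \<le> y")
  case True
  then show ?thesis using primitive_increment[OF assms(1,2), of x y 0 C] assms by auto
next
  case False
  then show ?thesis using primitive_increment[OF assms(1,2), of y x 0 C] assms by auto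
qed

lemma primitive_abs_le:
  assumes [measurable]: "f \<in> borel_measurable leb01" and "\<And>x. x \<in> {0..1} \<Longrightarrow> \<bar>f x\<bar> \<le> C"
  shows "\<bar>primitive f x\<bar> \<le> C"
  unfolding primitive_def using assms(2) by (intro integral_leb01_abs_le indicator_mult_le) auto

lemma AE_leb01_neq: "AE y in leb01. y \<noteq> (a::real)"
  by (simp add: AE_restrict_space_iff) (rule AE_mp[OF AE_lborel_singleton[of a]], auto)

lemma primitive_0:
  assumes [measurable]: "f \<in> borel_measurable leb01"
  shows "primitive f 0 = 0"
proof -
  have "primitive f 0 = (\<integral>y. 0 \<partial>leb01)"
    unfolding primitive_def
  proof (rule integral_cong_AE)
    show "AE y in leb01. indicator {..0} y * f y = 0"
      using AE_leb01_neq[of 0] AE_space[of leb01] by eventually_elim (auto simp: indicator_def)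
  qed measurable
  then show ?thesis by simp
qed

lemma primitive_1: "primitive f 1 = (\<integral>y. f y \<partial>leb01)"
  unfolding primitive_def by (intro Bochner_Integration.integral_cong) (auto simp: indicator_def)

lemma kernel_measurable:
  assumes f: "f \<in> borel_measurable leb01" and g: "g \<in> borel_measurable leb01"
  shows "(\<lambda>(x, y). indicator {..x} y * (g x * f y) :: real) \<in> borel_measurable (leb01 \<Otimes>\<^sub>M leb01)"
proof -
  note [measurable] = measurable_compose[OF measurable_snd f] measurable_compose[OF measurable_fst g]
    measurable_compose[OF measurable_snd ident_measurable_leb01] measurable_compose[OF measurable_fst ident_measurable_leb01]
  have "(\<lambda>(x, y). indicator {..x} y * (g x * f y) :: real) =
      (\<lambda>z. (if snd z \<le> fst z then 1 else 0) * (g (fst z) * f (snd z)))"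
    by (auto simp: fun_eq_iff indicator_def)
  also have "\<dots> \<in> borel_measurable (leb01 \<Otimes>\<^sub>M leb01)"
    by (intro borel_measurable_times borel_measurable_if_D measurable_If) measurable
  finally show ?thesis .
qed

lemma primitive_measurable [measurable]:
  assumes f: "f \<in> borel_measurable leb01"
  shows "primitive f \<in> borel_measurable leb01"
  unfolding primitive_def[abs_def]
  using leb01.borel_measurable_lebesgue_integral[OF kernel_measurable[OF f, of "\<lambda>_. 1"]] by simp

lemma primitive_diff:
  assumes [measurable]: "f \<in> borel_measurable leb01" "g \<in> borel_measurable leb01"
    and "\<And>x. x \<in> {0..1} \<Longrightarrow> \<bar>f x\<bar> \<le> C" "\<And>x. x \<in> {0..1} \<Longrightarrow> \<bar>g x\<bar> \<le> D"
  shows "primitive (\<lambda>x. f x - g x) x = primitive f x - primitive g x"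
  unfolding primitive_def right_diff_distrib
  using assms(3,4)
  by (intro Bochner_Integration.integral_diff integrable_leb01[of _ C] integrable_leb01[of _ D] indicator_mult_le) auto

text \<open>Integration by parts for merely measurable integrands: Fubini turns the two terms into
  integrals over the two triangles of the unit square.\<close>

lemma primitive_by_parts:
  assumes [measurable]: "q \<in> borel_measurable leb01" "h \<in> borel_measurable leb01"
    and q: "\<And>x. x \<in> {0..1} \<Longrightarrow> \<bar>q x\<bar> \<le> C" and h: "\<And>x. x \<in> {0..1} \<Longrightarrow> \<bar>h x\<bar> \<le> D"
  shows "(\<integral>x. q x * primitive h x \<partial>leb01) + (\<integral>x. h x * primitive q x \<partial>leb01) =
    (\<integral>x. q x \<partial>leb01) * (\<integral>x. h x \<partial>leb01)"
proof -
  interpret P: pair_sigma_finite leb01 leb01 ..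
  interpret PF: finite_measure "leb01 \<Otimes>\<^sub>M leb01"
    by (intro finite_measure_pair_measure finite_measure_leb01)
  have qh: "\<bar>q y * h x\<bar> \<le> C * D" if "x \<in> {0..1}" "y \<in> {0..1}" for x y
    unfolding abs_mult using q[OF that(2)] h[OF that(1)]
    by (intro mult_mono) (auto intro: order_trans[OF abs_ge_zero])
  have ihx: "integrable leb01 (\<lambda>x. indicator {..y} x * (q y * h x))" if "y \<in> {0..1}" for y
    using qh that by (intro integrable_leb01[of _ "C * D"] indicator_mult_le) auto
  have int: "integrable (leb01 \<Otimes>\<^sub>M leb01) (\<lambda>(x, y). indicator {..x} y * (h x * q y))"
  proof (rule PF.integrable_const_bound)
    show "AE z in leb01 \<Otimes>\<^sub>M leb01. norm (case z of (x, y) \<Rightarrow> indicator {..x} y * (h x * q y)) \<le> C * D"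
      using qh by (intro AE_I2) (auto simp: space_pair_measure mult.commute intro!: indicator_mult_le)
    show "(\<lambda>(x, y). indicator {..x} y * (h x * q y)) \<in> borel_measurable (leb01 \<Otimes>\<^sub>M leb01)"
      by (intro kernel_measurable) measurable
  qed
  have A: "(\<integral>x. q x * primitive h x \<partial>leb01) = (\<integral>y. (\<integral>x. indicator {..y} x * (q y * h x) \<partial>leb01) \<partial>leb01)"
    by (simp add: primitive_def mult.left_commute flip: integral_mult_right_zero)
  have "(\<integral>x. h x * primitive q x \<partial>leb01) = (\<integral>x. (\<integral>y. indicator {..x} y * (h x * q y) \<partial>leb01) \<partial>leb01)"
    by (simp add: primitive_def mult.left_commute flip: integral_mult_right_zero)
  also have "\<dots> = (\<integral>y. (\<integral>x. indicator {..x} y * (h x * q y) \<partial>leb01) \<partial>leb01)"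
    using P.Fubini_integral[OF int] by simp
  finally have B: "(\<integral>x. h x * primitive q x \<partial>leb01) = (\<integral>y. (\<integral>x. indicator {..x} y * (h x * q y) \<partial>leb01) \<partial>leb01)" .
  have int_rev: "integrable leb01 (\<lambda>y. (\<integral>x. indicator {..x} y * (h x * q y) \<partial>leb01))"
    using P.integrable_snd[OF int] by simp
  have int_A: "integrable leb01 (\<lambda>y. (\<integral>x. indicator {..y} x * (q y * h x) \<partial>leb01))"
  proof (rule integrable_leb01[of _ "C * D"])
    have "(\<lambda>y. \<integral>x. indicator {..y} x * (q y * h x) \<partial>leb01) = (\<lambda>y. q y * primitive h y)"
      by (simp add: primitive_def mult.left_commute flip: integral_mult_right_zero)
    then show "(\<lambda>y. \<integral>x. indicator {..y} x * (q y * h x) \<partial>leb01) \<in> borel_measurable leb01"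
      by simp
  qed (use qh in \<open>auto intro!: integral_leb01_abs_le indicator_mult_le\<close>)
  have ihx2: "integrable leb01 (\<lambda>x. indicator {..x} y * (h x * q y))" if "y \<in> {0..1}" for y
  proof (rule integrable_leb01[of _ "C * D"])
    show "(\<lambda>x. indicator {..x} y * (h x * q y)) \<in> borel_measurable leb01"
    proof -
      have "(\<lambda>x. indicator {..x} y * (h x * q y)) = (\<lambda>x. indicator {y..} x * (h x * q y))"
        by (auto simp: indicator_def)
      then show ?thesis by simp
    qed
    show "\<bar>indicator {..x} y * (h x * q y)\<bar> \<le> C * D" if "x \<in> {0..1}" for x
      using qh[OF that \<open>y \<in> {0..1}\<close>] by (intro indicator_mult_le) (simp add: mult.commute)
  qed
  have "(\<integral>x. q x * primitive h x \<partial>leb01) + (\<integral>x. h x * primitive q x \<partial>leb01) =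
    (\<integral>y. (\<integral>x. indicator {..y} x * (q y * h x) \<partial>leb01) + (\<integral>x. indicator {..x} y * (h x * q y) \<partial>leb01) \<partial>leb01)"
    unfolding A B by (rule Bochner_Integration.integral_add[symmetric]) fact+
  also have "\<dots> = (\<integral>y. q y * (\<integral>x. h x \<partial>leb01) \<partial>leb01)"
  proof (rule Bochner_Integration.integral_cong)
    fix y assume "y \<in> space leb01"
    then have y: "y \<in> {0..1}" by simp
    have "(\<integral>x. indicator {..y} x * (q y * h x) \<partial>leb01) + (\<integral>x. indicator {..x} y * (h x * q y) \<partial>leb01) =
       (\<integral>x. indicator {..y} x * (q y * h x) + indicator {..x} y * (h x * q y) \<partial>leb01)"
      by (rule Bochner_Integration.integral_add[symmetric]) (use ihx ihx2 y in auto)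
    also have "\<dots> = (\<integral>x. q y * h x \<partial>leb01)"
    \<comment> \<open>The triangles overlap only on the diagonal, which meets each line of fixed
      \<open>y\<close> in one point.\<close>
    proof (rule integral_cong_AE)
      show "AE x in leb01. indicator {..y} x * (q y * h x) + indicator {..x} y * (h x * q y) = q y * h x"
        using AE_leb01_neq[of y] by eventually_elim (auto simp: indicator_def)
      show "(\<lambda>x. indicator {..y} x * (q y * h x) + indicator {..x} y * (h x * q y)) \<in> borel_measurable leb01"
        using ihx[OF y] ihx2[OF y] by measurable
    qed measurable
    finally show "(\<integral>x. indicator {..y} x * (q y * h x) \<partial>leb01) + (\<integral>x. indicator {..x} y * (h x * q y) \<partial>leb01)
      = q y * (\<integral>x. h x \<partial>leb01)" by simp
  qed simp
  finally show ?thesis by simp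
qed

lemma log_sum_bounds: "0 \<le> ln (1 + exp y)" "ln (1 + exp y) \<le> ln 2 + \<bar>y\<bar>" for y :: real
proof -
  have "1 + exp y \<le> 2 * exp \<bar>y\<bar>" using one_le_exp_iff[of "\<bar>y\<bar>"] exp_le_cancel_iff[of y "\<bar>y\<bar>"] by linarith
  then have "ln (1 + exp y) \<le> ln (2 * exp \<bar>y\<bar>)" by (intro ln_mono) (auto intro: add_pos_pos)
  then show "ln (1 + exp y) \<le> ln 2 + \<bar>y\<bar>" by (simp add: ln_mult)
qed simp

section \<open>The variational problem\<close>

locale profile_problem =
  fixes \<phi>0 \<phi>1 \<epsilon> :: real
  assumes \<phi>01: "\<phi>0 < \<phi>1" and \<epsilon>_pos: "0 < \<epsilon>" and \<epsilon>_less: "\<epsilon> < 1 / (\<phi>1 - \<phi>0)"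
begin

text \<open>The argument \<open>a\<close> is the rescaled slope \<open>\<epsilon> \<phi>\<^sub>x\<close> of the profile \<open>\<phi>\<close>, and \<open>r\<close> is a representative of \<open>\<rho>\<close>.\<close>

definition mass :: real where "mass = \<epsilon> * (\<phi>1 - \<phi>0)"

text \<open>The bounds are imposed at every point of the unit interval, so that later estimates
  involve no exceptional sets. A density satisfying them almost everywhere can be clipped into this
  form.\<close>

definition admissible :: "(real \<Rightarrow> real) \<Rightarrow> bool" where
  "admissible a \<longleftrightarrow> a \<in> borel_measurable leb01 \<and> (\<forall>x\<in>{0..1}. 0 \<le> a x \<and> a x \<le> 1) \<and> (\<integral>x. a x \<partial>leb01) = mass"

definition profile :: "(real \<Rightarrow> real) \<Rightarrow> real \<Rightarrow> real" where
  "profile a x = \<phi>0 + primitive a x / \<epsilon>"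

definition cost :: "(real \<Rightarrow> real) \<Rightarrow> (real \<Rightarrow> real) \<Rightarrow> real \<Rightarrow> real" where
  "cost r a x = binary_entropy (a x) + (profile a x - ln (1 + exp (profile a x))) - r x * profile a x"

text \<open>This is \<Lambda> minus the pairing with \<rho>, expressed through the slope; the
  Legendre transform maximizes \<open>- J\<close>.\<close>

definition J :: "(real \<Rightarrow> real) \<Rightarrow> (real \<Rightarrow> real) \<Rightarrow> real" where
  "J r a = (\<integral>x. cost r a x \<partial>leb01)"

text \<open>The derivative of the non-entropic part of \<open>cost\<close> with respect to the value
  of the profile; it is not the slope of the profile, which is \<open>a\<close>.\<close>

definition slope :: "(real \<Rightarrow> real) \<Rightarrow> (real \<Rightarrow> real) \<Rightarrow> real \<Rightarrow> real" where
  "slope r a x = 1 - logistic (profile a x) - r x"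

text \<open>The upper bound is the hypothesis on \<open>\<epsilon>\<close>. It makes
  \<open>mass\<close> a value of the logistic function and leaves room for slopes steeper than the
  mean.\<close>

lemma mass_pos: "0 < mass" and mass_less_1: "mass < 1"
  using \<phi>01 \<epsilon>_pos \<epsilon>_less by (auto simp: mass_def field_simps)

definition bound :: real where "bound = \<bar>\<phi>0\<bar> + 1 / \<epsilon>"

lemma admissibleD:
  assumes "admissible a"
  shows admissible_measurable: "a \<in> borel_measurable leb01"
    and admissible_nonneg: "x \<in> {0..1} \<Longrightarrow> 0 \<le> a x" and admissible_le_1: "x \<in> {0..1} \<Longrightarrow> a x \<le> 1"
    and admissible_abs: "x \<in> {0..1} \<Longrightarrow> \<bar>a x\<bar> \<le> 1"
    and admissible_integral: "(\<integral>x. a x \<partial>leb01) = mass"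
  using assms by (auto simp: admissible_def)

lemma profile_measurable: "admissible a \<Longrightarrow> profile a \<in> borel_measurable leb01"
  unfolding profile_def[abs_def] using admissible_measurable[of a] by measurable

lemma profile_abs_le:
  assumes "admissible a"
  shows "\<bar>profile a x\<bar> \<le> bound"
proof -
  have "\<bar>primitive a x\<bar> \<le> 1"
    using assms by (intro primitive_abs_le admissibleD)
  then have "\<bar>primitive a x / \<epsilon>\<bar> \<le> 1 / \<epsilon>"
    using \<epsilon>_pos by (simp add: divide_right_mono)
  then show ?thesis unfolding profile_def bound_def by linarith
qed

lemma cost_measurable:
  assumes "admissible a" and [measurable]: "r \<in> borel_measurable leb01"
  shows "cost r a \<in> borel_measurable leb01"
proof -
  note [measurable] = profile_measurable[OF assms(1)] admissible_measurable[OF assms(1)]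
  show ?thesis unfolding cost_def[abs_def] by measurable
qed

lemma cost_abs_le:
  assumes a: "admissible a" and r: "\<bar>r x\<bar> \<le> R" and x: "x \<in> {0..1}"
  shows "\<bar>cost r a x\<bar> \<le> 2 * ln 2 + 2 * bound + R * bound"
proof -
  have "\<bar>r x * profile a x\<bar> \<le> R * bound"
    unfolding abs_mult using r profile_abs_le[OF a, of x] by (intro mult_mono) auto
  then show ?thesis unfolding cost_def
    using binary_entropy_abs_le[OF admissible_nonneg[OF a x] admissible_le_1[OF a x]]
      log_sum_bounds[of "profile a x"] profile_abs_le[OF a, of x] by linarith
qed

lemma cost_integrable:
  assumes "admissible a" "r \<in> borel_measurable leb01" "\<And>x. x \<in> {0..1} \<Longrightarrow> \<bar>r x\<bar> \<le> R"
  shows "integrable leb01 (cost r a)"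
  by (rule integrable_leb01[OF cost_measurable cost_abs_le]) (use assms in auto)

lemma J_abs_le:
  assumes "admissible a" "r \<in> borel_measurable leb01" "\<And>x. x \<in> {0..1} \<Longrightarrow> \<bar>r x\<bar> \<le> R"
  shows "\<bar>J r a\<bar> \<le> 2 * ln 2 + 2 * bound + R * bound"
  unfolding J_def by (intro integral_leb01_abs_le cost_measurable cost_abs_le assms)

lemma product_profile_integrable:
  assumes a: "admissible a" and [measurable]: "v \<in> borel_measurable leb01" and v: "\<And>x. x \<in> {0..1} \<Longrightarrow> \<bar>v x\<bar> \<le> C"
  shows "integrable leb01 (\<lambda>x. v x * profile a x)"
proof (rule integrable_leb01)
  note [measurable] = profile_measurable[OF a]
  show "(\<lambda>x. v x * profile a x) \<in> borel_measurable leb01" by measurable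
  show "\<bar>v x * profile a x\<bar> \<le> C * bound" if "x \<in> {0..1}" for x
    unfolding abs_mult using v[OF that] profile_abs_le[OF a, of x] by (intro mult_mono) auto
qed

lemma J_perturb:
  assumes "admissible a" "r \<in> borel_measurable leb01" "\<And>x. x \<in> {0..1} \<Longrightarrow> \<bar>r x\<bar> \<le> R"
    "v \<in> borel_measurable leb01" "\<And>x. x \<in> {0..1} \<Longrightarrow> \<bar>v x\<bar> \<le> C"
  shows "J (\<lambda>x. r x + t * v x) a = J r a - t * (\<integral>x. v x * profile a x \<partial>leb01)"
proof -
  have "J (\<lambda>x. r x + t * v x) a = (\<integral>x. cost r a x - t * (v x * profile a x) \<partial>leb01)"
    unfolding J_def cost_def by (simp add: algebra_simps)
  also have "\<dots> = J r a - t * (\<integral>x. v x * profile a x \<partial>leb01)"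
    unfolding J_def using cost_integrable[OF assms(1-3)] product_profile_integrable[OF assms(1,4,5)]
    by (subst Bochner_Integration.integral_diff) auto
  finally show ?thesis .
qed

lemma slope_measurable:
  assumes "admissible a" and [measurable]: "r \<in> borel_measurable leb01"
  shows "slope r a \<in> borel_measurable leb01"
proof -
  note [measurable] = profile_measurable[OF assms(1)]
  show ?thesis unfolding slope_def[abs_def] by measurable
qed

lemma slope_abs_le: "\<bar>r x\<bar> \<le> R \<Longrightarrow> \<bar>slope r a x\<bar> \<le> 1 + R"
  using logistic_pos[of "profile a x"] logistic_less_1[of "profile a x"]
  unfolding slope_def by linarith

text \<open>The potential of the linearized problem. By parts, the tangent term
  \<open>slope * primitive b / \<epsilon>\<close> turns into
  \<open>- b * primitive slope / \<epsilon>\<close> up to a constant, so the minimization is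
  pointwise and is solved by the logistic function of this potential. The number \<open>p\<close> is
  the Lagrange multiplier of the mass constraint, and also the potential at 0.\<close>

definition field :: "(real \<Rightarrow> real) \<Rightarrow> (real \<Rightarrow> real) \<Rightarrow> real \<Rightarrow> real \<Rightarrow> real" where
  "field r a p x = p + primitive (slope r a) x / \<epsilon>"

lemma field_measurable:
  assumes "admissible a" "r \<in> borel_measurable leb01"
  shows "field r a p \<in> borel_measurable leb01"
proof -
  note [measurable] = slope_measurable[OF assms]
  show ?thesis unfolding field_def[abs_def] by measurable
qed

text \<open>The constant potential whose logistic value is \<open>mass\<close>; it is the centre of
  the interval in which multipliers are sought.\<close>

definition logit_mass :: real where "logit_mass = ln (mass / (1 - mass))"

lemma logistic_logit_mass: "logistic logit_mass = mass"
  using mass_pos mass_less_1 by (simp add: logistic_def logit_mass_def exp_minus field_simps)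

lemma primitive_slope_abs_le:
  assumes "admissible a" "r \<in> borel_measurable leb01" "\<And>x. x \<in> {0..1} \<Longrightarrow> \<bar>r x\<bar> \<le> R"
  shows "\<bar>primitive (slope r a) x / \<epsilon>\<bar> \<le> (1 + R) / \<epsilon>"
proof -
  have "\<bar>primitive (slope r a) x\<bar> \<le> 1 + R"
    by (intro primitive_abs_le slope_measurable slope_abs_le assms)
  then show ?thesis using \<epsilon>_pos by (simp add: divide_right_mono)
qed

text \<open>The potential differs from \<open>p\<close> by at most
  \<open>(1 + R) / \<epsilon>\<close>. At the two ends of this interval around
  \<open>logit_mass\<close> the mean therefore lies on opposite sides of \<open>mass\<close>, and
  the intermediate value theorem applies. The bound on \<open>p\<close>, independent of
  \<open>a\<close>, later gives compactness.\<close>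

lemma exists_admissible_field:
  assumes a: "admissible a" and r: "r \<in> borel_measurable leb01" and R: "\<And>x. x \<in> {0..1} \<Longrightarrow> \<bar>r x\<bar> \<le> R"
  shows "\<exists>p. \<bar>p - logit_mass\<bar> \<le> (1 + R) / \<epsilon> \<and> admissible (\<lambda>x. logistic (field r a p x))"
proof -
  define B where "B = (1 + R) / \<epsilon>"
  define F where "F = (\<lambda>p. \<integral>x. logistic (field r a p x) \<partial>leb01)"
  note [measurable] = field_measurable[OF a r]
  have l: "\<bar>logistic z\<bar> \<le> 1" for z :: real
    using logistic_pos[of z] logistic_less_1[of z] by simp
  have int: "integrable leb01 (\<lambda>x. logistic (field r a p x))" for p
    by (rule integrable_leb01[of _ 1]) (auto simp: l)
  have pert: "\<bar>field r a p x - p\<bar> \<le> B" for p x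
    using primitive_slope_abs_le[OF a r R, of x] by (simp add: field_def B_def)
  have B: "0 \<le> B" using pert[of 0 0] by linarith
  have le: "F (logit_mass - B) \<le> (\<integral>x. mass \<partial>leb01)" unfolding F_def
    using int pert[of "logit_mass - B"] logistic_mono[of _ logit_mass] logistic_logit_mass
    by (intro integral_mono leb01.integrable_const) (auto simp: abs_le_iff diff_le_eq)
  have ge: "(\<integral>x. mass \<partial>leb01) \<le> F (logit_mass + B)" unfolding F_def
    using int pert[of "logit_mass + B"] logistic_mono[of logit_mass] logistic_logit_mass
    by (intro integral_mono leb01.integrable_const) (auto simp: abs_le_iff algebra_simps)
  have "continuous_on UNIV F"
  proof (rule lipschitz_on_continuous_on[of 1], rule lipschitz_onI)
    fix p p' :: real
    have "dist (F p) (F p') = \<bar>\<integral>x. logistic (field r a p x) - logistic (field r a p' x) \<partial>leb01\<bar>"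
      unfolding F_def by (simp add: Bochner_Integration.integral_diff[OF int int] dist_real_def)
    also have "\<dots> \<le> \<bar>p - p'\<bar>"
    proof (rule integral_leb01_abs_le)
      fix x show "\<bar>logistic (field r a p x) - logistic (field r a p' x)\<bar> \<le> \<bar>p - p'\<bar>"
        using logistic_Lipschitz[of "field r a p x" "field r a p' x"] by (simp add: field_def)
    qed measurable
    finally show "dist (F p) (F p') \<le> 1 * dist p p'" by (simp add: dist_real_def)
  qed simp
  then have "\<exists>p\<ge>logit_mass - B. p \<le> logit_mass + B \<and> F p = mass"
    using le ge B by (intro IVT') (auto intro: continuous_on_subset)
  then obtain p where p: "\<bar>p - logit_mass\<bar> \<le> B" "F p = mass" by (auto simp: abs_le_iff algebra_simps)
  have "admissible (\<lambda>x. logistic (field r a p x))"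
    using p(2) unfolding F_def admissible_def by (auto simp: logistic_pos logistic_less_1 less_imp_le)
  then show ?thesis using p(1) unfolding B_def by blast
qed

text \<open>The concave part of the functional is replaced by its tangent at \<open>a\<close>; the function
  \<open>b\<close> is the explicit minimizer of the resulting convex functional.\<close>

lemma J_linearization:
  assumes a: "admissible a" and r[measurable]: "r \<in> borel_measurable leb01" and R: "\<And>x. x \<in> {0..1} \<Longrightarrow> \<bar>r x\<bar> \<le> R"
    and b_def: "b = (\<lambda>x. logistic (field r a p x))" and b: "admissible b"
  shows "J r b \<le> J r a" and "J r b = J r a \<Longrightarrow> AE x in leb01. a x = b x"
proof -
  define q where "q = slope r a"
  define w where "w = field r a p"
  note [measurable] = admissible_measurable[OF a] admissible_measurable[OF b]
    profile_measurable[OF a] profile_measurable[OF b]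
  have q[measurable]: "q \<in> borel_measurable leb01" and qR: "\<And>x. x \<in> {0..1} \<Longrightarrow> \<bar>q x\<bar> \<le> 1 + R"
    unfolding q_def by (intro slope_measurable slope_abs_le a r R; assumption)+
  have w[measurable]: "w \<in> borel_measurable leb01" using field_measurable[OF a r] by (simp add: w_def)
  have wR: "\<bar>w x\<bar> \<le> \<bar>p\<bar> + (1 + R) / \<epsilon>" for x
    using primitive_slope_abs_le[OF a r R, of x] unfolding w_def field_def by linarith
  \<comment> \<open>The Fenchel gap between the slope \<open>a\<close> and the potential
    \<open>w\<close>. It vanishes only where \<open>a\<close> is the logistic value of
    \<open>w\<close>, and its integral bounds the decrease of \<open>J\<close> from below.\<close>
  define d where "d = (\<lambda>x. binary_entropy (a x) - (w x * a x - ln (1 + exp (w x))))"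
  have bw: "b x = logistic (w x)" for x by (simp add: b_def w_def)
  have d_eq: "d x = (binary_entropy (a x) - binary_entropy (b x)) + w x * (b x - a x)" for x
    by (simp add: d_def bw binary_entropy_logistic algebra_simps)
  have d_nonneg: "0 \<le> d x" if "x \<in> {0..1}" for x
    using entropy_Fenchel(1)[OF admissible_nonneg[OF a that] admissible_le_1[OF a that]] by (simp add: d_def)
  have ba: "\<bar>b x - a x\<bar> \<le> 1" if "x \<in> {0..1}" for x
    using admissibleD(2,3)[OF a that] admissibleD(2,3)[OF b that] by linarith
  have prod_bound: "\<bar>u * z\<bar> \<le> C" if "\<bar>u\<bar> \<le> C" "\<bar>z\<bar> \<le> 1" for u z C :: real
    using mult_mono[of "\<bar>u\<bar>" C "\<bar>z\<bar>" 1] that by (simp add: abs_mult)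
  have int_wba: "integrable leb01 (\<lambda>x. w x * (b x - a x))"
    by (rule integrable_leb01[of _ "\<bar>p\<bar> + (1 + R) / \<epsilon>"]) (use wR ba prod_bound in auto)
  have int_ent: "integrable leb01 (\<lambda>x. binary_entropy (c x))" if c: "admissible c" for c
    using c binary_entropy_abs_le admissible_measurable[OF c]
    by (intro integrable_leb01[of _ "ln 2"]) (auto simp: admissible_def)
  have int_d: "integrable leb01 d"
    unfolding d_eq[abs_def]
    by (intro Bochner_Integration.integrable_add Bochner_Integration.integrable_diff int_wba int_ent a b)
  have int_ba: "integrable leb01 (\<lambda>x. b x - a x)"
    by (rule integrable_leb01[of _ 1]) (use ba in auto)
  have ba0: "(\<integral>x. b x - a x \<partial>leb01) = 0"
    using admissibleD[OF a] admissibleD[OF b]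
    by (subst Bochner_Integration.integral_diff) (auto intro!: integrable_leb01[of _ 1])
  have prim: "profile b x - profile a x = primitive (\<lambda>x. b x - a x) x / \<epsilon>" for x
    using primitive_diff[of b a 1 1 x] admissibleD[OF a] admissibleD[OF b]
    by (simp add: profile_def diff_divide_distrib)
  have pabs: "\<bar>primitive (\<lambda>x. b x - a x) x / \<epsilon>\<bar> \<le> 1 / \<epsilon>" for x
    using \<epsilon>_pos primitive_abs_le[of "\<lambda>x. b x - a x" 1 x] ba by (simp add: divide_right_mono)
  have int_q: "integrable leb01 (\<lambda>x. q x * (primitive (\<lambda>x. b x - a x) x / \<epsilon>))"
  proof (rule integrable_leb01[of _ "(1 + R) * (1 / \<epsilon>)"])
    show "\<bar>q x * (primitive (\<lambda>x. b x - a x) x / \<epsilon>)\<bar> \<le> (1 + R) * (1 / \<epsilon>)" if "x \<in> {0..1}" for x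
      unfolding abs_mult using qR[OF that] pabs[of x] by (intro mult_mono) auto
  qed measurable
  \<comment> \<open>The multiplier \<open>p\<close> and the boundary term of the integration by
    parts both drop out, because \<open>a\<close> and \<open>b\<close> have the same mean.\<close>
  have wint: "(\<integral>x. w x * (b x - a x) \<partial>leb01) = - (\<integral>x. q x * (primitive (\<lambda>x. b x - a x) x / \<epsilon>) \<partial>leb01)"
  proof -
    have int1: "integrable leb01 (\<lambda>x. (b x - a x) * primitive q x)"
      using ba primitive_abs_le[OF q qR]
      by (intro integrable_leb01[of _ "1 + R"]) (auto simp: mult.commute[of "b _ - a _"] intro!: prod_bound)
    have "(\<integral>x. w x * (b x - a x) \<partial>leb01) = (\<integral>x. p * (b x - a x) + (b x - a x) * primitive q x / \<epsilon> \<partial>leb01)"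
      unfolding w_def field_def q_def by (simp add: algebra_simps)
    also have "\<dots> = p * (\<integral>x. b x - a x \<partial>leb01) + (\<integral>x. (b x - a x) * primitive q x \<partial>leb01) / \<epsilon>"
      using int_ba int1 by (subst Bochner_Integration.integral_add) auto
    also have "\<dots> = - (\<integral>x. q x * primitive (\<lambda>x. b x - a x) x \<partial>leb01) / \<epsilon>"
      using primitive_by_parts[of q "\<lambda>x. b x - a x" "1 + R" 1] qR ba ba0
      by (simp add: add_eq_0_iff)
    finally show ?thesis by simp
  qed
  have "J r b - J r a = (\<integral>x. cost r b x - cost r a x \<partial>leb01)"
    unfolding J_def using cost_integrable[OF a r R] cost_integrable[OF b r R] by simp
  also have "\<dots> \<le> (\<integral>x. (binary_entropy (b x) - binary_entropy (a x))
      + q x * (primitive (\<lambda>x. b x - a x) x / \<epsilon>) \<partial>leb01)"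
  proof (rule integral_mono)
    show "integrable leb01 (\<lambda>x. cost r b x - cost r a x)"
      using cost_integrable[OF a r R] cost_integrable[OF b r R] by simp
    show "integrable leb01 (\<lambda>x. (binary_entropy (b x) - binary_entropy (a x))
      + q x * (primitive (\<lambda>x. b x - a x) x / \<epsilon>))"
      by (intro Bochner_Integration.integrable_add Bochner_Integration.integrable_diff int_q int_ent a b)
    fix x
    \<comment> \<open>The only inequality in this chain: the concave part lies below its tangent at
      \<open>profile a x\<close>.\<close>
    show "cost r b x - cost r a x \<le> (binary_entropy (b x) - binary_entropy (a x))
      + q x * (primitive (\<lambda>x. b x - a x) x / \<epsilon>)"
      using log_sum_convex[of "profile a x" "profile b x"]
      unfolding prim[symmetric] q_def slope_def cost_def by (simp add: algebra_simps)
  qed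
  also have "\<dots> = - (\<integral>x. d x \<partial>leb01)"
  proof -
    have "(\<integral>x. (binary_entropy (b x) - binary_entropy (a x))
      + q x * (primitive (\<lambda>x. b x - a x) x / \<epsilon>) \<partial>leb01) =
      (\<integral>x. binary_entropy (b x) \<partial>leb01) - (\<integral>x. binary_entropy (a x) \<partial>leb01)
       + (\<integral>x. q x * (primitive (\<lambda>x. b x - a x) x / \<epsilon>) \<partial>leb01)"
      using int_ent[OF a] int_ent[OF b] int_q
      by (subst Bochner_Integration.integral_add) (auto intro!: Bochner_Integration.integrable_diff)
    moreover have "(\<integral>x. d x \<partial>leb01) = ((\<integral>x. binary_entropy (a x) \<partial>leb01) - (\<integral>x. binary_entropy (b x) \<partial>leb01))
       + (\<integral>x. w x * (b x - a x) \<partial>leb01)"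
      unfolding d_eq using int_ent[OF a] int_ent[OF b] int_wba
      by (subst Bochner_Integration.integral_add) (auto intro!: Bochner_Integration.integrable_diff)
    ultimately show ?thesis using wint by simp
  qed
  finally have main: "J r b - J r a \<le> - (\<integral>x. d x \<partial>leb01)" .
  have dint: "0 \<le> (\<integral>x. d x \<partial>leb01)" using d_nonneg by (intro Bochner_Integration.integral_nonneg) auto
  show "J r b \<le> J r a" using main dint by linarith
  show "AE x in leb01. a x = b x" if "J r b = J r a"
  proof -
    have "(\<integral>x. d x \<partial>leb01) = 0" using main dint that by linarith
    then have "AE x in leb01. d x = 0"
      using integral_nonneg_eq_0_iff_AE[OF int_d AE_I2] d_nonneg by simp
    then show ?thesis using AE_space
    proof eventually_elim
      case (elim x)
      then show ?case using entropy_Fenchel(2)[of "a x" "w x"] admissibleD(2,3)[OF a, of x]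
        by (simp add: d_def bw)
    qed
  qed
qed

end

section \<open>Compactness of potentials and existence of minimizers\<close>

lemma leb01_bounded_convergence:
  fixes f :: "nat \<Rightarrow> real \<Rightarrow> real"
  assumes f: "\<And>n. f n \<in> borel_measurable leb01"
    and C: "\<And>n x. x \<in> {0..1} \<Longrightarrow> \<bar>f n x\<bar> \<le> C"
    and lim: "\<And>x. x \<in> {0..1} \<Longrightarrow> (\<lambda>n. f n x) \<longlonglongrightarrow> g x"
  shows "g \<in> borel_measurable leb01" "(\<lambda>n. \<integral>x. f n x \<partial>leb01) \<longlonglongrightarrow> (\<integral>x. g x \<partial>leb01)"
proof -
  show g: "g \<in> borel_measurable leb01"
    by (rule borel_measurable_LIMSEQ_real[of _ f]) (use f lim in auto)
  show "(\<lambda>n. \<integral>x. f n x \<partial>leb01) \<longlonglongrightarrow> (\<integral>x. g x \<partial>leb01)"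
  proof (rule integral_dominated_convergence[where w = "\<lambda>_. C"])
    show "integrable leb01 (\<lambda>_. C)" by (rule leb01.integrable_const)
    show "AE x in leb01. (\<lambda>n. f n x) \<longlonglongrightarrow> g x" using lim by (intro AE_I2) simp
    show "AE x in leb01. norm (f n x) \<le> C" for n using C by (intro AE_I2) simp
  qed (use f g in auto)
qed

context profile_problem
begin

text \<open>\<open>slope\<close> is bounded by \<open>1 + R\<close> whatever \<open>a\<close> is, so
  the potentials are equi-Lipschitz, and the bound on \<open>p\<close> makes them equibounded.
  Neither \<open>a\<close> nor \<open>r\<close> has to converge.\<close>

lemma field_compact:
  assumes a: "\<And>n. admissible (a n)" and r: "\<And>n. r n \<in> borel_measurable leb01"
    and R: "\<And>n x. x \<in> {0..1} \<Longrightarrow> \<bar>r n x\<bar> \<le> R" and p: "\<And>n. \<bar>p n - logit_mass\<bar> \<le> (1 + R) / \<epsilon>"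
  obtains u k where "strict_mono (k :: nat \<Rightarrow> nat)"
    "\<And>x. x \<in> {0..1} \<Longrightarrow> (\<lambda>n. field (r (k n)) (a (k n)) (p (k n)) x) \<longlonglongrightarrow> u x"
proof -
  define L where "L = (1 + R) / \<epsilon>"
  let ?w = "\<lambda>n. field (r n) (a n) (p n)"
  have Lip: "\<bar>?w n x - ?w n y\<bar> \<le> L * \<bar>x - y\<bar>" if "x \<in> {0..1}" "y \<in> {0..1}" for n x y
  proof -
    have "\<bar>primitive (slope (r n) (a n)) x - primitive (slope (r n) (a n)) y\<bar> \<le> (1 + R) * \<bar>x - y\<bar>"
      using that by (intro primitive_Lipschitz slope_measurable slope_abs_le a r R)
    then have "\<bar>primitive (slope (r n) (a n)) x - primitive (slope (r n) (a n)) y\<bar> / \<epsilon> \<le> (1 + R) * \<bar>x - y\<bar> / \<epsilon>"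
      using \<epsilon>_pos by (simp add: divide_right_mono)
    then show ?thesis using \<epsilon>_pos by (simp add: field_def L_def diff_divide_distrib[symmetric])
  qed
  have L: "0 \<le> L" using Lip[of 1 0 0] by simp
  have bdd: "\<bar>?w n x\<bar> \<le> \<bar>logit_mass\<bar> + L + L" for n x
  proof -
    have "\<bar>primitive (slope (r n) (a n)) x / \<epsilon>\<bar> \<le> L"
      unfolding L_def by (intro primitive_slope_abs_le a r R)
    then show ?thesis using p[of n] unfolding L_def[symmetric] field_def by linarith
  qed
  obtain u k where "strict_mono (k :: nat \<Rightarrow> nat)"
    and conv: "\<And>e. 0 < e \<Longrightarrow> \<exists>N. \<forall>n x. n \<ge> N \<and> x \<in> {0..1} \<longrightarrow> norm (?w (k n) x - u x) < e"
  proof (rule Arzela_Ascoli[of "{0..1::real}" ?w "\<bar>logit_mass\<bar> + L + L"])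
    fix x e :: real assume "x \<in> {0..1}" "0 < e"
    show "\<exists>d>0. \<forall>n y. y \<in> {0..1} \<and> norm (x - y) < d \<longrightarrow> norm (?w n x - ?w n y) < e"
    proof (intro exI[of _ "e / (L + 1)"] conjI allI impI)
      show "e / (L + 1) > 0" using L \<open>0 < e\<close> by simp
      fix n y assume y: "y \<in> {0..1} \<and> norm (x - y) < e / (L + 1)"
      have "norm (?w n x - ?w n y) \<le> (L + 1) * \<bar>x - y\<bar>"
        using Lip[of x y n] y \<open>x \<in> {0..1}\<close> by (simp add: distrib_right)
      also have "\<dots> < e" using y L by (simp add: field_simps)
      finally show "norm (?w n x - ?w n y) < e" .
    qed
  qed (use bdd in auto)
  show thesis
  proof (rule that)
    show "strict_mono k" by fact
    show "(\<lambda>n. ?w (k n) x) \<longlonglongrightarrow> u x" if "x \<in> {0..1}" for x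
      unfolding LIMSEQ_iff using conv that by blast
  qed
qed

text \<open>For logistic slopes the entropy is an explicit continuous function of the potential, so
  pointwise convergence of potentials makes \<open>J\<close> converge, where weak convergence of
  slopes would give only semicontinuity of the entropy.\<close>

lemma logistic_limit:
  assumes b_def: "\<And>n. b n = (\<lambda>x. logistic (w n x))" and c_def: "c = (\<lambda>x. logistic (u x))"
    and b: "\<And>n. admissible (b n)"
    and lim: "\<And>x. x \<in> {0..1} \<Longrightarrow> (\<lambda>n. w n x) \<longlonglongrightarrow> u x"
  shows "admissible c"
    and "\<And>x. (\<lambda>n. profile (b n) x) \<longlonglongrightarrow> profile c x"
    and "\<lbrakk>r \<in> borel_measurable leb01; \<And>x. x \<in> {0..1} \<Longrightarrow> \<bar>r x\<bar> \<le> R\<rbrakk> \<Longrightarrow>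
      (\<lambda>n. \<integral>x. r x * profile (b n) x \<partial>leb01) \<longlonglongrightarrow> (\<integral>x. r x * profile c x \<partial>leb01)"
    and "\<lbrakk>r \<in> borel_measurable leb01; \<And>x. x \<in> {0..1} \<Longrightarrow> \<bar>r x\<bar> \<le> R\<rbrakk> \<Longrightarrow>
      (\<lambda>n. J r (b n)) \<longlonglongrightarrow> J r c"
proof -
  note bm[measurable] = admissible_measurable[OF b]
  have pt: "(\<lambda>n. b n x) \<longlonglongrightarrow> c x" if "x \<in> {0..1}" for x
    unfolding b_def c_def using lim[OF that] by (rule tendsto_logistic)
  note conv = leb01_bounded_convergence[of b 1 c, OF bm admissible_abs[OF b] pt]
  show c: "admissible c"
    unfolding admissible_def using conv logistic_pos logistic_less_1
    by (auto simp: c_def admissible_integral[OF b] LIMSEQ_const_iff intro: less_imp_le)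
  show prof: "(\<lambda>n. profile (b n) x) \<longlonglongrightarrow> profile c x" for x
  proof -
    have "(\<lambda>n. primitive (b n) x) \<longlonglongrightarrow> primitive c x"
      unfolding primitive_def
    proof (rule leb01_bounded_convergence(2)[where C = 1])
      show "\<bar>indicator {..x} y * b n y\<bar> \<le> 1" if "y \<in> {0..1}" for n y
        using admissible_abs[OF b that] by (rule indicator_mult_le)
    qed (auto intro!: tendsto_intros pt)
    then show ?thesis unfolding profile_def using \<epsilon>_pos by (intro tendsto_intros) auto
  qed
  show "(\<lambda>n. \<integral>x. r x * profile (b n) x \<partial>leb01) \<longlonglongrightarrow> (\<integral>x. r x * profile c x \<partial>leb01)"
    if [measurable]: "r \<in> borel_measurable leb01" and R: "\<And>x. x \<in> {0..1} \<Longrightarrow> \<bar>r x\<bar> \<le> R"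
  proof (rule leb01_bounded_convergence(2)[where C = "R * bound"])
    show "(\<lambda>x. r x * profile (b n) x) \<in> borel_measurable leb01" for n
      using product_profile_integrable[OF b that] by (rule borel_measurable_integrable)
    show "\<bar>r x * profile (b n) x\<bar> \<le> R * bound" if "x \<in> {0..1}" for n x
      unfolding abs_mult using R[OF that] profile_abs_le[OF b, of n x] by (intro mult_mono) auto
  qed (intro tendsto_intros prof)
  show "(\<lambda>n. J r (b n)) \<longlonglongrightarrow> J r c"
    if r[measurable]: "r \<in> borel_measurable leb01" and R: "\<And>x. x \<in> {0..1} \<Longrightarrow> \<bar>r x\<bar> \<le> R"
    unfolding J_def
  proof (rule leb01_bounded_convergence(2)[OF cost_measurable[OF b r]])
    show "\<bar>cost r (b n) x\<bar> \<le> 2 * ln 2 + 2 * bound + R * bound" if "x \<in> {0..1}" for n x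
      by (intro cost_abs_le b R that)
    fix x :: real assume x: "x \<in> {0..1}"
    have nz: "1 + exp y \<noteq> 0" for y :: real using exp_gt_zero[of y] by linarith
    show "(\<lambda>n. cost r (b n) x) \<longlonglongrightarrow> cost r c x"
      unfolding cost_def unfolding b_def c_def unfolding binary_entropy_logistic
      by (intro tendsto_intros prof[unfolded b_def c_def] lim[OF x] tendsto_logistic nz)
  qed
qed

lemma admissible_mass: "admissible (\<lambda>_. mass)"
  using mass_pos mass_less_1 by (simp add: admissible_def)

lemma approximate_minimizer:
  assumes r: "r \<in> borel_measurable leb01" and R: "\<And>x. x \<in> {0..1} \<Longrightarrow> \<bar>r x\<bar> \<le> R" and e: "0 < e"
  shows "\<exists>a. admissible a \<and> (\<forall>c. admissible c \<longrightarrow> J r a \<le> J r c + e)"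
proof -
  let ?S = "J r ` {a. admissible a}"
  have ne: "?S \<noteq> {}" using admissible_mass by blast
  have bdd: "bdd_below ?S"
    using J_abs_le[OF _ r R] by (intro bdd_belowI[of _ "- (2 * ln 2 + 2 * bound + R * bound)"])
      (force simp: abs_le_iff)
  obtain s where "s \<in> ?S" "s < Inf ?S + e"
    using cInf_lessD[OF ne, of "Inf ?S + e"] e by auto
  then obtain a where "admissible a" "J r a < Inf ?S + e" by auto
  moreover have "Inf ?S \<le> J r c" if "admissible c" for c
    using that by (intro cInf_lower bdd) auto
  ultimately show ?thesis by force
qed

text \<open>Existence and the upper half of Danskin's theorem in one compactness argument. Almost
  minimizers for the perturbed coefficients are replaced by logistic ones and pass to a limit
  \<open>a\<close>, which minimizes the unperturbed functional and whose pairing with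
  \<open>v\<close> controls the first order change.\<close>

lemma perturbed_minimizer:
  assumes r[measurable]: "r \<in> borel_measurable leb01" and R: "\<And>x. x \<in> {0..1} \<Longrightarrow> \<bar>r x\<bar> \<le> R"
    and v[measurable]: "v \<in> borel_measurable leb01" and V: "\<And>x. x \<in> {0..1} \<Longrightarrow> \<bar>v x\<bar> \<le> V"
  obtains a t e where "admissible a" "\<And>c. admissible c \<Longrightarrow> J r a \<le> J r c"
    "\<And>n::nat. 0 < t n" "t \<longlonglongrightarrow> 0" "e \<longlonglongrightarrow> 0"
    "\<And>n c. admissible c \<Longrightarrow>
      - J (\<lambda>x. r x + t n * v x) c \<le> - J r a + t n * ((\<integral>x. v x * profile a x \<partial>leb01) + e n)"
proof -
  define s where "s = (\<lambda>n. 1 / real (Suc n))"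
  have s: "0 < s n" "s n \<le> 1" for n by (auto simp: s_def)
  have s0: "s \<longlonglongrightarrow> 0" unfolding s_def by (rule LIMSEQ_Suc[OF lim_1_over_n])
  define rn where "rn = (\<lambda>n x. r x + s n * v x)"
  have rn: "rn n \<in> borel_measurable leb01" for n unfolding rn_def by measurable
  have RV: "\<bar>rn n x\<bar> \<le> R + V" if "x \<in> {0..1}" for n x
  proof -
    have "\<bar>s n * v x\<bar> \<le> 1 * V" unfolding abs_mult using s[of n] V[OF that] by (intro mult_mono) auto
    then show ?thesis unfolding rn_def using R[OF that] by linarith
  qed
  \<comment> \<open>The tolerance is the square of the perturbation size, so it still vanishes after
    division by that size.\<close>
  have "\<exists>a. admissible a \<and> (\<forall>c. admissible c \<longrightarrow> J (rn n) a \<le> J (rn n) c + (s n)\<^sup>2)" for n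
    using s(1)[of n] by (intro approximate_minimizer[OF rn RV]) auto
  then obtain a0 where a0: "\<And>n. admissible (a0 n)"
    "\<And>n c. admissible c \<Longrightarrow> J (rn n) (a0 n) \<le> J (rn n) c + (s n)\<^sup>2" by metis
  have "\<exists>p. \<bar>p - logit_mass\<bar> \<le> (1 + (R + V)) / \<epsilon> \<and> admissible (\<lambda>x. logistic (field (rn n) (a0 n) p x))" for n
    by (rule exists_admissible_field[OF a0(1) rn RV])
  then obtain p where p: "\<And>n. \<bar>p n - logit_mass\<bar> \<le> (1 + (R + V)) / \<epsilon>"
    "\<And>n. admissible (\<lambda>x. logistic (field (rn n) (a0 n) (p n) x))" by metis
  obtain u k where k: "strict_mono (k :: nat \<Rightarrow> nat)"
    and u: "\<And>x. x \<in> {0..1} \<Longrightarrow> (\<lambda>n. field (rn (k n)) (a0 (k n)) (p (k n)) x) \<longlonglongrightarrow> u x"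
    using field_compact[of a0 rn "R + V" p, OF a0(1) rn RV p(1)] by blast
  define b where "b = (\<lambda>n x. logistic (field (rn (k n)) (a0 (k n)) (p (k n)) x))"
  define a where "a = (\<lambda>x. logistic (u x))"
  define t where "t = s \<circ> k"
  have t: "0 < t n" for n using s by (simp add: t_def)
  have t0: "t \<longlonglongrightarrow> 0" unfolding t_def by (rule LIMSEQ_subseq_LIMSEQ[OF s0 k])
  have b: "admissible (b n)" for n using p by (simp add: b_def)
  note L = logistic_limit[OF b_def[THEN fun_cong] a_def b]
  have a: "admissible a" by (rule L(1)) (rule u)
  define I where "I = (\<lambda>c. \<integral>x. v x * profile c x \<partial>leb01)"
  have Ilim: "(\<lambda>n. I (b n)) \<longlonglongrightarrow> I a" unfolding I_def by (rule L(3)[OF _ v]) (use u V in auto)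
  have Jlim: "(\<lambda>n. J r (b n)) \<longlonglongrightarrow> J r a" by (rule L(4)[OF _ r]) (use u R in auto)
  have pert: "J (\<lambda>x. r x + t n * v x) c = J r c - t n * I c" if "admissible c" for n c
    unfolding I_def using J_perturb[OF that r R v V] by blast
  \<comment> \<open>The logistic replacement does not increase the perturbed cost, so it inherits
    the tolerance.\<close>
  have bmin: "J (\<lambda>x. r x + t n * v x) (b n) \<le> J (\<lambda>x. r x + t n * v x) c + (t n)\<^sup>2" if "admissible c" for n c
    using J_linearization(1)[OF a0(1) rn RV b_def[THEN fun_cong] b, of n] a0(2)[OF that, of "k n"]
    unfolding rn_def t_def by (simp add: b_def)
  have bmin': "J r (b n) - t n * I (b n) \<le> J r c - t n * I c + (t n)\<^sup>2" if "admissible c" for n c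
    using bmin[OF that, of n] by (simp add: pert b that)
  have amin: "J r a \<le> J r c" if c: "admissible c" for c
  proof (rule LIMSEQ_le)
    show "(\<lambda>n. J r (b n) - t n * I (b n)) \<longlonglongrightarrow> J r a"
      using tendsto_diff[OF Jlim tendsto_mult[OF t0 Ilim]] by simp
    show "(\<lambda>n. J r c - t n * I c + (t n)\<^sup>2) \<longlonglongrightarrow> J r c"
      using tendsto_add[OF tendsto_diff[OF tendsto_const tendsto_mult[OF t0 tendsto_const]] tendsto_power[OF t0, of 2]] by simp
  qed (use bmin'[OF c] in auto)
  show thesis
  \<comment> \<open>The difference of the pairings comes from replacing \<open>b n\<close> by its
    limit, and the final \<open>t n\<close> is the tolerance divided by \<open>t n\<close>.\<close>
  proof (rule that[of a t "\<lambda>n. I (b n) - I a + t n"])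
    show "(\<lambda>n. I (b n) - I a + t n) \<longlonglongrightarrow> 0"
      using tendsto_add[OF tendsto_diff[OF Ilim tendsto_const[of "I a"]] t0] by simp
    fix n c assume c: "admissible c"
    have "- J (\<lambda>x. r x + t n * v x) c \<le> - J r (b n) + t n * I (b n) + (t n)\<^sup>2"
      using bmin[OF c, of n] pert[OF b, of n n] by simp
    also have "\<dots> \<le> - J r a + t n * I (b n) + (t n)\<^sup>2" using amin[OF b, of n] by simp
    also have "\<dots> = - J r a + t n * (I a + (I (b n) - I a + t n))"
      by (simp add: power2_eq_square algebra_simps)
    finally show "- J (\<lambda>x. r x + t n * v x) c \<le>
      - J r a + t n * ((\<integral>x. v x * profile a x \<partial>leb01) + (I (b n) - I a + t n))"
      unfolding I_def .
  qed (use a amin t t0 in auto)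
qed

text \<open>A minimizer cannot be improved by its logistic replacement, so the equality case of the
  linearization applies. No variations are taken, and slopes touching 0 or 1 need no separate
  treatment.\<close>

lemma minimizer_Euler_Lagrange:
  assumes a: "admissible a" and r: "r \<in> borel_measurable leb01" and R: "\<And>x. x \<in> {0..1} \<Longrightarrow> \<bar>r x\<bar> \<le> R"
    and min: "\<And>c. admissible c \<Longrightarrow> J r a \<le> J r c"
  obtains p where "\<bar>p - logit_mass\<bar> \<le> (1 + R) / \<epsilon>" "AE x in leb01. a x = logistic (field r a p x)"
proof -
  obtain p where p: "\<bar>p - logit_mass\<bar> \<le> (1 + R) / \<epsilon>" "admissible (\<lambda>x. logistic (field r a p x))"
    using exists_admissible_field[OF a r R] by blast
  note lin = J_linearization[OF a r R refl p(2)]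
  have "J r (\<lambda>x. logistic (field r a p x)) = J r a"
    using lin(1) min[OF p(2)] by (rule antisym)
  then show thesis using that[OF p(1) lin(2)] by blast
qed

end

section \<open>The shooting map\<close>

lemma logistic_of_real: "logistic (of_real x :: complex) = of_real (logistic x)"
  by (simp add: logistic_def exp_of_real[symmetric])

text \<open>Height 1 is below pi / 2, so the cosine of the imaginary part is nonnegative. This keeps
  the denominator of the logistic function away from 0.\<close>

lemma Re_exp_strip: "\<bar>Im z\<bar> \<le> 1 \<Longrightarrow> 0 \<le> Re (exp (- z))"
  using pi_gt3 by (auto simp: Re_exp intro!: mult_nonneg_nonneg cos_ge_zero)

lemma norm_logistic_denominator: "\<bar>Im z\<bar> \<le> 1 \<Longrightarrow> 1 \<le> norm (1 + exp (- z))"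
  using Re_exp_strip[of z] complex_Re_le_cmod[of "1 + exp (- z)"] by simp

lemma norm_logistic_strip:
  assumes "\<bar>Im z\<bar> \<le> 1"
  shows "norm (logistic z) \<le> 1"
  using norm_logistic_denominator[OF assms] by (auto simp: logistic_def norm_divide divide_le_eq)

text \<open>With constant 1 here, an Euler step of length \<open>h\<close> enlarges imaginary parts
  by a factor of at most \<open>1 + h\<close>.\<close>

lemma Im_logistic_strip:
  assumes "\<bar>Im z\<bar> \<le> 1"
  shows "\<bar>Im (logistic z)\<bar> \<le> \<bar>Im z\<bar>"
proof -
  define w where "w = exp (- z)"
  have re: "0 \<le> Re w" using Re_exp_strip[OF assms] by (simp add: w_def)
  have n: "1 \<le> norm (1 + w)" using norm_logistic_denominator[OF assms] by (simp add: w_def)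
  have "\<bar>Im w\<bar> = norm w * \<bar>sin (Im z)\<bar>" by (simp add: w_def Im_exp abs_mult norm_exp_eq_Re)
  also have "\<dots> \<le> norm w * \<bar>Im z\<bar>" by (intro mult_left_mono abs_sin_x_le_abs_x) simp
  finally have im: "\<bar>Im w\<bar> \<le> norm w * \<bar>Im z\<bar>" .
  \<comment> \<open>Since the real part of \<open>w\<close> is nonnegative, the right side is at
    least \<open>1 + (norm w)\<^sup>2\<close>, which exceeds \<open>norm w\<close>.\<close>
  have "norm w \<le> (norm (1 + w))\<^sup>2"
  proof -
    have "(norm (1 + w))\<^sup>2 = 1 + 2 * Re w + (norm w)\<^sup>2"
      unfolding cmod_power2 by (simp add: power2_eq_square algebra_simps)
    moreover have "0 \<le> (norm w - 1)\<^sup>2 + norm w" by simp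
    ultimately show ?thesis using re by (simp add: power2_eq_square algebra_simps)
  qed
  then have "norm w * \<bar>Im z\<bar> \<le> (norm (1 + w))\<^sup>2 * \<bar>Im z\<bar>" by (intro mult_right_mono) auto
  with im have "\<bar>Im w\<bar> \<le> \<bar>Im z\<bar> * (norm (1 + w))\<^sup>2" by (simp add: mult.commute)
  moreover have "Im (logistic z) = - Im w / (norm (1 + w))\<^sup>2"
    unfolding logistic_def w_def[symmetric] by (simp add: Im_divide cmod_power2)
  moreover have "(norm (1 + w))\<^sup>2 > 0" using n by (intro zero_less_power) linarith
  ultimately show ?thesis by (simp add: abs_divide divide_le_eq)
qed

lemma holomorphic_on_logistic:
  assumes "f holomorphic_on S" "\<And>z. z \<in> S \<Longrightarrow> \<bar>Im (f z)\<bar> \<le> 1"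
  shows "(\<lambda>z. logistic (f z)) holomorphic_on S"
proof -
  have "1 + exp (- f z) \<noteq> 0" if "z \<in> S" for z
    using norm_logistic_denominator[OF assms(2)[OF that]] by auto
  then show ?thesis unfolding logistic_def by (intro holomorphic_intros assms) auto
qed

text \<open>Euler's method for \<open>u' = logistic (w + c)\<close>, \<open>w' = - logistic u\<close>. The merely measurable
  coefficient of the equation enters only through its primitive \<open>c\<close>.\<close>

fun euler :: "real \<Rightarrow> real \<Rightarrow> (nat \<Rightarrow> real) \<Rightarrow> 'a::{real_normed_field,banach} \<Rightarrow> nat \<Rightarrow> 'a \<times> 'a" where
  "euler h y c p 0 = (of_real y, p)"
| "euler h y c p (Suc k) =
    (fst (euler h y c p k) + of_real h * logistic (snd (euler h y c p k) + of_real (c k)),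
     snd (euler h y c p k) - of_real h * logistic (fst (euler h y c p k)))"

text \<open>Links the analytic family to the real scheme, whose limit is known when a solution
  exists.\<close>

lemma euler_of_real:
  "euler h y c (of_real p :: complex) k =
    (of_real (fst (euler h y c p k)), of_real (snd (euler h y c p k)))"
proof (induction k)
  case (Suc k)
  have "logistic (of_real x + of_real y) = (of_real (logistic (x + y)) :: complex)" for x y
    using logistic_of_real[of "x + y"] by simp
  then show ?case by (simp add: Suc logistic_of_real)
qed simp

text \<open>The coefficients \<open>c k\<close> are real and leave imaginary parts alone. The
  condition on \<open>N\<close> keeps all iterates in the strip where
  \<open>Im_logistic_strip\<close> applies.\<close>

lemma euler_Im_le:
  assumes h: "0 \<le> h" and N: "\<bar>Im p\<bar> * (1 + h) ^ N \<le> 1" and "k \<le> N"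
  shows "\<bar>Im (fst (euler h y c p k))\<bar> \<le> \<bar>Im p\<bar> * (1 + h) ^ k \<and>
    \<bar>Im (snd (euler h y c p k))\<bar> \<le> \<bar>Im p\<bar> * (1 + h) ^ k"
  using \<open>k \<le> N\<close>
proof (induction k)
  case (Suc k)
  let ?u = "fst (euler h y c p k)" and ?w = "snd (euler h y c p k)" and ?D = "\<bar>Im p\<bar> * (1 + h) ^ k"
  have IH: "\<bar>Im ?u\<bar> \<le> ?D" "\<bar>Im ?w\<bar> \<le> ?D" using Suc by auto
  have "?D \<le> \<bar>Im p\<bar> * (1 + h) ^ N" using h Suc.prems by (intro mult_left_mono power_increasing) auto
  then have D1: "?D \<le> 1" using N by linarith
  have "\<bar>Im (logistic (?w + of_real (c k)))\<bar> \<le> ?D" "\<bar>Im (logistic ?u)\<bar> \<le> ?D"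
    using Im_logistic_strip[of "?w + of_real (c k)"] Im_logistic_strip[of ?u] IH D1 by auto
  then have "\<bar>h * Im (logistic (?w + of_real (c k)))\<bar> \<le> h * ?D" "\<bar>h * Im (logistic ?u)\<bar> \<le> h * ?D"
    using h by (auto simp: abs_mult intro: mult_left_mono)
  then have "\<bar>Im ?u + h * Im (logistic (?w + of_real (c k)))\<bar> \<le> ?D + h * ?D"
    "\<bar>Im ?w - h * Im (logistic ?u)\<bar> \<le> ?D + h * ?D"
    using IH by linarith+
  moreover have "?D + h * ?D = \<bar>Im p\<bar> * (1 + h) ^ Suc k" by (simp add: algebra_simps)
  ultimately show ?case by simp
qed simp

lemma euler_holomorphic:
  assumes h: "0 \<le> h" and N: "\<And>z. z \<in> S \<Longrightarrow> \<bar>Im z\<bar> * (1 + h) ^ N \<le> 1" and "k \<le> N"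
  shows "(\<lambda>z. fst (euler h y c z k)) holomorphic_on S \<and> (\<lambda>z. snd (euler h y c z k)) holomorphic_on S"
  using \<open>k \<le> N\<close>
proof (induction k)
  case (Suc k)
  have *: "\<bar>Im (fst (euler h y c z k))\<bar> \<le> 1" "\<bar>Im (snd (euler h y c z k) + of_real (c k))\<bar> \<le> 1" if "z \<in> S" for z
  proof -
    have "\<bar>Im z\<bar> * (1 + h) ^ k \<le> \<bar>Im z\<bar> * (1 + h) ^ N"
      using h Suc.prems by (intro mult_left_mono power_increasing) auto
    then show "\<bar>Im (fst (euler h y c z k))\<bar> \<le> 1" "\<bar>Im (snd (euler h y c z k) + of_real (c k))\<bar> \<le> 1"
      using euler_Im_le[OF h N[OF that], of k y c] N[OF that] Suc.prems by auto
  qed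
  show ?case using Suc * by (auto intro!: holomorphic_intros holomorphic_on_logistic)
qed (auto intro!: holomorphic_intros)

text \<open>The logistic function has norm at most 1 in the strip. With total step length fixed,
  this is the uniform bound required by Montel's theorem.\<close>

lemma euler_norm_le:
  assumes h: "0 \<le> h" and N: "\<bar>Im p\<bar> * (1 + h) ^ N \<le> 1" and "k \<le> N"
  shows "norm (fst (euler h y c p k)) \<le> \<bar>y\<bar> + real k * h"
  using \<open>k \<le> N\<close>
proof (induction k)
  case (Suc k)
  have "\<bar>Im p\<bar> * (1 + h) ^ k \<le> \<bar>Im p\<bar> * (1 + h) ^ N"
    using h Suc.prems by (intro mult_left_mono power_increasing) auto
  then have "\<bar>Im (snd (euler h y c p k) + of_real (c k))\<bar> \<le> 1"
    using euler_Im_le[OF h N, of k y c] N Suc.prems by auto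
  then have "norm (of_real h * logistic (snd (euler h y c p k) + of_real (c k))) \<le> h * 1"
    unfolding norm_mult using h by (intro mult_mono norm_logistic_strip) auto
  then have "norm (fst (euler h y c p (Suc k))) \<le> norm (fst (euler h y c p k)) + h"
    using norm_triangle_ineq[of "fst (euler h y c p k)"] by (simp del: norm_mult) (meson add_left_mono order_trans)
  then show ?case using Suc by (simp add: algebra_simps)
qed simp

text \<open>The potential loses at most \<open>h\<close> per step, so a large start keeps it large
  and keeps the slope near 1; this is what excludes a constant end point map.\<close>

lemma euler_lower:
  fixes p :: real
  assumes h: "0 \<le> h" and B: "\<And>j. - B \<le> c j" and "k \<le> N"
  shows "p - real k * h \<le> snd (euler h y c p k) \<and>
    y + real k * h * logistic (p - real N * h - B) \<le> fst (euler h y c p k)"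
  using \<open>k \<le> N\<close>
proof (induction k)
  case (Suc k)
  let ?u = "fst (euler h y c p k)" and ?w = "snd (euler h y c p k)"
  have "h * logistic ?u \<le> h" using h logistic_less_1[of ?u] by (intro mult_left_le) auto
  moreover have "h * logistic (p - real N * h - B) \<le> h * logistic (?w + c k)"
  proof (intro mult_left_mono logistic_mono h)
    have "real k * h \<le> real N * h" using Suc.prems h by (intro mult_right_mono) auto
    then show "p - real N * h - B \<le> ?w + c k" using Suc B[of k] by auto
  qed
  ultimately show ?case using Suc by (auto simp: algebra_simps)
qed simp

lemma discrete_Gronwall:
  fixes E :: "nat \<Rightarrow> real"
  assumes "E 0 \<le> 0" and step: "\<And>k. k < N \<Longrightarrow> E (Suc k) \<le> (1 + h) * E k + c" and h: "0 \<le> h" and c: "0 \<le> c"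
    and "k \<le> N"
  shows "E k \<le> real k * c * (1 + h) ^ k"
  using \<open>k \<le> N\<close>
proof (induction k)
  case (Suc k)
  have "E (Suc k) \<le> (1 + h) * (real k * c * (1 + h) ^ k) + c"
    using step[of k] Suc h by (intro order_trans[OF step] add_right_mono mult_left_mono) auto
  also have "\<dots> \<le> (1 + h) * (real k * c * (1 + h) ^ k) + c * (1 + h) ^ Suc k"
    using mult_left_mono[OF one_le_power[of "1 + h" "Suc k"] c] h by simp
  also have "\<dots> = real (Suc k) * c * (1 + h) ^ Suc k" by (simp add: algebra_simps)
  finally show ?case .
qed (use assms(1) in simp)

lemma primitive_cong_AE:
  assumes "AE x in leb01. f x = g x" and [measurable]: "f \<in> borel_measurable leb01" "g \<in> borel_measurable leb01"
  shows "primitive f x = primitive g x"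
  unfolding primitive_def
proof (rule integral_cong_AE)
  show "AE y in leb01. indicator {..x} y * f y = indicator {..x} y * g y"
    using assms(1) by eventually_elim simp
qed measurable

section \<open>Convergence of Euler's method for the Euler-Lagrange system\<close>

context profile_problem
begin

text \<open>The part of the potential that is driven by \<rho> and does not depend on the unknown
  profile.\<close>

definition drift :: "(real \<Rightarrow> real) \<Rightarrow> real \<Rightarrow> real" where
  "drift r x = primitive (\<lambda>x. 1 - r x) x / \<epsilon>"

text \<open>The grid has mesh \<open>1 / N\<close>; the factor \<open>1 / \<epsilon>\<close> of both
  equations is absorbed in the step length. The second component approximates the potential without
  its drift.\<close>

definition euler_profile :: "(real \<Rightarrow> real) \<Rightarrow> nat \<Rightarrow> 'a::{real_normed_field,banach} \<Rightarrow> nat \<Rightarrow> 'a \<times> 'a" where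
  "euler_profile r N = euler (1 / (real N * \<epsilon>)) \<phi>0 (\<lambda>k. drift r (real k / real N))"

text \<open>This bound, uniform in \<open>N\<close>, is both the Gronwall factor of the error
  estimate and the reciprocal of the half-width of the complex strip.\<close>

lemma one_plus_step_power_le:
  assumes "k \<le> N"
  shows "(1 + 1 / (real N * \<epsilon>)) ^ k \<le> exp (1 / \<epsilon>)"
proof (cases "N = 0")
  case False
  have "(1 + 1 / (real N * \<epsilon>)) ^ k \<le> exp (1 / (real N * \<epsilon>)) ^ k"
    using \<epsilon>_pos by (intro power_mono exp_ge_add_one_self) auto
  also have "\<dots> = exp (real k * (1 / (real N * \<epsilon>)))" by (rule exp_of_nat_mult[symmetric])
  also have "\<dots> \<le> exp (real N * (1 / (real N * \<epsilon>)))"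
    using assms \<epsilon>_pos by (intro exp_le_cancel_iff[THEN iffD2] mult_right_mono) auto
  also have "\<dots> = exp (1 / \<epsilon>)" using False by simp
  finally show ?thesis .
qed (use assms \<epsilon>_pos in auto)

lemma profile_0: "admissible a \<Longrightarrow> profile a 0 = \<phi>0"
  using primitive_0[of a] by (simp add: profile_def admissible_def)

context
  fixes r a :: "real \<Rightarrow> real" and R p :: real
  assumes a: "admissible a" and r: "r \<in> borel_measurable leb01" and R: "\<And>x. x \<in> {0..1} \<Longrightarrow> \<bar>r x\<bar> \<le> R"
    and EL: "AE x in leb01. a x = logistic (field r a p x)"
begin

lemma R_nonneg: "0 \<le> R"
  using R[of 0] by simp

text \<open>Integration turns the almost everywhere equation for \<open>a\<close> into one that
  holds at every point, as comparison at grid points requires.\<close>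

lemma profile_eq_field: "profile a x = \<phi>0 + primitive (\<lambda>x. logistic (field r a p x)) x / \<epsilon>"
proof -
  note [measurable] = field_measurable[OF a r]
  have "primitive a x = primitive (\<lambda>x. logistic (field r a p x)) x"
    using EL admissible_measurable[OF a] by (intro primitive_cong_AE) auto
  then show ?thesis by (simp add: profile_def)
qed

text \<open>Isolates the rough coefficient in the known function \<open>drift\<close>; the remaining
  integrand is Lipschitz.\<close>

lemma field_eq_drift: "field r a p x = p + drift r x - primitive (\<lambda>x. logistic (profile a x)) x / \<epsilon>"
proof -
  note [measurable] = r profile_measurable[OF a]
  have "primitive (slope r a) x = primitive (\<lambda>x. (1 - r x) - logistic (profile a x)) x"
    unfolding slope_def[abs_def] by (simp add: algebra_simps)
  also have "\<dots> = primitive (\<lambda>x. 1 - r x) x - primitive (\<lambda>x. logistic (profile a x)) x"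
  proof (rule primitive_diff)
    show "\<bar>1 - r x\<bar> \<le> 1 + R" if "x \<in> {0..1}" for x using R[OF that] by linarith
    show "\<bar>logistic (profile a x)\<bar> \<le> 1" for x
      using logistic_pos[of "profile a x"] logistic_less_1[of "profile a x"] by linarith
  qed measurable
  finally show ?thesis by (simp add: field_def drift_def diff_divide_distrib)
qed

lemma field_Lipschitz: "x \<in> {0..1} \<Longrightarrow> y \<in> {0..1} \<Longrightarrow> \<bar>field r a p y - field r a p x\<bar> \<le> (1 + R) / \<epsilon> * \<bar>y - x\<bar>"
proof -
  assume "x \<in> {0..1}" "y \<in> {0..1}"
  then have "\<bar>primitive (slope r a) y - primitive (slope r a) x\<bar> \<le> (1 + R) * \<bar>y - x\<bar>"
    by (intro primitive_Lipschitz slope_measurable slope_abs_le a r R)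
  then have "\<bar>primitive (slope r a) y - primitive (slope r a) x\<bar> / \<epsilon> \<le> (1 + R) * \<bar>y - x\<bar> / \<epsilon>"
    using \<epsilon>_pos by (intro divide_right_mono) auto
  then show ?thesis using \<epsilon>_pos by (simp add: field_def diff_divide_distrib[symmetric])
qed

lemma profile_Lipschitz: "x \<in> {0..1} \<Longrightarrow> y \<in> {0..1} \<Longrightarrow> \<bar>profile a y - profile a x\<bar> \<le> 1 / \<epsilon> * \<bar>y - x\<bar>"
proof -
  assume "x \<in> {0..1}" "y \<in> {0..1}"
  then have "\<bar>primitive a y - primitive a x\<bar> \<le> 1 * \<bar>y - x\<bar>"
    by (intro primitive_Lipschitz admissible_measurable admissible_abs a)
  then have "\<bar>primitive a y - primitive a x\<bar> / \<epsilon> \<le> 1 * \<bar>y - x\<bar> / \<epsilon>"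
    using \<epsilon>_pos by (intro divide_right_mono) auto
  then show ?thesis using \<epsilon>_pos by (simp add: profile_def diff_divide_distrib[symmetric])
qed

text \<open>Local truncation error of one Euler step: freezing a Lipschitz integrand at the left end
  costs the square of the mesh.\<close>

lemma logistic_primitive_step:
  assumes g: "g \<in> borel_measurable leb01"
    and Lip: "\<And>x y. x \<in> {0..1} \<Longrightarrow> y \<in> {0..1} \<Longrightarrow> \<bar>g y - g x\<bar> \<le> L * \<bar>y - x\<bar>" and L: "0 \<le> L"
    and xy: "0 \<le> x" "x \<le> y" "y \<le> 1"
  shows "\<bar>primitive (\<lambda>x. logistic (g x)) y / \<epsilon> - primitive (\<lambda>x. logistic (g x)) x / \<epsilon>
    - (y - x) / \<epsilon> * logistic (g x)\<bar> \<le> L / \<epsilon> * (y - x)\<^sup>2"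
proof -
  note [measurable] = g
  have "\<bar>primitive (\<lambda>x. logistic (g x)) y - primitive (\<lambda>x. logistic (g x)) x - logistic (g x) * (y - x)\<bar>
    \<le> (L * (y - x)) * (y - x)"
  proof (rule primitive_increment[where C = 1])
    show "\<bar>logistic (g t)\<bar> \<le> 1" for t
      using logistic_pos[of "g t"] logistic_less_1[of "g t"] by linarith
    show "\<bar>logistic (g t) - logistic (g x)\<bar> \<le> L * (y - x)" if t: "t \<in> {x..y}" for t
    proof -
      have "\<bar>logistic (g t) - logistic (g x)\<bar> \<le> L * \<bar>t - x\<bar>"
        using logistic_Lipschitz[of "g t" "g x"] Lip[of x t] t xy by auto
      also have "\<dots> \<le> L * (y - x)" using t L by (intro mult_left_mono) auto
      finally show ?thesis .
    qed
  qed (use xy in measurable)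
  then have "\<bar>primitive (\<lambda>x. logistic (g x)) y - primitive (\<lambda>x. logistic (g x)) x - logistic (g x) * (y - x)\<bar> / \<epsilon>
    \<le> L * (y - x)\<^sup>2 / \<epsilon>"
    using \<epsilon>_pos by (intro divide_right_mono) (auto simp: power2_eq_square mult.assoc)
  moreover have "(X - Y - c * (y - x)) / \<epsilon> = X / \<epsilon> - Y / \<epsilon> - (y - x) / \<epsilon> * c" for X Y c
    using \<epsilon>_pos by (simp add: field_simps)
  moreover have "\<bar>X\<bar> / \<epsilon> = \<bar>X / \<epsilon>\<bar>" for X using \<epsilon>_pos by simp
  ultimately show ?thesis by simp
qed

text \<open>The drift enters the scheme with its exact values at the grid points, so no regularity
  of \<open>r\<close> is used. The terms \<open>1 + R\<close> and \<open>1\<close> of the constant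
  are the local errors of profile and potential.\<close>

lemma euler_profile_error:
  assumes N: "0 < N" and k: "k \<le> N"
  shows "\<bar>profile a (real k / real N) - fst (euler_profile r N p k)\<bar>
    \<le> (1 + R + 1) / \<epsilon>\<^sup>2 * exp (1 / \<epsilon>) / real N"
proof -
  define x where "x = (\<lambda>k. real k / real N)"
  define h where "h = 1 / (real N * \<epsilon>)"
  define w where "w = field r a p"
  define U where "U = (\<lambda>k. profile a (x k))"
  define W where "W = (\<lambda>k. w (x k) - drift r (x k))"
  define u where "u = (\<lambda>k. fst (euler_profile r N p k))"
  define v where "v = (\<lambda>k. snd (euler_profile r N p k))"
  have h: "0 < h" using N \<epsilon>_pos by (simp add: h_def)
  have x: "0 \<le> x k" "x k \<le> x (Suc k)" for k by (auto simp: x_def divide_right_mono)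
  have xS: "x (Suc k) - x k = 1 / real N" for k by (simp add: x_def diff_divide_distrib[symmetric])
  have x1: "x (Suc k) \<le> 1" if "k < N" for k using that by (simp add: x_def)
  have hN: "1 / real N / \<epsilon> = h" by (simp add: h_def)
  have stepU: "\<bar>U (Suc k) - U k - h * logistic (w (x k))\<bar> \<le> (1 + R) / \<epsilon> / \<epsilon> * (1 / real N)\<^sup>2" if "k < N" for k
    using logistic_primitive_step[OF field_measurable[OF a r] field_Lipschitz, of "x k" "x (Suc k)"]
      R_nonneg \<epsilon>_pos x[of k] x1[OF that]
    unfolding U_def profile_eq_field w_def xS hN by simp
  have stepW: "\<bar>W (Suc k) - W k + h * logistic (U k)\<bar> \<le> 1 / \<epsilon> / \<epsilon> * (1 / real N)\<^sup>2" if "k < N" for k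
    using logistic_primitive_step[OF profile_measurable[OF a] profile_Lipschitz, of "x k" "x (Suc k)"]
      \<epsilon>_pos x[of k] x1[OF that]
    unfolding U_def W_def w_def field_eq_drift xS hN by (simp add: abs_le_iff algebra_simps)
  have us: "u (Suc k) = u k + h * logistic (v k + drift r (x k))"
    and vs: "v (Suc k) = v k - h * logistic (u k)" for k
    by (simp_all add: u_def v_def euler_profile_def h_def x_def)
  define E where "E = (\<lambda>k. \<bar>U k - u k\<bar> + \<bar>W k - v k\<bar>)"
  define c where "c = (1 + R + 1) / \<epsilon>\<^sup>2 * (1 / real N)\<^sup>2"
  have ceq: "(1 + R) / \<epsilon> / \<epsilon> * (1 / real N)\<^sup>2 + 1 / \<epsilon> / \<epsilon> * (1 / real N)\<^sup>2 = c"
    by (simp add: c_def power2_eq_square add_divide_distrib distrib_right)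
  have c: "0 \<le> c" using R_nonneg by (simp add: c_def)
  have "E k \<le> real k * c * (1 + h) ^ k"
  proof (rule discrete_Gronwall[OF _ _ _ c k])
    show "E 0 \<le> 0"
      using primitive_0[OF slope_measurable[OF a r]] primitive_0[of "\<lambda>x. 1 - r x"] r
      by (simp add: E_def U_def u_def W_def v_def w_def x_def euler_profile_def field_def drift_def profile_0[OF a])
    fix k assume kN: "k < N"
    have l1: "\<bar>h * logistic (w (x k)) - h * logistic (v k + drift r (x k))\<bar> \<le> h * \<bar>W k - v k\<bar>"
    proof -
      have "\<bar>logistic (w (x k)) - logistic (v k + drift r (x k))\<bar> \<le> \<bar>W k - v k\<bar>"
        using logistic_Lipschitz[of "w (x k)" "v k + drift r (x k)"] by (simp add: W_def algebra_simps)
      then show ?thesis using h by (simp add: abs_mult flip: right_diff_distrib)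
    qed
    have l2: "\<bar>h * logistic (U k) - h * logistic (u k)\<bar> \<le> h * \<bar>U k - u k\<bar>"
      using h logistic_Lipschitz[of "U k" "u k"] by (simp add: abs_mult flip: right_diff_distrib)
    have "\<bar>U (Suc k) - u (Suc k)\<bar> \<le> \<bar>U k - u k\<bar> + (1 + R) / \<epsilon> / \<epsilon> * (1 / real N)\<^sup>2 + h * \<bar>W k - v k\<bar>"
      using stepU[OF kN] l1 unfolding us by linarith
    moreover have "\<bar>W (Suc k) - v (Suc k)\<bar> \<le> \<bar>W k - v k\<bar> + 1 / \<epsilon> / \<epsilon> * (1 / real N)\<^sup>2 + h * \<bar>U k - u k\<bar>"
      using stepW[OF kN] l2 unfolding vs by linarith
    ultimately show "E (Suc k) \<le> (1 + h) * E k + c"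
      unfolding E_def using ceq by (simp add: distrib_right distrib_left)
  qed (use h in auto)
  then have "\<bar>U k - u k\<bar> \<le> real k * c * (1 + h) ^ k" by (simp add: E_def)
  \<comment> \<open>At most \<open>N\<close> local errors of size \<open>1 / N\<^sup>2\<close> add
    up to order \<open>1 / N\<close>.\<close>
  also have "\<dots> \<le> real N * c * exp (1 / \<epsilon>)"
    using k c h one_plus_step_power_le[OF k] unfolding h_def[symmetric]
    by (intro mult_mono mult_right_mono) auto
  also have "\<dots> = (1 + R + 1) / \<epsilon>\<^sup>2 * exp (1 / \<epsilon>) / real N"
    using N by (simp add: c_def power2_eq_square)
  finally show ?thesis by (simp add: U_def u_def x_def)
qed

lemma euler_profile_tendsto:
  assumes x: "x \<in> {0..1}"
  shows "(\<lambda>n. fst (euler_profile r (Suc n) p (nat \<lfloor>x * real (Suc n)\<rfloor>))) \<longlonglongrightarrow> profile a x"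
proof -
  define C where "C = (1 + R + 1) / \<epsilon>\<^sup>2 * exp (1 / \<epsilon>) + 1 / \<epsilon>"
  have "(\<lambda>n. fst (euler_profile r (Suc n) p (nat \<lfloor>x * real (Suc n)\<rfloor>)) - profile a x) \<longlonglongrightarrow> 0"
  proof (rule Lim_null_comparison)
    show "(\<lambda>n. C * (1 / real (Suc n))) \<longlonglongrightarrow> 0"
      using tendsto_mult[OF tendsto_const LIMSEQ_Suc[OF lim_1_over_n]] by auto
    show "eventually (\<lambda>n. norm (fst (euler_profile r (Suc n) p (nat \<lfloor>x * real (Suc n)\<rfloor>)) - profile a x)
      \<le> C * (1 / real (Suc n))) sequentially"
    proof (intro always_eventually allI)
      fix n
      define N where "N = Suc n"
      define k where "k = nat \<lfloor>x * real N\<rfloor>"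
      have kx: "real k \<le> x * real N" "x * real N < real k + 1"
        using x by (auto simp: k_def N_def)
      have "x * real N \<le> 1 * real N" using x by (intro mult_right_mono) auto
      then have kN: "k \<le> N" using kx by simp
      have N: "0 < N" by (simp add: N_def)
      have d: "\<bar>real k / real N - x\<bar> \<le> 1 / real N"
      proof -
        have "real k / real N \<le> x" "x \<le> real k / real N + 1 / real N"
          using kx N by (simp_all add: divide_le_eq le_divide_eq flip: add_divide_distrib)
        then show ?thesis by simp
      qed
      have "\<bar>profile a (real k / real N) - profile a x\<bar> \<le> 1 / \<epsilon> * \<bar>real k / real N - x\<bar>"
        using x kN N by (intro profile_Lipschitz) auto
      also have "\<dots> \<le> 1 / \<epsilon> * (1 / real N)" using d \<epsilon>_pos by (intro mult_left_mono) auto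
      finally have "\<bar>fst (euler_profile r N p k) - profile a x\<bar> \<le> C * (1 / real N)"
        using euler_profile_error[OF N kN] unfolding C_def distrib_right by (simp add: abs_le_iff)
      then show "norm (fst (euler_profile r (Suc n) p (nat \<lfloor>x * real (Suc n)\<rfloor>)) - profile a x)
        \<le> C * (1 / real (Suc n))" by (simp add: N_def k_def)
    qed
  qed
  then show ?thesis by (simp add: LIM_zero_iff)
qed

end

text \<open>The Euler scheme depends only on \<open>r\<close> and \<open>p\<close>, and both
  profiles are its limit.\<close>

lemma profile_unique:
  assumes "r \<in> borel_measurable leb01" "\<And>x. x \<in> {0..1} \<Longrightarrow> \<bar>r x\<bar> \<le> R"
    and "admissible a" "AE x in leb01. a x = logistic (field r a p x)"
    and "admissible b" "AE x in leb01. b x = logistic (field r b p x)" and "x \<in> {0..1}"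
  shows "profile a x = profile b x"
  using euler_profile_tendsto[OF assms(3,1,2,4,7)] euler_profile_tendsto[OF assms(5,1,2,6,7)]
  by (rule LIMSEQ_unique)

section \<open>Analytic dependence of the end point on the shooting parameter\<close>

lemma profile_1: "admissible a \<Longrightarrow> profile a 1 = \<phi>1"
  using \<epsilon>_pos by (simp add: profile_def primitive_1 admissible_def mass_def)

text \<open>Infinitely many parameters in a compact interval would accumulate, so an analytic limit
  of the end point maps, equal to \<open>\<phi>1\<close> at each of them, would be constant. A large
  starting potential contradicts this.\<close>

lemma finite_shooting_parameters:
  assumes r: "r \<in> borel_measurable leb01" and R: "\<And>x. x \<in> {0..1} \<Longrightarrow> \<bar>r x\<bar> \<le> R"
  shows "finite {p. \<bar>p - logit_mass\<bar> \<le> (1 + R) / \<epsilon> \<and>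
    (\<exists>a. admissible a \<and> (AE x in leb01. a x = logistic (field r a p x)))}" (is "finite ?P")
proof (rule ccontr)
  assume inf: "infinite ?P"
  \<comment> \<open>The half-width compensates the growth factor \<open>exp (1 / \<epsilon>)\<close>
    of imaginary parts over a full run of the scheme.\<close>
  define S where "S = {z :: complex. \<bar>Im z\<bar> < exp (- 1 / \<epsilon>)}"
  define F where "F = (\<lambda>n z :: complex. fst (euler_profile r (Suc n) z (Suc n)))"
  have S_eq: "S = {z. Im z < exp (- 1 / \<epsilon>)} \<inter> {z. Im z > - exp (- 1 / \<epsilon>)}" by (auto simp: S_def)
  have S: "open S" "connected S"
    unfolding S_eq by (auto intro!: open_Int open_halfspace_Im_lt open_halfspace_Im_gt convex_connected convex_Int
        convex_halfspace_Im_lt convex_halfspace_Im_gt)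
  have realS: "of_real t \<in> S" for t by (simp add: S_def)
  have strip: "\<bar>Im z\<bar> * (1 + 1 / (real (Suc n) * \<epsilon>)) ^ Suc n \<le> 1" if "z \<in> S" for z n
  proof -
    have "\<bar>Im z\<bar> * (1 + 1 / (real (Suc n) * \<epsilon>)) ^ Suc n \<le> exp (- 1 / \<epsilon>) * exp (1 / \<epsilon>)"
      using that one_plus_step_power_le[of "Suc n" "Suc n"] \<epsilon>_pos
      by (intro mult_mono) (auto simp: S_def less_imp_le simp del: power_Suc of_nat_Suc)
    then show ?thesis by (simp add: exp_add[symmetric])
  qed
  have h: "0 \<le> 1 / (real (Suc n) * \<epsilon>)" for n using \<epsilon>_pos by simp
  have hol: "F n holomorphic_on S" for n
    unfolding F_def euler_profile_def using euler_holomorphic[OF h strip order_refl] by blast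
  have bnd: "norm (F n z) \<le> \<bar>\<phi>0\<bar> + 1 / \<epsilon>" if "z \<in> S" for n z
    using euler_norm_le[OF h strip[OF that] order_refl, of n \<phi>0 "\<lambda>k. drift r (real k / real (Suc n))"]
    unfolding F_def euler_profile_def by simp
  \<comment> \<open>The limit is taken along a subsequence. At the parameters in question the full
    real sequence converges to \<open>\<phi>1\<close>, so \<open>G\<close> has this value whichever
    subsequence was selected.\<close>
  obtain G s where G: "G holomorphic_on S" "strict_mono (s :: nat \<Rightarrow> nat)"
    "\<And>z. z \<in> S \<Longrightarrow> (\<lambda>n. F (s n) z) \<longlonglongrightarrow> G z"
  proof (rule Montel[OF S(1), of "range F" F])
    fix K assume "compact K" "K \<subseteq> S"
    then show "\<exists>B. \<forall>h\<in>range F. \<forall>z\<in>K. norm (h z) \<le> B"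
      using bnd by (intro exI[of _ "\<bar>\<phi>0\<bar> + 1 / \<epsilon>"]) auto
  qed (use hol in auto)
  have real: "F n (of_real t) = of_real (fst (euler_profile r (Suc n) t (Suc n)))" for n t
    by (simp add: F_def euler_profile_def euler_of_real del: euler.simps)
  have GP: "G (of_real p) = of_real \<phi>1" if p: "p \<in> ?P" for p
  proof -
    from p obtain a where a: "admissible a" "AE x in leb01. a x = logistic (field r a p x)" by auto
    have "(\<lambda>n. fst (euler_profile r (Suc n) p (Suc n))) \<longlonglongrightarrow> \<phi>1"
      using euler_profile_tendsto[OF a(1) r R a(2), of 1] profile_1[OF a(1)] by (simp del: of_nat_Suc)
    then have "(\<lambda>n. F n (of_real p)) \<longlonglongrightarrow> of_real \<phi>1" unfolding real by (rule tendsto_of_real)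
    then have "(\<lambda>n. F (s n) (of_real p)) \<longlonglongrightarrow> of_real \<phi>1"
      using LIMSEQ_subseq_LIMSEQ[OF _ G(2)] by (force simp: o_def)
    then show ?thesis using G(3)[OF realS] LIMSEQ_unique by blast
  qed
  let ?PC = "of_real ` ?P :: complex set"
  let ?K = "of_real ` {logit_mass - (1 + R) / \<epsilon> .. logit_mass + (1 + R) / \<epsilon>} :: complex set"
  have K: "compact ?K" by (intro compact_continuous_image continuous_intros) auto
  have PC: "infinite ?PC" "?PC \<subseteq> ?K"
    using inf by (auto simp: finite_image_iff inj_on_def abs_le_iff)
  have "\<exists>\<xi>\<in>?K. \<xi> islimpt ?PC"
    by (rule compact_eq_Bolzano_Weierstrass[THEN iffD1, OF K, rule_format]) (rule conjI[OF PC])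
  then obtain \<xi> where \<xi>: "\<xi> \<in> ?K" "\<xi> islimpt ?PC" by blast
  have const: "G z = of_real \<phi>1" if "z \<in> S" for z
  proof -
    have "G z - of_real \<phi>1 = 0"
    proof (rule analytic_continuation[of "\<lambda>z. G z - of_real \<phi>1" S ?PC \<xi>])
      show "(\<lambda>z. G z - of_real \<phi>1) holomorphic_on S" by (intro holomorphic_intros G)
    qed (use S realS \<xi> GP that in auto)
    then show ?thesis by simp
  qed
  define B where "B = (1 + R) / \<epsilon>"
  have drift: "- B \<le> drift r x" for x
  proof -
    have "\<bar>primitive (\<lambda>x. 1 - r x) x\<bar> \<le> 1 + R"
    proof (rule primitive_abs_le)
      show "\<bar>1 - r x\<bar> \<le> 1 + R" if "x \<in> {0..1}" for x using R[OF that] by linarith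
    qed (use r in measurable)
    then have "\<bar>primitive (\<lambda>x. 1 - r x) x\<bar> / \<epsilon> \<le> (1 + R) / \<epsilon>" using \<epsilon>_pos by (intro divide_right_mono) auto
    then have "\<bar>primitive (\<lambda>x. 1 - r x) x / \<epsilon>\<bar> \<le> (1 + R) / \<epsilon>" using \<epsilon>_pos by simp
    then show ?thesis unfolding drift_def B_def by linarith
  qed
  \<comment> \<open>Any slope strictly between \<open>mass\<close> and 1 would do; the midpoint is
    taken.\<close>
  define t where "t = (1 + mass) / 2"
  have t: "mass < t" "0 < t" "t < 1" using mass_pos mass_less_1 by (auto simp: t_def)
  \<comment> \<open>Over the whole interval the potential loses at most
    \<open>1 / \<epsilon>\<close> to the scheme and \<open>B\<close> to the drift; what remains
    still has logistic value \<open>t\<close>.\<close>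
  define p where "p = ln (t / (1 - t)) + 1 / \<epsilon> + B"
  have lt: "logistic (p - 1 / \<epsilon> - B) = t" using t by (simp add: p_def logistic_def exp_minus field_simps)
  have low: "\<phi>0 + t / \<epsilon> \<le> Re (F n (of_real p))" for n
    using euler_lower[where B = B and c = "\<lambda>k. drift r (real k / real (Suc n))" and k = "Suc n"
        and p = p and y = \<phi>0, OF h[of n] _ order_refl] drift
    unfolding real euler_profile_def by (simp add: lt del: euler.simps of_nat_Suc)
  have "\<phi>0 + t / \<epsilon> \<le> Re (G (of_real p))"
  proof (rule LIMSEQ_le_const)
    show "(\<lambda>n. Re (F (s n) (of_real p))) \<longlonglongrightarrow> Re (G (of_real p))"
      by (intro tendsto_Re G(3) realS)
  qed (use low in auto)
  then have "\<phi>0 + t / \<epsilon> \<le> \<phi>1" using const[OF realS] by simp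
  then have "t \<le> mass" using \<epsilon>_pos by (simp add: mass_def field_simps)
  then show False using t by simp
qed

end

section \<open>Distribution functions on the unit interval\<close>

text \<open>Continuity from above. The approximating points are chosen inside the unit interval,
  where the sets are measurable for \<open>\<mu>\<close>.\<close>

lemma measure_Icc_right_limit:
  assumes \<mu>: "finite_measure \<mu>" and sets: "sets \<mu> = sets (restrict_space borel {0..1::real})" and x: "0 \<le> x" "x < 1"
  shows "(\<lambda>n. measure \<mu> {0..x + (1 - x) / real (Suc n)}) \<longlonglongrightarrow> measure \<mu> {0..x}"
proof -
  let ?z = "\<lambda>n. x + (1 - x) / real (Suc n)"
  have z: "?z n \<le> 1" for n
  proof -
    have "(1 - x) / real (Suc n) \<le> (1 - x) / 1" using x by (intro divide_left_mono) auto
    then show ?thesis by simp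
  qed
  have "(\<Inter>n. {0..?z n}) = {0..x}"
  proof (intro equalityI subsetI)
    fix y assume y: "y \<in> (\<Inter>n. {0..?z n})"
    have "?z \<longlonglongrightarrow> x + (1 - x) * 0"
      using tendsto_add[OF tendsto_const[of x] tendsto_mult[OF tendsto_const[of "1 - x"] LIMSEQ_Suc[OF lim_1_over_n]]]
      by simp
    then have "y \<le> x + (1 - x) * 0" by (rule LIMSEQ_le_const) (use y in auto)
    then show "y \<in> {0..x}" using y by auto
  qed (use x in \<open>auto intro: order_trans\<close>)
  moreover have "decseq (\<lambda>n. {0..?z n})"
  proof -
    have "(1 - x) / real (Suc n) \<le> (1 - x) / real (Suc m)" if "m \<le> n" for m n
      using x that by (intro divide_left_mono) auto
    then have "{0..?z n} \<subseteq> {0..?z m}" if "m \<le> n" for m n using that by (simp del: of_nat_Suc)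
    then show ?thesis unfolding decseq_def by blast
  qed
  moreover have "range (\<lambda>n. {0..?z n}) \<subseteq> sets \<mu>"
    unfolding sets using z by (auto simp: sets_restrict_space_iff)
  ultimately show ?thesis
    using finite_measure.finite_Lim_measure_decseq[OF \<mu>, of "\<lambda>n. {0..?z n}"] by simp
qed

lemma AE_leb01_exists_between:
  assumes P: "AE x in leb01. P x" and xy: "0 \<le> x" "x < y" "y \<le> 1"
  shows "\<exists>z. x < z \<and> z < y \<and> P z"
proof (rule ccontr)
  assume no: "\<not> ?thesis"
  have "AE z in lborel. 0 \<le> z \<and> z \<le> 1 \<longrightarrow> P z"
    using P by (subst (asm) AE_restrict_space_iff) auto
  then have "AE z in lborel. z \<notin> {x<..<y}"
    by eventually_elim (use no xy in auto)
  then have "emeasure lborel {x<..<y} = 0"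
    by (subst (asm) AE_iff_measurable[of "{x<..<y}"]) auto
  then show False using xy by simp
qed

lemma has_dmeasure_finite:
  assumes "has_dmeasure \<phi>0 \<phi>1 f \<mu>"
  shows "space \<mu> = {0..1}" "finite_measure \<mu>"
proof -
  have "sets \<mu> = sets (restrict_space borel {0..1})" using assms by (simp add: has_dmeasure_def)
  from sets_eq_imp_space_eq[OF this] show sp: "space \<mu> = {0..1}" by (simp add: space_restrict_space)
  show "finite_measure \<mu>"
    by (rule finite_measureI) (use assms in \<open>simp add: sp has_dmeasure_def\<close>)
qed

text \<open>Equality of the distribution functions almost everywhere spreads to all
  \<open>x < 1\<close> by monotonicity and right continuity. At 1 there is nothing to the right, and
  the prescribed total mass decides.\<close>

lemma has_dmeasure_le:
  assumes \<mu>: "has_dmeasure \<phi>0 \<phi>1 f \<mu>" and \<nu>: "has_dmeasure \<phi>0 \<phi>1 f \<nu>" and x: "0 \<le> x" "x \<le> 1"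
  shows "measure \<mu> {0..x} \<le> measure \<nu> {0..x}"
proof (cases "x = 1")
  case True
  then show ?thesis using \<mu> \<nu> by (simp add: has_dmeasure_def measure_def)
next
  case False
  with x have x1: "x < 1" by simp
  have sets: "sets \<mu> = sets (restrict_space borel {0..1})" "sets \<nu> = sets (restrict_space borel {0..1})"
    using \<mu> \<nu> by (auto simp: has_dmeasure_def)
  have ae: "AE x in leb01. measure \<mu> {0..x} = measure \<nu> {0..x}"
  proof -
    have "AE x in leb01. f x = \<phi>0 + measure \<mu> {0..x}" "AE x in leb01. f x = \<phi>0 + measure \<nu> {0..x}"
      using \<mu> \<nu> by (auto simp: has_dmeasure_def)
    then show ?thesis by eventually_elim simp
  qed
  show ?thesis
  proof (rule LIMSEQ_le_const[OF measure_Icc_right_limit[OF has_dmeasure_finite(2)[OF \<nu>] sets(2) x(1) x1]], intro exI allI impI)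
    fix n
    have d: "0 < (1 - x) / real (Suc n)" "(1 - x) / real (Suc n) \<le> 1 - x"
      using x1 divide_left_mono[of 1 "real (Suc n)" "1 - x"] by auto
    then obtain z where z: "x < z" "z < x + (1 - x) / real (Suc n)" "measure \<mu> {0..z} = measure \<nu> {0..z}"
      using AE_leb01_exists_between[OF ae x(1), of "x + (1 - x) / real (Suc n)"] by auto
    have "measure \<mu> {0..x} \<le> measure \<mu> {0..z}"
      using z d by (intro finite_measure.finite_measure_mono[OF has_dmeasure_finite(2)[OF \<mu>]])
        (auto simp: sets sets_restrict_space_iff)
    also have "\<dots> = measure \<nu> {0..z}" by fact
    also have "\<dots> \<le> measure \<nu> {0..x + (1 - x) / real (Suc n)}"
      using z d by (intro finite_measure.finite_measure_mono[OF has_dmeasure_finite(2)[OF \<nu>]])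
        (auto simp: sets sets_restrict_space_iff)
    finally show "measure \<mu> {0..x} \<le> measure \<nu> {0..x + (1 - x) / real (Suc n)}" .
  qed
qed

text \<open>Makes the definite description in \<open>dmeasure\<close> meaningful. Atoms at 0 and 1
  are captured by the closed intervals and by the total mass.\<close>

lemma has_dmeasure_unique:
  assumes \<mu>: "has_dmeasure \<phi>0 \<phi>1 f \<mu>" and \<nu>: "has_dmeasure \<phi>0 \<phi>1 f \<nu>"
  shows "\<mu> = \<nu>"
proof -
  have sets: "sets \<mu> = sets (restrict_space borel {0..1})" "sets \<nu> = sets (restrict_space borel {0..1})"
    using \<mu> \<nu> by (auto simp: has_dmeasure_def)
  have total: "emeasure \<mu> {0..1} = emeasure \<nu> {0..1}" using \<mu> \<nu> by (simp add: has_dmeasure_def)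
  have id: "(\<lambda>x. x) \<in> borel_measurable \<kappa>" if "sets \<kappa> = sets (restrict_space borel {0..1::real})" for \<kappa>
    by (subst measurable_cong_sets[OF that refl]) (rule measurable_restrict_space1, simp)
  have emb: "emeasure (distr \<kappa> borel (\<lambda>x. x)) A = emeasure \<kappa> (A \<inter> {0..1})"
    if "has_dmeasure \<phi>0 \<phi>1 f \<kappa>" "A \<in> sets borel" for \<kappa> A
    using that id[of \<kappa>] has_dmeasure_finite(1)[OF that(1)]
    by (subst emeasure_distr) (auto simp: has_dmeasure_def)
  have eq: "emeasure \<mu> {0..x} = emeasure \<nu> {0..x}" if "0 \<le> x" "x \<le> 1" for x
    using has_dmeasure_le[OF \<mu> \<nu> that] has_dmeasure_le[OF \<nu> \<mu> that]
      finite_measure.emeasure_eq_measure[OF has_dmeasure_finite(2)[OF \<mu>]]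
      finite_measure.emeasure_eq_measure[OF has_dmeasure_finite(2)[OF \<nu>]] by simp
  \<comment> \<open>Both measures are pushed to the whole line, where agreement on the rays
    \<open>{x<..}\<close> determines a measure.\<close>
  have "distr \<mu> borel (\<lambda>x. x) = distr \<nu> borel (\<lambda>x. x)"
  proof (rule measure_eqI_lessThan)
    fix x :: real
    show "emeasure (distr \<mu> borel (\<lambda>x. x)) {x<..} < \<infinity>"
      using finite_measure.emeasure_finite[OF has_dmeasure_finite(2)[OF \<mu>]]
      by (simp add: emb[OF \<mu>] less_top)
    consider "x < 0" | "0 \<le> x" "x \<le> 1" | "1 < x" by linarith
    then have "emeasure \<mu> ({x<..} \<inter> {0..1}) = emeasure \<nu> ({x<..} \<inter> {0..1})"
    proof cases
      case 1
      then have "{x<..} \<inter> {0..1} = {0..1}" by auto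
      then show ?thesis using total by simp
    next
      case 2
      then have "{x<..} \<inter> {0..1} = {0..1} - {0..x}" by auto
      moreover have "emeasure \<kappa> ({0..1} - {0..x}) = emeasure \<kappa> {0..1} - emeasure \<kappa> {0..x}"
        if "has_dmeasure \<phi>0 \<phi>1 f \<kappa>" for \<kappa>
        using that 2 finite_measure.emeasure_finite[OF has_dmeasure_finite(2)[OF that], of "{0..x}"]
        by (intro emeasure_Diff) (auto simp: has_dmeasure_def sets_restrict_space_iff)
      ultimately show ?thesis using \<mu> \<nu> total eq[OF 2] by simp
    next
      case 3
      then have "{x<..} \<inter> {0..1} = {}" by auto
      then show ?thesis by simp
    qed
    then show "emeasure (distr \<mu> borel (\<lambda>x. x)) {x<..} = emeasure (distr \<nu> borel (\<lambda>x. x)) {x<..}"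
      by (simp add: emb[OF \<mu>] emb[OF \<nu>])
  qed simp_all
  note d = this
  show ?thesis
  proof (rule measure_eqI)
    show "sets \<mu> = sets \<nu>" using sets by simp
    fix A assume "A \<in> sets \<mu>"
    then have A: "A \<in> sets borel" "A \<inter> {0..1} = A" by (auto simp: sets sets_restrict_space_iff)
    then show "emeasure \<mu> A = emeasure \<nu> A"
      using emb[OF \<mu> A(1)] emb[OF \<nu> A(1)] d by simp
  qed
qed

lemma dmeasure_eq: "has_dmeasure \<phi>0 \<phi>1 f \<mu> \<Longrightarrow> dmeasure \<phi>0 \<phi>1 f = \<mu>"
  unfolding dmeasure_def using has_dmeasure_unique by (intro the_equality) auto

lemma sigma_finite_leb01: "sigma_finite_measure leb01"
  by (rule finite_measure.axioms(1)[OF finite_measure_leb01])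

lemma sets_leb01: "sets leb01 = sets (restrict_space borel {0..1})"
  by (rule sets_restrict_space_cong) simp

section \<open>The functional expressed through rescaled slopes\<close>

context profile_problem
begin

definition slope_measure :: "(real \<Rightarrow> real) \<Rightarrow> real measure" where
  "slope_measure a = density leb01 (\<lambda>x. ennreal (a x / \<epsilon>))"

text \<open>Admissibility without the mass constraint, which for a given profile is known only after
  its measure has been identified.\<close>

definition unit_valued :: "(real \<Rightarrow> real) \<Rightarrow> bool" where
  "unit_valued a \<longleftrightarrow> a \<in> borel_measurable leb01 \<and> (\<forall>x\<in>{0..1}. 0 \<le> a x \<and> a x \<le> 1)"

lemma emeasure_slope_measure:
  assumes a: "unit_valued a" and x: "x \<in> {0..1}"
  shows "emeasure (slope_measure a) {0..x} = ennreal (primitive a x / \<epsilon>)"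
proof -
  have [measurable]: "a \<in> borel_measurable leb01" using a by (simp add: unit_valued_def)
  have S: "{0..x} \<in> sets leb01" using x by (auto simp: sets_restrict_space_iff)
  have "emeasure (slope_measure a) {0..x} = (\<integral>\<^sup>+y. ennreal (a y / \<epsilon>) * indicator {0..x} y \<partial>leb01)"
    unfolding slope_measure_def using S by (subst emeasure_density) auto
  also have "\<dots> = (\<integral>\<^sup>+y. ennreal (indicator {..x} y * a y / \<epsilon>) \<partial>leb01)"
    by (intro nn_integral_cong) (auto simp: indicator_def)
  also have "\<dots> = ennreal (\<integral>y. indicator {..x} y * a y / \<epsilon> \<partial>leb01)"
  proof (rule nn_integral_eq_integral)
    show "integrable leb01 (\<lambda>y. indicator {..x} y * a y / \<epsilon>)"
      using a by (intro integrable_divide_zero impI integrable_leb01[of _ 1] indicator_mult_le) (auto simp: unit_valued_def)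
    show "AE y in leb01. 0 \<le> indicator {..x} y * a y / \<epsilon>"
      using a \<epsilon>_pos by (intro AE_I2) (auto simp: unit_valued_def)
  qed
  also have "\<dots> = ennreal (primitive a x / \<epsilon>)" by (simp add: primitive_def)
  finally show ?thesis .
qed

lemma measure_slope_measure:
  assumes a: "unit_valued a" and x: "x \<in> {0..1}"
  shows "measure (slope_measure a) {0..x} = primitive a x / \<epsilon>"
proof -
  have "0 \<le> primitive a x"
    unfolding primitive_def using a by (intro Bochner_Integration.integral_nonneg) (auto simp: unit_valued_def)
  then show ?thesis using emeasure_slope_measure[OF a x] \<epsilon>_pos by (simp add: measure_def)
qed

lemma admissible_unit_valued: "admissible a \<longleftrightarrow> unit_valued a \<and> (\<integral>x. a x \<partial>leb01) = mass"
  by (auto simp: admissible_def unit_valued_def)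

lemma has_dmeasure_profile:
  assumes a: "admissible a"
  shows "has_dmeasure \<phi>0 \<phi>1 (profile a) (slope_measure a)"
proof -
  have u: "unit_valued a" using a by (simp add: admissible_unit_valued)
  have "sets (slope_measure a) = sets (restrict_space borel {0..1})"
    by (simp add: slope_measure_def sets_leb01)
  moreover have "emeasure (slope_measure a) {0..1} = ennreal (\<phi>1 - \<phi>0)"
    using emeasure_slope_measure[OF u, of 1] \<epsilon>_pos admissible_integral[OF a] by (simp add: primitive_1 mass_def)
  moreover have "AE x in leb01. profile a x = \<phi>0 + measure (slope_measure a) {0..x}"
    by (intro AE_I2) (simp add: measure_slope_measure[OF u] profile_def)
  ultimately show ?thesis by (simp add: has_dmeasure_def)
qed

definition energy :: "(real \<Rightarrow> real) \<Rightarrow> real" where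
  "energy a = (\<integral>x. binary_entropy (a x) + (profile a x - ln (1 + exp (profile a x))) \<partial>leb01)"

lemma Lambda_fun_profile:
  assumes a: "admissible a"
  shows "Lambda_fun \<epsilon> \<phi>0 \<phi>1 (profile a) = ereal (energy a)"
proof -
  note [measurable] = admissible_measurable[OF a] profile_measurable[OF a]
  have dm: "dmeasure \<phi>0 \<phi>1 (profile a) = slope_measure a"
    by (rule dmeasure_eq[OF has_dmeasure_profile[OF a]])
  have "AE x in leb01. ennreal (a x / \<epsilon>) = RN_deriv leb01 (slope_measure a) x"
    by (rule sigma_finite_measure.RN_deriv_unique[OF sigma_finite_leb01]) (simp_all add: slope_measure_def)
  then have dens: "AE x in leb01. \<epsilon> * ddensity \<phi>0 \<phi>1 (profile a) x = a x \<and> a x \<in> {0..1}"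
    using AE_space
  proof eventually_elim
    case (elim x)
    then have "ddensity \<phi>0 \<phi>1 (profile a) x = a x / \<epsilon>"
      using admissible_nonneg[OF a, of x] \<epsilon>_pos by (simp add: ddensity_def dm flip: elim(1))
    then show ?case using elim(2) admissibleD(2,3)[OF a, of x] \<epsilon>_pos by simp
  qed
  have [measurable]: "ddensity \<phi>0 \<phi>1 (profile a) \<in> borel_measurable leb01"
    unfolding ddensity_def[abs_def] by measurable
  have [measurable]: "(\<lambda>x. real_of_ereal (s_entropy (\<epsilon> * ddensity \<phi>0 \<phi>1 (profile a) x))) \<in> borel_measurable leb01"
    by (rule measurable_compose[OF _ s_entropy_measurable]) measurable
  have "(\<integral>x. real_of_ereal (s_entropy (\<epsilon> * ddensity \<phi>0 \<phi>1 (profile a) x)) + profile a x - ln (1 + exp (profile a x)) \<partial>leb01)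
    = energy a"
    unfolding energy_def
  proof (rule integral_cong_AE)
    show "AE x in leb01. real_of_ereal (s_entropy (\<epsilon> * ddensity \<phi>0 \<phi>1 (profile a) x)) + profile a x - ln (1 + exp (profile a x))
      = binary_entropy (a x) + (profile a x - ln (1 + exp (profile a x)))"
      using dens by eventually_elim (simp add: s_entropy_def binary_entropy_def)
  qed measurable
  moreover have "absolutely_continuous leb01 (slope_measure a)"
    unfolding slope_measure_def by (rule absolutely_continuousI_density) measurable
  moreover have "AE x in leb01. 0 \<le> \<epsilon> * ddensity \<phi>0 \<phi>1 (profile a) x \<and> \<epsilon> * ddensity \<phi>0 \<phi>1 (profile a) x \<le> 1"
    using dens by eventually_elim auto
  ultimately show ?thesis
    using has_dmeasure_profile[OF a] unfolding Lambda_fun_def dm by auto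
qed

text \<open>Converse of \<open>Lambda_fun_profile\<close>: a finite value forces the profile form,
  so the supremum in the Legendre transform may be taken over admissible slopes.\<close>

lemma Lambda_fun_finite:
  assumes fin: "Lambda_fun \<epsilon> \<phi>0 \<phi>1 f \<noteq> \<infinity>"
  shows "\<exists>a. admissible a \<and> (AE x in leb01. f x = profile a x)"
proof -
  define \<mu> where "\<mu> = dmeasure \<phi>0 \<phi>1 f"
  have *: "\<exists>\<mu>. has_dmeasure \<phi>0 \<phi>1 f \<mu>" "absolutely_continuous leb01 \<mu>"
    "AE x in leb01. 0 \<le> \<epsilon> * ddensity \<phi>0 \<phi>1 f x \<and> \<epsilon> * ddensity \<phi>0 \<phi>1 f x \<le> 1"
    using fin unfolding Lambda_fun_def \<mu>_def by (auto split: if_splits)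
  then have \<mu>: "has_dmeasure \<phi>0 \<phi>1 f \<mu>" using dmeasure_eq unfolding \<mu>_def by metis
  then have sets: "sets \<mu> = sets leb01" by (simp add: has_dmeasure_def sets_leb01)
  \<comment> \<open>Clipping changes the rescaled density only on a null set and makes the bounds
    hold everywhere.\<close>
  define a where "a = (\<lambda>x. max 0 (min 1 (\<epsilon> * ddensity \<phi>0 \<phi>1 f x)))"
  have [measurable]: "ddensity \<phi>0 \<phi>1 f \<in> borel_measurable leb01"
    unfolding ddensity_def[abs_def] by measurable
  have am[measurable]: "a \<in> borel_measurable leb01" unfolding a_def by measurable
  have u: "unit_valued a" unfolding unit_valued_def using am by (auto simp: a_def)
  \<comment> \<open>Needed because \<open>enn2real\<close> sends infinity to 0, so an infinite
    density could not be recovered from \<open>ddensity\<close>.\<close>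
  have "AE x in leb01. RN_deriv leb01 \<mu> x \<noteq> \<infinity>"
    by (rule sigma_finite_measure.RN_deriv_finite[OF sigma_finite_leb01 finite_measure.axioms(1) *(2) sets])
      (rule has_dmeasure_finite[OF \<mu>])
  with *(3) have "AE x in leb01. ennreal (a x / \<epsilon>) = RN_deriv leb01 \<mu> x"
  proof eventually_elim
    case (elim x)
    then have "a x / \<epsilon> = ddensity \<phi>0 \<phi>1 f x" using \<epsilon>_pos by (simp add: a_def)
    then show ?case using elim(2) by (simp add: ddensity_def \<mu>_def less_top)
  qed
  then have "slope_measure a = density leb01 (RN_deriv leb01 \<mu>)"
    unfolding slope_measure_def by (intro density_cong) auto
  also have "\<dots> = \<mu>"
    by (rule sigma_finite_measure.density_RN_deriv[OF sigma_finite_leb01 *(2) sets])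
  finally have sm: "slope_measure a = \<mu>" .
  have "emeasure \<mu> {0..1} = ennreal (\<phi>1 - \<phi>0)" using \<mu> by (simp add: has_dmeasure_def)
  then have "(\<integral>x. a x \<partial>leb01) / \<epsilon> = \<phi>1 - \<phi>0"
    using measure_slope_measure[OF u, of 1] \<phi>01 by (simp add: sm primitive_1 measure_def)
  then have adm: "admissible a" using u \<epsilon>_pos by (simp add: admissible_unit_valued mass_def field_simps)
  have "AE x in leb01. f x = \<phi>0 + measure \<mu> {0..x}" using \<mu> by (simp add: has_dmeasure_def)
  then have "AE x in leb01. f x = profile a x"
    using AE_space by eventually_elim (simp add: profile_def sm[symmetric] measure_slope_measure[OF u])
  then show ?thesis using adm by blast
qed

end

section \<open>Classes of functions\<close>

lemma abs_L1_eq_iff: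
  "integrable leb01 f \<Longrightarrow> integrable leb01 g \<Longrightarrow> abs_L1 f = abs_L1 g \<longleftrightarrow> (AE x in leb01. f x = g x)"
  using Quotient3_rel[OF Quotient3_L1, of f g] by simp

lemma L1_cases: obtains f where "integrable leb01 f" "l = abs_L1 f"
  by (induction l rule: L1.abs_induct) auto

text \<open>Truncation on a null set turns the essential bound into a pointwise one, which is the
  form used throughout the variational problem.\<close>

lemma Linf_bounded_representative:
  "\<exists>r R. r \<in> borel_measurable leb01 \<and> (\<forall>x. \<bar>r x\<bar> \<le> R) \<and> \<rho> = abs_Linf r"
proof (induction \<rho> rule: Linf.abs_induct)
  case (1 f)
  then have f: "ess_bounded01 f" by simp
  then obtain C where fm[measurable]: "f \<in> borel_measurable leb01" and C: "AE x in leb01. \<bar>f x\<bar> \<le> C"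
    by (auto simp: ess_bounded01_def)
  define r where "r = (\<lambda>x. if \<bar>f x\<bar> \<le> C then f x else 0)"
  have rm: "r \<in> borel_measurable leb01" unfolding r_def by measurable
  have rC: "\<bar>r x\<bar> \<le> \<bar>C\<bar>" for x by (auto simp: r_def)
  have "ess_bounded01 r" using rm rC by (auto simp: ess_bounded01_def intro!: exI[of _ "\<bar>C\<bar>"])
  moreover have "AE x in leb01. f x = r x" using C by eventually_elim (simp add: r_def)
  ultimately have "abs_Linf f = abs_Linf r"
    using Quotient3_rel[OF Quotient3_Linf, of f r] f by simp
  then show ?case using rm rC by blast
qed

lemma Linf_cases:
  obtains r R where "r \<in> borel_measurable leb01" "\<And>x. x \<in> {0..1} \<Longrightarrow> \<bar>r x\<bar> \<le> R" "\<rho> = abs_Linf r"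
  using Linf_bounded_representative[of \<rho>] by blast

lemma bounded_ess_bounded01:
  "r \<in> borel_measurable leb01 \<Longrightarrow> (\<And>x. x \<in> {0..1} \<Longrightarrow> \<bar>r x\<bar> \<le> R) \<Longrightarrow> ess_bounded01 r"
  by (auto simp: ess_bounded01_def intro!: exI[of _ R] AE_I2)

lemma ess_bounded01_mult_integrable:
  assumes "ess_bounded01 f" and g: "integrable leb01 g"
  shows "integrable leb01 (\<lambda>x. f x * g x :: real)"
proof -
  obtain C where [measurable]: "f \<in> borel_measurable leb01" and C: "AE x in leb01. \<bar>f x\<bar> \<le> C"
    using assms by (auto simp: ess_bounded01_def)
  have [measurable]: "g \<in> borel_measurable leb01" using g by simp
  show ?thesis
  proof (rule Bochner_Integration.integrable_bound)
    show "integrable leb01 (\<lambda>x. C * g x)" using g by simp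
    show "AE x in leb01. norm (f x * g x) \<le> norm (C * g x)"
      using C by eventually_elim (auto simp: abs_mult intro!: mult_right_mono)
  qed measurable
qed

lemma bilinear_pairing: "bilinear pairing"
proof -
  have "pairing (x + y) l = pairing x l + pairing y l" for x y l
    by transfer (simp add: distrib_right ess_bounded01_mult_integrable)
  moreover have "pairing x (k + l) = pairing x k + pairing x l" for x k l
    by transfer (simp add: distrib_left ess_bounded01_mult_integrable)
  moreover have "pairing (c *\<^sub>R x) l = c * pairing x l" for c x l
    by transfer (simp add: mult.assoc)
  moreover have "pairing x (c *\<^sub>R l) = c * pairing x l" for c x l
    by transfer (simp add: mult.left_commute)
  ultimately show ?thesis by (auto simp: bilinear_def intro!: linearI)
qed

text \<open>Testing against the sign of a representative yields its integral norm.\<close>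

lemma pairing_separating:
  assumes "\<And>v. pairing v l = 0"
  shows "l = 0"
proof -
  obtain f where f: "integrable leb01 f" "l = abs_L1 f" by (rule L1_cases[of l])
  have [measurable]: "f \<in> borel_measurable leb01" using f by simp
  have "ess_bounded01 (\<lambda>x. sgn (f x))"
    by (rule bounded_ess_bounded01[of _ 1]) (auto simp: sgn_if)
  then have "(\<integral>x. sgn (f x) * f x \<partial>leb01) = 0"
    using assms[of "abs_Linf (\<lambda>x. sgn (f x))"] f by (simp add: pairing.abs_eq)
  then have "(\<integral>x. \<bar>f x\<bar> \<partial>leb01) = 0" by (simp add: abs_sgn mult.commute)
  then have "AE x in leb01. f x = 0"
    using integral_nonneg_eq_0_iff_AE[of leb01 "\<lambda>x. \<bar>f x\<bar>"] f by simp
  then show ?thesis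
    using abs_L1_eq_iff[OF f(1), of "\<lambda>_. 0"] f by (simp add: zero_L1.abs_eq)
qed

lemma topspace_weak_star: "topspace weak_star = UNIV"
  unfolding weak_star_def topology_generated_by_topspace by (auto intro!: exI[of _ UNIV])

section \<open>The Legendre transform and its maximizers\<close>

context profile_problem
begin

definition profile_class :: "(real \<Rightarrow> real) \<Rightarrow> L1" where
  "profile_class a = abs_L1 (profile a)"

lemma profile_integrable: "admissible a \<Longrightarrow> integrable leb01 (profile a)"
  by (rule integrable_leb01[OF profile_measurable profile_abs_le])

lemma Lambda_profile_class: "admissible a \<Longrightarrow> Lambda \<epsilon> \<phi>0 \<phi>1 (profile_class a) = ereal (energy a)"
  unfolding profile_class_def using profile_integrable by (simp add: Lambda.abs_eq Lambda_fun_profile)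

lemma Lambda_finite_cases:
  assumes "Lambda \<epsilon> \<phi>0 \<phi>1 \<phi> \<noteq> \<infinity>"
  obtains a where "admissible a" "\<phi> = profile_class a"
proof -
  obtain f where f: "integrable leb01 f" "\<phi> = abs_L1 f" by (rule L1_cases[of \<phi>])
  then have "Lambda_fun \<epsilon> \<phi>0 \<phi>1 f \<noteq> \<infinity>" using assms by (simp add: Lambda.abs_eq)
  then obtain a where a: "admissible a" "AE x in leb01. f x = profile a x" using Lambda_fun_finite by blast
  then show thesis
    using that f abs_L1_eq_iff[OF f(1) profile_integrable[OF a(1)]] by (simp add: profile_class_def)
qed

lemma profile_class_in_profiles: "admissible a \<Longrightarrow> profile_class a \<in> profiles \<phi>0 \<phi>1"
  unfolding profiles_def profile_class_def using profile_integrable has_dmeasure_profile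
  by (auto simp: is_profile.abs_eq)

lemma pairing_profile_class:
  assumes "admissible a" "r \<in> borel_measurable leb01" "\<And>x. x \<in> {0..1} \<Longrightarrow> \<bar>r x\<bar> \<le> R"
  shows "pairing (abs_Linf r) (profile_class a) = (\<integral>x. r x * profile a x \<partial>leb01)"
  unfolding profile_class_def
  by (rule pairing.abs_eq) (use bounded_ess_bounded01[OF assms(2,3)] profile_integrable[OF assms(1)] in auto)

lemma J_eq_pairing:
  assumes a: "admissible a" and r: "r \<in> borel_measurable leb01" "\<And>x. x \<in> {0..1} \<Longrightarrow> \<bar>r x\<bar> \<le> R"
  shows "pairing (abs_Linf r) (profile_class a) - energy a = - J r a"
proof -
  have "J (\<lambda>x. 0 + 1 * r x) a = J (\<lambda>_. 0) a - 1 * (\<integral>x. r x * profile a x \<partial>leb01)"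
    by (rule J_perturb[where R = 0 and C = R]) (use a r in auto)
  moreover have "J (\<lambda>_. 0) a = energy a" by (simp add: J_def cost_def energy_def)
  ultimately show ?thesis using pairing_profile_class[OF a r] by simp
qed

abbreviation G :: "Linf \<Rightarrow> real" where
  "G \<rho> \<equiv> real_of_ereal (Lambda_star \<epsilon> \<phi>0 \<phi>1 \<rho>)"

lemma Lambda_star_eq:
  assumes r: "r \<in> borel_measurable leb01" "\<And>x. x \<in> {0..1} \<Longrightarrow> \<bar>r x\<bar> \<le> R"
    and a: "admissible a" and min: "\<And>c. admissible c \<Longrightarrow> J r a \<le> J r c"
  shows "Lambda_star \<epsilon> \<phi>0 \<phi>1 (abs_Linf r) = ereal (- J r a)"
proof -
  have val: "ereal (pairing (abs_Linf r) (profile_class c)) - Lambda \<epsilon> \<phi>0 \<phi>1 (profile_class c) = ereal (- J r c)"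
    if "admissible c" for c
    using J_eq_pairing[OF that r] by (simp add: Lambda_profile_class[OF that])
  show ?thesis unfolding Lambda_star_def
  proof (rule antisym)
    show "(SUP \<phi>. ereal (pairing (abs_Linf r) \<phi>) - Lambda \<epsilon> \<phi>0 \<phi>1 \<phi>) \<le> ereal (- J r a)"
    proof (rule SUP_least)
      fix \<phi>
      show "ereal (pairing (abs_Linf r) \<phi>) - Lambda \<epsilon> \<phi>0 \<phi>1 \<phi> \<le> ereal (- J r a)"
      proof (cases "Lambda \<epsilon> \<phi>0 \<phi>1 \<phi> = \<infinity>")
        case False
        then obtain c where c: "admissible c" "\<phi> = profile_class c" by (rule Lambda_finite_cases)
        then show ?thesis using val[OF c(1)] min[OF c(1)] by simp
      qed simp
    qed
    show "ereal (- J r a) \<le> (SUP \<phi>. ereal (pairing (abs_Linf r) \<phi>) - Lambda \<epsilon> \<phi>0 \<phi>1 \<phi>)"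
      unfolding val[OF a, symmetric] by (rule SUP_upper) simp
  qed
qed

text \<open>The perturbation result with perturbation 0.\<close>

lemma minimizer_exists:
  assumes r: "r \<in> borel_measurable leb01" "\<And>x. x \<in> {0..1} \<Longrightarrow> \<bar>r x\<bar> \<le> R"
  obtains a where "admissible a" "\<And>c. admissible c \<Longrightarrow> J r a \<le> J r c"
  by (rule perturbed_minimizer[OF r, of "\<lambda>_. 0" 0]) auto

lemma Lambda_star_finite: "Lambda_star \<epsilon> \<phi>0 \<phi>1 \<rho> = ereal (G \<rho>)"
proof -
  obtain r R where r: "r \<in> borel_measurable leb01" "\<And>x. x \<in> {0..1} \<Longrightarrow> \<bar>r x\<bar> \<le> R" and \<rho>: "\<rho> = abs_Linf r"
    using Linf_cases[of \<rho>] by blast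
  obtain a where "admissible a" "\<And>c. admissible c \<Longrightarrow> J r a \<le> J r c"
    using minimizer_exists[OF r] by blast
  from Lambda_star_eq[OF r this] show ?thesis unfolding \<rho> by simp
qed

text \<open>The supremum is finite, so a maximizer has finite \<Lambda> and comes from an admissible
  slope; all quantities then become real, as the abstract setting requires.\<close>

lemma maximizers_eq:
  "maximizers \<epsilon> \<phi>0 \<phi>1 \<rho> = {\<phi> \<in> profile_class ` {a. admissible a}. pairing \<rho> \<phi> - real_of_ereal (Lambda \<epsilon> \<phi>0 \<phi>1 \<phi>) = G \<rho>}"
proof (intro equalityI subsetI)
  fix \<phi> assume "\<phi> \<in> maximizers \<epsilon> \<phi>0 \<phi>1 \<rho>"
  then have "ereal (pairing \<rho> \<phi>) - Lambda \<epsilon> \<phi>0 \<phi>1 \<phi> = Lambda_star \<epsilon> \<phi>0 \<phi>1 \<rho>"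
    by (simp add: maximizers_def)
  also note Lambda_star_finite
  finally have e: "ereal (pairing \<rho> \<phi>) - Lambda \<epsilon> \<phi>0 \<phi>1 \<phi> = ereal (G \<rho>)" .
  then have "Lambda \<epsilon> \<phi>0 \<phi>1 \<phi> \<noteq> \<infinity>" by auto
  then obtain a where a: "admissible a" "\<phi> = profile_class a" by (rule Lambda_finite_cases)
  then show "\<phi> \<in> {\<phi> \<in> profile_class ` {a. admissible a}. pairing \<rho> \<phi> - real_of_ereal (Lambda \<epsilon> \<phi>0 \<phi>1 \<phi>) = G \<rho>}"
    using e by (simp add: Lambda_profile_class)
next
  fix \<phi> assume "\<phi> \<in> {\<phi> \<in> profile_class ` {a. admissible a}. pairing \<rho> \<phi> - real_of_ereal (Lambda \<epsilon> \<phi>0 \<phi>1 \<phi>) = G \<rho>}"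
  then obtain a where "admissible a" "\<phi> = profile_class a" "pairing \<rho> \<phi> - energy a = G \<rho>"
    by (auto simp: Lambda_profile_class)
  then show "\<phi> \<in> maximizers \<epsilon> \<phi>0 \<phi>1 \<rho>"
    unfolding maximizers_def mem_Collect_eq by (subst Lambda_star_finite) (simp add: Lambda_profile_class)
qed

lemma maximizers_abs_Linf:
  assumes r: "r \<in> borel_measurable leb01" "\<And>x. x \<in> {0..1} \<Longrightarrow> \<bar>r x\<bar> \<le> R"
  shows "maximizers \<epsilon> \<phi>0 \<phi>1 (abs_Linf r) = profile_class ` {a. admissible a \<and> (\<forall>c. admissible c \<longrightarrow> J r a \<le> J r c)}"
proof -
  obtain a where a: "admissible a" "\<And>c. admissible c \<Longrightarrow> J r a \<le> J r c"
    using minimizer_exists[OF r] by blast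
  have "G (abs_Linf r) = - J r a" using Lambda_star_eq[OF r a] by simp
  then have "maximizers \<epsilon> \<phi>0 \<phi>1 (abs_Linf r) = profile_class ` {c. admissible c \<and> J r c = J r a}"
    unfolding maximizers_eq using J_eq_pairing[OF _ r] by (auto simp: Lambda_profile_class)
  moreover have "{c. admissible c \<and> J r c = J r a} = {c. admissible c \<and> (\<forall>d. admissible d \<longrightarrow> J r c \<le> J r d)}"
    using a by (auto intro: antisym)
  ultimately show ?thesis by simp
qed

text \<open>A maximizer is determined by its multiplier, so the finite set of shooting parameters
  maps onto a set containing all maximizers.\<close>

lemma finite_maximizers: "finite (maximizers \<epsilon> \<phi>0 \<phi>1 \<rho>)"
proof -
  obtain r R where r: "r \<in> borel_measurable leb01" "\<And>x. x \<in> {0..1} \<Longrightarrow> \<bar>r x\<bar> \<le> R" and \<rho>: "\<rho> = abs_Linf r"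
    using Linf_cases[of \<rho>] by blast
  have M: "maximizers \<epsilon> \<phi>0 \<phi>1 \<rho> = profile_class ` {a. admissible a \<and> (\<forall>c. admissible c \<longrightarrow> J r a \<le> J r c)}"
    unfolding \<rho> by (rule maximizers_abs_Linf) (use r in auto)
  define sol where "sol = (\<lambda>p a. admissible a \<and> (AE x in leb01. a x = logistic (field r a p x)))"
  define P where "P = {p. \<bar>p - logit_mass\<bar> \<le> (1 + R) / \<epsilon> \<and> (\<exists>a. sol p a)}"
  have "finite P" unfolding P_def sol_def by (rule finite_shooting_parameters[OF r])
  moreover have "maximizers \<epsilon> \<phi>0 \<phi>1 \<rho> \<subseteq> (\<lambda>p. profile_class (SOME a. sol p a)) ` P"
  proof
    fix \<phi> assume "\<phi> \<in> maximizers \<epsilon> \<phi>0 \<phi>1 \<rho>"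
    then obtain a where a: "admissible a" "\<And>c. admissible c \<Longrightarrow> J r a \<le> J r c" and \<phi>: "\<phi> = profile_class a"
      unfolding M by blast
    obtain p where p: "\<bar>p - logit_mass\<bar> \<le> (1 + R) / \<epsilon>" "AE x in leb01. a x = logistic (field r a p x)"
      using minimizer_Euler_Lagrange[OF a(1) r a(2)] by blast
    have sol: "sol p a" using a p by (simp add: sol_def)
    \<comment> \<open>The chosen solution may differ from \<open>a\<close>, but by uniqueness for
      fixed \<open>p\<close> both have the same profile.\<close>
    define b where "b = (SOME a. sol p a)"
    have b: "sol p b" unfolding b_def by (rule someI[of "sol p", OF sol])
    have "AE x in leb01. profile a x = profile b x"
      by (rule AE_I2, rule profile_unique[OF r, where p = p]) (use sol b in \<open>auto simp: sol_def\<close>)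
    then have "profile_class a = profile_class b"
      unfolding profile_class_def using sol b
      by (subst abs_L1_eq_iff) (auto simp: sol_def intro!: profile_integrable)
    then show "\<phi> \<in> (\<lambda>p. profile_class (SOME a. sol p a)) ` P"
      using p(1) sol unfolding P_def \<phi> b_def by blast
  qed
  ultimately show ?thesis by (meson finite_imageI finite_subset)
qed

text \<open>\<open>perturbed_minimizer\<close> bounds every competitor at the times
  \<open>t n\<close>, in particular the minimizer of the perturbed problem, which realizes the
  transform there. As \<open>t n\<close> tends to 0 from the right, the bound holds
  frequently.\<close>

lemma Lambda_star_directional_bound:
  "\<exists>\<phi>\<in>maximizers \<epsilon> \<phi>0 \<phi>1 \<rho>. \<forall>\<eta>>0. frequently (\<lambda>t. G (\<rho> + t *\<^sub>R v) \<le> G \<rho> + t * (pairing v \<phi> + \<eta>)) (at_right 0)"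
proof -
  obtain r R where r: "r \<in> borel_measurable leb01" "\<And>x. x \<in> {0..1} \<Longrightarrow> \<bar>r x\<bar> \<le> R" and \<rho>: "\<rho> = abs_Linf r"
    using Linf_cases[of \<rho>] by blast
  obtain w W where w: "w \<in> borel_measurable leb01" "\<And>x. x \<in> {0..1} \<Longrightarrow> \<bar>w x\<bar> \<le> W" and v: "v = abs_Linf w"
    using Linf_cases[of v] by blast
  obtain a t e where a: "admissible a" "\<And>c. admissible c \<Longrightarrow> J r a \<le> J r c"
    and t: "\<And>n::nat. 0 < t n" "t \<longlonglongrightarrow> 0" and e: "e \<longlonglongrightarrow> 0"
    and bd: "\<And>n c. admissible c \<Longrightarrow>
      - J (\<lambda>x. r x + t n * w x) c \<le> - J r a + t n * ((\<integral>x. w x * profile a x \<partial>leb01) + e n)"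
    using perturbed_minimizer[OF r w] by blast
  have M: "maximizers \<epsilon> \<phi>0 \<phi>1 \<rho> = profile_class ` {a. admissible a \<and> (\<forall>c. admissible c \<longrightarrow> J r a \<le> J r c)}"
    unfolding \<rho> by (rule maximizers_abs_Linf) (use r in auto)
  have G\<rho>: "G \<rho> = - J r a" unfolding \<rho> using Lambda_star_eq[OF r a] by simp
  have pv: "pairing v (profile_class a) = (\<integral>x. w x * profile a x \<partial>leb01)"
    unfolding v by (rule pairing_profile_class[OF a(1) w])
  have step: "G (\<rho> + t n *\<^sub>R v) \<le> G \<rho> + t n * (pairing v (profile_class a) + e n)" for n
  proof -
    have eq: "\<rho> + t n *\<^sub>R v = abs_Linf (\<lambda>x. r x + t n * w x)"
      unfolding \<rho> v using bounded_ess_bounded01[OF r] bounded_ess_bounded01[OF w]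
      by (simp add: scaleR_Linf.abs_eq plus_Linf.abs_eq ess_bounded01_scale)
    have m: "(\<lambda>x. r x + t n * w x) \<in> borel_measurable leb01"
      using r(1) w(1) by (intro borel_measurable_add borel_measurable_times) auto
    have b: "\<bar>r x + t n * w x\<bar> \<le> R + t n * W" if "x \<in> {0..1}" for x
    proof -
      have "\<bar>t n * w x\<bar> \<le> t n * W" using t(1)[of n] w(2)[OF that] by (simp add: abs_mult)
      then show ?thesis using r(2)[OF that] by linarith
    qed
    obtain c where c: "admissible c" "\<And>d. admissible d \<Longrightarrow> J (\<lambda>x. r x + t n * w x) c \<le> J (\<lambda>x. r x + t n * w x) d"
      using minimizer_exists[OF m b] by blast
    show ?thesis using Lambda_star_eq[OF m b c] bd[OF c(1), of n] unfolding eq[symmetric] G\<rho> pv by simp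
  qed
  have tr: "filterlim t (at_right 0) sequentially"
    using t(2) order.strict_implies_not_eq[OF t(1)] by (auto simp: filterlim_at t(1))
  show ?thesis
  proof (intro bexI[of _ "profile_class a"] allI impI)
    show "profile_class a \<in> maximizers \<epsilon> \<phi>0 \<phi>1 \<rho>"
      unfolding M using a by blast
    fix \<eta> :: real assume "0 < \<eta>"
    then have "eventually (\<lambda>n. e n < \<eta>) sequentially" using e by (intro order_tendstoD(2)) auto
    then have ev: "eventually (\<lambda>n. G (\<rho> + t n *\<^sub>R v) \<le> G \<rho> + t n * (pairing v (profile_class a) + \<eta>)) sequentially"
    proof eventually_elim
      case (elim n)
      have "t n * (pairing v (profile_class a) + e n) \<le> t n * (pairing v (profile_class a) + \<eta>)"
        using elim t(1)[of n] by (intro mult_left_mono) auto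
      then show ?case using step[of n] by linarith
    qed
    show "frequently (\<lambda>t. G (\<rho> + t *\<^sub>R v) \<le> G \<rho> + t * (pairing v (profile_class a) + \<eta>)) (at_right 0)"
      unfolding frequently_def
    proof
      assume "eventually (\<lambda>t. \<not> G (\<rho> + t *\<^sub>R v) \<le> G \<rho> + t * (pairing v (profile_class a) + \<eta>)) (at_right 0)"
      from eventually_conj[OF ev filterlim_iff[THEN iffD1, OF tr, rule_format, OF this]]
      show False by (simp add: eventually_False)
    qed
  qed
qed

sublocale affine_supremum pairing "profile_class ` {a. admissible a}" "\<lambda>\<phi>. real_of_ereal (Lambda \<epsilon> \<phi>0 \<phi>1 \<phi>)"
  G "maximizers \<epsilon> \<phi>0 \<phi>1"
proof
  show "bilinear pairing" by (rule bilinear_pairing)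
  show "l = 0" if "\<And>v. pairing v l = 0" for l by (rule pairing_separating[OF that])
  show "maximizers \<epsilon> \<phi>0 \<phi>1 \<rho> = {\<phi> \<in> profile_class ` {a. admissible a}.
      pairing \<rho> \<phi> - real_of_ereal (Lambda \<epsilon> \<phi>0 \<phi>1 \<phi>) = G \<rho>}" for \<rho>
    by (rule maximizers_eq)
  show "finite (maximizers \<epsilon> \<phi>0 \<phi>1 \<rho>)" for \<rho> by (rule finite_maximizers)
  show "pairing \<rho> \<phi> - real_of_ereal (Lambda \<epsilon> \<phi>0 \<phi>1 \<phi>) \<le> G \<rho>" if "\<phi> \<in> profile_class ` {a. admissible a}" for \<rho> \<phi>
  proof -
    obtain a where a: "admissible a" "\<phi> = profile_class a" using \<open>\<phi> \<in> _\<close> by blast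
    have "ereal (pairing \<rho> \<phi>) - Lambda \<epsilon> \<phi>0 \<phi>1 \<phi> \<le> Lambda_star \<epsilon> \<phi>0 \<phi>1 \<rho>"
      unfolding Lambda_star_def by (rule SUP_upper) simp
    then show ?thesis unfolding a(2) Lambda_profile_class[OF a(1)]
      by (subst (asm) Lambda_star_finite) simp
  qed
  show "\<exists>\<phi>\<in>maximizers \<epsilon> \<phi>0 \<phi>1 \<rho>. \<forall>\<eta>>0. frequently (\<lambda>t. G (\<rho> + t *\<^sub>R v) \<le> G \<rho> + t * (pairing v \<phi> + \<eta>)) (at_right 0)" for \<rho> v
    by (rule Lambda_star_directional_bound)
qed

text \<open>A strict superlevel set is the union, over admissible slopes, of preimages of open sets
  under pairings, and these generate the weak* topology.\<close>

lemma lower_semicontinuous_Lambda_star: "lower_semicontinuous weak_star (Lambda_star \<epsilon> \<phi>0 \<phi>1)"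
  unfolding lower_semicontinuous_def topspace_weak_star
proof
  fix t :: ereal
  let ?E = "\<lambda>a. (\<lambda>\<rho>. pairing \<rho> (profile_class a)) -` {y. t < ereal (y - energy a)}"
  have "t < Lambda_star \<epsilon> \<phi>0 \<phi>1 \<rho> \<longleftrightarrow> (\<exists>a. admissible a \<and> t < ereal (pairing \<rho> (profile_class a) - energy a))" for \<rho>
  proof
    assume "t < Lambda_star \<epsilon> \<phi>0 \<phi>1 \<rho>"
    then obtain \<phi> where \<phi>: "t < ereal (pairing \<rho> \<phi>) - Lambda \<epsilon> \<phi>0 \<phi>1 \<phi>"
      unfolding Lambda_star_def by (auto simp: less_SUP_iff)
    then have "Lambda \<epsilon> \<phi>0 \<phi>1 \<phi> \<noteq> \<infinity>" by auto
    then obtain a where "admissible a" "\<phi> = profile_class a" by (rule Lambda_finite_cases)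
    then show "\<exists>a. admissible a \<and> t < ereal (pairing \<rho> (profile_class a) - energy a)"
      using \<phi> by (auto simp: Lambda_profile_class)
  next
    assume "\<exists>a. admissible a \<and> t < ereal (pairing \<rho> (profile_class a) - energy a)"
    then obtain a where a: "admissible a" "t < ereal (pairing \<rho> (profile_class a) - energy a)" by blast
    have "ereal (pairing \<rho> (profile_class a)) - Lambda \<epsilon> \<phi>0 \<phi>1 (profile_class a) \<le> Lambda_star \<epsilon> \<phi>0 \<phi>1 \<rho>"
      unfolding Lambda_star_def by (rule SUP_upper) simp
    then show "t < Lambda_star \<epsilon> \<phi>0 \<phi>1 \<rho>" using a by (simp add: Lambda_profile_class)
  qed
  then have eq: "{\<rho> \<in> UNIV. t < Lambda_star \<epsilon> \<phi>0 \<phi>1 \<rho>} = (\<Union>a\<in>{a. admissible a}. ?E a)" by auto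
  have "openin weak_star (?E a)" for a
  proof -
    have "open {y. t < ereal (y - energy a)}"
      by (intro open_Collect_less continuous_intros) 
    then show ?thesis unfolding weak_star_def by (intro topology_generated_by_Basis) blast
  qed
  then show "openin weak_star {\<rho> \<in> UNIV. t < Lambda_star \<epsilon> \<phi>0 \<phi>1 \<rho>}" unfolding eq by (intro openin_Union) auto
qed

end

theorem proposition4p6:
  fixes \<phi>0 \<phi>1 \<epsilon> :: real
  assumes "\<phi>0 < \<phi>1" and "0 < \<epsilon>" and "\<epsilon> < 1 / (\<phi>1 - \<phi>0)"
  shows "(\<forall>\<rho>. \<bar>Lambda_star \<epsilon> \<phi>0 \<phi>1 \<rho>\<bar> \<noteq> \<infinity>)
    \<and> lower_semicontinuous weak_star (Lambda_star \<epsilon> \<phi>0 \<phi>1)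
    \<and> convex_on UNIV (\<lambda>\<rho>. real_of_ereal (Lambda_star \<epsilon> \<phi>0 \<phi>1 \<rho>))
    \<and> (\<forall>\<rho>.
         gateaux_subdiff pairing (Lambda_star \<epsilon> \<phi>0 \<phi>1) \<rho>
           = subdifferential pairing (Lambda_star \<epsilon> \<phi>0 \<phi>1) \<rho>
         \<and> subdifferential pairing (Lambda_star \<epsilon> \<phi>0 \<phi>1) \<rho>
           = convex hull (maximizers \<epsilon> \<phi>0 \<phi>1 \<rho>)
         \<and> (\<forall>\<phi>\<in>profiles \<phi>0 \<phi>1. maximizers \<epsilon> \<phi>0 \<phi>1 \<rho> = {\<phi>} \<longrightarrow>
              gateaux_superdiff pairing (Lambda_star \<epsilon> \<phi>0 \<phi>1) \<rho> = {\<phi>})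
         \<and> (\<not> (\<exists>\<phi>\<in>profiles \<phi>0 \<phi>1. maximizers \<epsilon> \<phi>0 \<phi>1 \<rho> = {\<phi>}) \<longrightarrow>
              gateaux_superdiff pairing (Lambda_star \<epsilon> \<phi>0 \<phi>1) \<rho> = {})
         \<and> (gateaux_differentiable pairing (Lambda_star \<epsilon> \<phi>0 \<phi>1) \<rho> \<longleftrightarrow>
              is_singleton (maximizers \<epsilon> \<phi>0 \<phi>1 \<rho>)))"
proof -
  interpret profile_problem \<phi>0 \<phi>1 \<epsilon> by unfold_locales (fact assms)+
  have fin: "Lambda_star \<epsilon> \<phi>0 \<phi>1 = (\<lambda>\<rho>. ereal (G \<rho>))" using Lambda_star_finite by blast
  have sub: "gateaux_subdiff pairing (Lambda_star \<epsilon> \<phi>0 \<phi>1) \<rho> = subdifferential pairing (Lambda_star \<epsilon> \<phi>0 \<phi>1) \<rho>"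
    "subdifferential pairing (Lambda_star \<epsilon> \<phi>0 \<phi>1) \<rho> = convex hull (maximizers \<epsilon> \<phi>0 \<phi>1 \<rho>)"
    "gateaux_differentiable pairing (Lambda_star \<epsilon> \<phi>0 \<phi>1) \<rho> \<longleftrightarrow> is_singleton (maximizers \<epsilon> \<phi>0 \<phi>1 \<rho>)" for \<rho>
    using gateaux_subdiff_eq[of \<rho>] subdifferential_eq[of \<rho>] gateaux_differentiable_iff[of \<rho>]
    unfolding fin[symmetric] by auto
  have sup: "l \<in> gateaux_superdiff pairing (Lambda_star \<epsilon> \<phi>0 \<phi>1) \<rho> \<longleftrightarrow> maximizers \<epsilon> \<phi>0 \<phi>1 \<rho> = {l}" for l \<rho>
    using gateaux_superdiff_iff[of l \<rho>] unfolding fin[symmetric] .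
  \<comment> \<open>With this inclusion, the restriction to \<open>profiles\<close> in the case
    distinction excludes no singleton.\<close>
  have "maximizers \<epsilon> \<phi>0 \<phi>1 \<rho> \<subseteq> profiles \<phi>0 \<phi>1" for \<rho>
    using profile_class_in_profiles unfolding maximizers_eq by blast
  then have sup_empty: "gateaux_superdiff pairing (Lambda_star \<epsilon> \<phi>0 \<phi>1) \<rho> = {}"
    if "\<not> (\<exists>\<phi>\<in>profiles \<phi>0 \<phi>1. maximizers \<epsilon> \<phi>0 \<phi>1 \<rho> = {\<phi>})" for \<rho>
    using that sup by blast
  have "\<bar>Lambda_star \<epsilon> \<phi>0 \<phi>1 \<rho>\<bar> \<noteq> \<infinity>" for \<rho> by (subst Lambda_star_finite) simp
  moreover have "gateaux_superdiff pairing (Lambda_star \<epsilon> \<phi>0 \<phi>1) \<rho> = {\<phi>}"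
    if "maximizers \<epsilon> \<phi>0 \<phi>1 \<rho> = {\<phi>}" for \<rho> \<phi>
    using sup that by (intro set_eqI) auto
  ultimately show ?thesis
    by (intro conjI allI ballI impI lower_semicontinuous_Lambda_star convex_G sub sup_empty)
qed

end
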